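(* The fermion operator $\psi(z)=\sum_{n\in\mathbb Z}\psi_{n+\frac12}z^{-n-1}$ generates a vertex operator superalgebra $(\mathcal F_{NS},V,\Omega,\omega)$, with Virasoro vector $\omega=\frac12\psi_{-3/2}\psi_{-1/2}\Omega$.
   Context: The fermion algebra is generated by $(\psi_n)_{n\in\mathbb Z+1/2}$ and $I$ central, with $[\psi_m,\psi_n]_+=\delta_{m+n,0}I$, $\psi_n^\star=\psi_{-n}$. $H=\mathcal F_{NS}$ is its module freely generated by a vector $\Omega\ne0$ with $\psi_m\Omega=0$ for $m>0$ and $I\Omega=\Omega$; it is a prehilbert space for the inner product with $(\Omega,\Omega)=1$ and $(\psi_nu,v)=(u,\psi_{-n}v)$. Fields and locality. A field is $A(z)=\sum_{n\in\mathbb Z}A(n)z^{-n-1}\in(\mathrm{End}\,H)[[z,z^{-1}]]$. Two fields $A,B$ are local with sign $\varepsilon\in\mathbb Z_2$ if there is $N\in\mathbb N$ such that for all $c,d\in H$ there is $X\in(z-w)^{-N}\mathbb C[z^{\pm1},w^{\pm1}]$ with $X(z,w)=(A(z)B(w)c,d)$ for $|z|>|w|$ and $X(z,w)=(-1)^\varepsilon(B(w)A(z)c,d)$ for $|w|>|z|$. With $[X,Y]_\varepsilon=XY-(-1)^\varepsilon YX$, one defines $A_nB(w)=\sum_m(A_nB)(m)w^{-m-1}$ by $(A_nB)(m)=\sum_{p=0}^n(-1)^p\binom np[A(n-p),B(m+p)]_\varepsilon$ if $n\ge0$ and $(A_nB)(m)=\sum_{p\ge0}\binom{p-n-1}p\big(A(n-p)B(m+p)-(-1)^{\varepsilon+n}B(m+n-p)A(p)\big)$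 if $n<0$. "$\psi$ generates": let $S$ be the smallest set of fields containing $\mathrm{Id},\psi$ and stable under $(A,B)\mapsto A_nB$ ($n\in\mathbb Z$) and $A\mapsto A'=\frac{d}{dz}A$; $\mathcal S$ is its linear span; $V:H\to\mathcal S$ is the inverse of the linear bijection $\mathcal S\to H$, $A\mapsto A(z)\Omega|_{z=0}$ (so $V(\psi_{-1/2}\Omega,z)=\psi(z)$). A vertex operator superalgebra is $(H,V,\Omega,\omega)$ with $H=H_{\bar0}\oplus H_{\bar1}$ a prehilbert superspace, $V:H\to(\mathrm{End}\,H)[[z,z^{-1}]]$ linear ($V(a)(z)$ written $V(a,z)$), $\Omega,\omega\in H$, such that, with $\mathcal S_\varepsilon=V(H_\varepsilon)$, $\mathcal S=\mathcal S_{\bar0}\oplus\mathcal S_{\bar1}$: (1) for all $A\in\mathcal S$, $n\in\mathbb N$: $A(n)\Omega=0$; $V(a,z)\Omega|_{z=0}=a$; $V(\Omega,z)=\mathrm{Id}$. (2) $\{A(n):A\in\mathcal S,n\in\mathbb Z\}$ acts irreducibly on $H$. (3) for $A\in\mathcal S_{\varepsilon_1}$, $B\in\mathcal S_{\varepsilon_2}$: $A,B$ are local with sign $\varepsilon_1\varepsilon_2$, and $A_nB\in\mathcal S_{\varepsilon_1+\varepsilon_2}$. (4) $V(\omega,z)=\sum_nL_nz^{-n-2}$ with $L_0\Omega=L_{-1}\Omega=0$, $\omega=L_{-2}\Omega$, and $[L_m,L_n]=(m-n)L_{m+n}+\frac c{12}m(m^2-1)\delta_{m+n,0}$, $c=2\|\omega\|^2$.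 (5) $L_0$ decomposes $H$ into $\bigoplus_{n\in\frac12\mathbb N}H_n$ ($L_0=n$ on $H_n$), $\dim H_n<\infty$, $H_n\perp H_m$ for $n\ne m$, $H_\varepsilon=\bigoplus_{n\in\mathbb N+\varepsilon/2}H_n$, $\Omega\in H_0$, $\omega\in H_2$, and $[L_0,V(a,z)]=zV'(a,z)+\alpha V(a,z)$ for $a\in H_\alpha$. (6) $[L_{-1},V(a,z)]=V'(a,z)=V(L_{-1}a,z)\in\mathcal S$. *)

theory Defs
  imports
    "HOL-Analysis.Infinite_Sum"
    "HOL-Library.Function_Algebras"
    "HOL-Library.Poly_Mapping"
    "HOL-Library.Z2"
begin

text \<open>Complex vector spaces are given by a scalar multiplication \<open>smul\<close> satisfying the locale
  \<^locale>\<open>vector_space\<close>. Inner products are linear in the first argument.\<close>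

locale prehilbert = vector_space smul
  for smul :: "complex \<Rightarrow> 'h::ab_group_add \<Rightarrow> 'h" +
  fixes ip :: "'h \<Rightarrow> 'h \<Rightarrow> complex"
  assumes ip_add: "ip (u + v) w = ip u w + ip v w"
    and ip_scale: "ip (smul c u) w = c * ip u w"
    and ip_sym: "ip u v = cnj (ip v u)"
    and ip_pos: "u \<noteq> 0 \<Longrightarrow> Re (ip u u) > 0"

text \<open>\<open>U\<close> is the internal direct sum of the subspaces \<open>W i\<close>, \<open>i \<in> I\<close>.\<close>

definition direct_sum_on :: "'i set \<Rightarrow> ('i \<Rightarrow> 'a::ab_group_add set) \<Rightarrow> 'a set \<Rightarrow> bool" where
  "direct_sum_on I W U \<longleftrightarrow>
     bij_betw (\<lambda>f. \<Sum>i | f i \<noteq> 0. f i)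
       {f. finite {i. f i \<noteq> 0} \<and> (\<forall>i\<in>I. f i \<in> W i) \<and> (\<forall>i. i \<notin> I \<longrightarrow> f i = 0)} U"


section \<open>Fields\<close>

text \<open>The field \<open>A(z) = \<Sum>n. A(n) z^(-n-1)\<close> is represented by its family of modes \<open>n \<mapsto> A(n)\<close>.
  Addition and zero of fields are the pointwise ones.\<close>

type_synonym 'h field = "int \<Rightarrow> 'h \<Rightarrow> 'h"

definition is_field :: "(complex \<Rightarrow> 'h \<Rightarrow> 'h) \<Rightarrow> 'h::ab_group_add field \<Rightarrow> bool" where
  "is_field smul A \<longleftrightarrow> (\<forall>n. Vector_Spaces.linear smul smul (A n))"

definition field_scale :: "(complex \<Rightarrow> 'h \<Rightarrow> 'h) \<Rightarrow> complex \<Rightarrow> 'h field \<Rightarrow> 'h field" where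
  "field_scale smul c A = (\<lambda>n v. smul c (A n v))"

definition field_id :: "'h::zero field" where
  "field_id = (\<lambda>n v. if n = -1 then v else 0)"

definition field_deriv :: "(complex \<Rightarrow> 'h \<Rightarrow> 'h) \<Rightarrow> 'h field \<Rightarrow> 'h field" where
  "field_deriv smul A = (\<lambda>n v. smul (of_int (- n)) (A (n - 1) v))"

definition parity_sign :: "bit \<Rightarrow> complex" where
  "parity_sign \<epsilon> = (if \<epsilon> = 0 then 1 else -1)"

definition scomm ::
  "(complex \<Rightarrow> 'h::ab_group_add \<Rightarrow> 'h) \<Rightarrow> bit \<Rightarrow> ('h \<Rightarrow> 'h) \<Rightarrow> ('h \<Rightarrow> 'h) \<Rightarrow> 'h \<Rightarrow> 'h" where
  "scomm smul \<epsilon> X Y v = X (Y v) - smul (parity_sign \<epsilon>) (Y (X v))"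

text \<open>Elements of \<open>\<complex>[z\<^sup>\<plusminus>\<^sup>1, w\<^sup>\<plusminus>\<^sup>1]\<close> are finitely supported families of coefficients.\<close>

definition laurent_eval :: "(int \<times> int \<Rightarrow>\<^sub>0 complex) \<Rightarrow> complex \<Rightarrow> complex \<Rightarrow> complex" where
  "laurent_eval P z w =
     (\<Sum>(i, j)\<in>Poly_Mapping.keys P. Poly_Mapping.lookup P (i, j) * z powi i * w powi j)"

text \<open>The points with \<open>z = 0\<close> or \<open>w = 0\<close> are excluded, as negative powers occur.\<close>

definition local_fields ::
  "('h \<Rightarrow> 'h \<Rightarrow> complex) \<Rightarrow> bit \<Rightarrow> 'h field \<Rightarrow> 'h field \<Rightarrow> bool" where
  "local_fields ip \<epsilon> A B \<longleftrightarrow> (\<exists>N::nat. \<forall>c d. \<exists>P.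
     (\<forall>z w. w \<noteq> 0 \<and> norm z > norm w \<longrightarrow>
       ((\<lambda>(n, m). ip (A n (B m c)) d * z powi (- n - 1) * w powi (- m - 1))
          has_sum (laurent_eval P z w / (z - w) ^ N)) UNIV) \<and>
     (\<forall>z w. z \<noteq> 0 \<and> norm w > norm z \<longrightarrow>
       ((\<lambda>(n, m). parity_sign \<epsilon> * ip (B m (A n c)) d * z powi (- n - 1) * w powi (- m - 1))
          has_sum (laurent_eval P z w / (z - w) ^ N)) UNIV))"

text \<open>The product \<open>A\<^sub>nB\<close> of two fields which are local with sign \<open>\<epsilon>\<close>. For \<open>n < 0\<close> the infinite
  sum is taken vector by vector, where only finitely many terms are nonzero in all cases of
  interest.\<close>

definition field_prod ::
  "(complex \<Rightarrow> 'h::ab_group_add \<Rightarrow> 'h) \<Rightarrow> bit \<Rightarrow> int \<Rightarrow> 'h field \<Rightarrow> 'h field \<Rightarrow> 'h field" where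
  "field_prod smul \<epsilon> n A B = (\<lambda>m v.
     if n \<ge> 0 then
       (\<Sum>p = 0..nat n. smul ((-1) ^ p * of_nat (nat n choose p))
          (scomm smul \<epsilon> (A (n - int p)) (B (m + int p)) v))
     else
       Sum_any (\<lambda>p::nat. smul (of_nat (nat (int p - n - 1) choose p))
          (A (n - int p) (B (m + int p) v)
           - smul (parity_sign \<epsilon> * (-1) powi n) (B (m + n - int p) (A (int p) v)))))"


section \<open>Vertex operator superalgebras\<close>

text \<open>\<open>par \<epsilon>\<close> is the component \<open>H\<^sub>\<epsilon>\<close> of the superspace \<open>H\<close>.\<close>

locale vertex_operator_superalgebra = prehilbert smul ip
  for smul :: "complex \<Rightarrow> 'h::ab_group_add \<Rightarrow> 'h" and ip +
  fixes par :: "bit \<Rightarrow> 'h set"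
    and V :: "'h \<Rightarrow> 'h field"
    and \<Omega> \<omega> :: 'h
    and \<S>\<^sub>p :: "bit \<Rightarrow> 'h field set" and \<S> :: "'h field set"
    and L :: "int \<Rightarrow> 'h \<Rightarrow> 'h"
    and E :: "real \<Rightarrow> 'h set"
  defines "\<S>\<^sub>p \<equiv> \<lambda>\<epsilon>. V ` par \<epsilon>"
    and "\<S> \<equiv> range V"
    and "L \<equiv> \<lambda>n. V \<omega> (n + 1)"  \<comment> \<open>\<open>V(\<omega>,z) = \<Sum>n. L n z^(-n-2)\<close>\<close>
    and "E \<equiv> \<lambda>n. {v. V \<omega> 1 v = smul (of_real n) v}"  \<comment> \<open>the eigenspaces of \<open>L 0\<close>\<close>
  assumes superspace: "\<forall>\<epsilon>. subspace (par \<epsilon>)" "direct_sum_on UNIV par UNIV"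
    and V_field: "\<forall>a. is_field smul (V a)"
    and V_linear: "Vector_Spaces.linear smul (field_scale smul) V"
    and fields_superspace: "direct_sum_on UNIV \<S>\<^sub>p \<S>"
    and vacuum: "\<forall>A\<in>\<S>. \<forall>n\<ge>0. A n \<Omega> = 0"
    and creation: "\<forall>a. V a (-1) \<Omega> = a"
    and V_vacuum: "V \<Omega> = field_id"
    and nontrivial: "\<exists>v::'h. v \<noteq> 0"
    and irreducible:
      "\<forall>W. subspace W \<and> (\<forall>A\<in>\<S>. \<forall>n. A n ` W \<subseteq> W) \<longrightarrow> W = {0} \<or> W = UNIV"
    and locality:
      "\<forall>\<epsilon>\<^sub>1 \<epsilon>\<^sub>2. \<forall>A\<in>\<S>\<^sub>p \<epsilon>\<^sub>1. \<forall>B\<in>\<S>\<^sub>p \<epsilon>\<^sub>2. local_fields ip (\<epsilon>\<^sub>1 * \<epsilon>\<^sub>2) A B"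
    and products:
      "\<forall>\<epsilon>\<^sub>1 \<epsilon>\<^sub>2. \<forall>A\<in>\<S>\<^sub>p \<epsilon>\<^sub>1. \<forall>B\<in>\<S>\<^sub>p \<epsilon>\<^sub>2. \<forall>n.
         field_prod smul (\<epsilon>\<^sub>1 * \<epsilon>\<^sub>2) n A B \<in> \<S>\<^sub>p (\<epsilon>\<^sub>1 + \<epsilon>\<^sub>2)"
    \<comment> \<open>the central charge is \<open>c = 2 * ip \<omega> \<omega>\<close>\<close>
    and virasoro_vacuum: "L 0 \<Omega> = 0" "L (-1) \<Omega> = 0" "\<omega> = L (-2) \<Omega>"
    and virasoro:
      "\<forall>m n v. L m (L n v) - L n (L m v) =
         smul (of_int (m - n)) (L (m + n) v) +
         smul (if m + n = 0 then 2 * ip \<omega> \<omega> / 12 * of_int (m * (m ^ 2 - 1)) else 0) v"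
    and grading: "direct_sum_on {real k / 2 | k. True} E UNIV"
    and finite_dim: "\<forall>n\<in>{real k / 2 | k. True}. \<exists>B. finite B \<and> span B = E n"
    and orthogonal:
      "\<forall>n\<in>{real k / 2 | k. True}. \<forall>m\<in>{real k / 2 | k. True}. n \<noteq> m \<longrightarrow>
         (\<forall>u\<in>E n. \<forall>v\<in>E m. ip u v = 0)"
    and parity_grading:
      "direct_sum_on {real k | k. True} E (par 0)"
      "direct_sum_on {real k + 1 / 2 | k. True} E (par 1)"
    and degrees: "\<Omega> \<in> E 0" "\<omega> \<in> E 2"
    \<comment> \<open>\<open>[L 0, A(z)] = z A'(z) + \<alpha> A(z)\<close>; the coefficient of \<open>z^(-m-1)\<close> in \<open>z A'(z)\<close> is mode \<open>m + 1\<close>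
      of \<open>A'\<close>\<close>
    and L0_commutator:
      "\<forall>\<alpha>\<in>{real k / 2 | k. True}. \<forall>a\<in>E \<alpha>. \<forall>m v.
         L 0 (V a m v) - V a m (L 0 v) =
         field_deriv smul (V a) (m + 1) v + smul (of_real \<alpha>) (V a m v)"
    and translation:
      "\<forall>a m v. L (-1) (V a m v) - V a m (L (-1) v) = field_deriv smul (V a) m v"
      "\<forall>a. field_deriv smul (V a) = V (L (-1) a)"
      "\<forall>a. field_deriv smul (V a) \<in> \<S>"


section \<open>The vertex operators generated by a field\<close>

inductive_set generated_fields ::
  "(complex \<Rightarrow> 'h::ab_group_add \<Rightarrow> 'h) \<Rightarrow> ('h \<Rightarrow> 'h \<Rightarrow> complex) \<Rightarrow> 'h field \<Rightarrow> 'h field set"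
  for smul ip \<psi> where
  identity: "field_id \<in> generated_fields smul ip \<psi>"
| generator: "\<psi> \<in> generated_fields smul ip \<psi>"
| product: "\<lbrakk>A \<in> generated_fields smul ip \<psi>; B \<in> generated_fields smul ip \<psi>;
     local_fields ip \<epsilon> A B\<rbrakk> \<Longrightarrow> field_prod smul \<epsilon> n A B \<in> generated_fields smul ip \<psi>"
| derivative: "A \<in> generated_fields smul ip \<psi> \<Longrightarrow>
     field_deriv smul A \<in> generated_fields smul ip \<psi>"

definition field_space ::
  "(complex \<Rightarrow> 'h::ab_group_add \<Rightarrow> 'h) \<Rightarrow> ('h \<Rightarrow> 'h \<Rightarrow> complex) \<Rightarrow> 'h field \<Rightarrow> 'h field set" where
  "field_space smul ip \<psi> = module.span (field_scale smul) (generated_fields smul ip \<psi>)"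

text \<open>\<open>A(z)\<Omega>\<close> at \<open>z = 0\<close>, for fields with \<open>A(n)\<Omega> = 0\<close> for \<open>n \<ge> 0\<close>.\<close>

definition state :: "'h \<Rightarrow> 'h field \<Rightarrow> 'h" where
  "state \<Omega> A = A (-1) \<Omega>"

definition vertex_map ::
  "(complex \<Rightarrow> 'h::ab_group_add \<Rightarrow> 'h) \<Rightarrow> ('h \<Rightarrow> 'h \<Rightarrow> complex) \<Rightarrow> 'h field \<Rightarrow> 'h \<Rightarrow> 'h \<Rightarrow> 'h field"
  where "vertex_map smul ip \<psi> \<Omega> = the_inv_into (field_space smul ip \<psi>) (state \<Omega>)"


section \<open>The fermion algebra and its Neveu-Schwarz module\<close>

text \<open>The half-integer index \<open>k + 1/2\<close> is encoded by the integer \<open>k\<close>: \<open>Psi k\<close> and \<open>psi k\<close> stand for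
  \<open>\<psi>\<close> of index \<open>k + 1/2\<close>. Thus \<open>-(k + 1/2)\<close> is encoded by \<open>- k - 1\<close>, positive indices by
  \<open>k \<ge> 0\<close>, and \<open>psi\<close> is itself the family of modes of \<open>\<psi>(z)\<close>.\<close>

datatype fermion_generator = Psi int | Central

text \<open>The free algebra on the generators consists of the finitely supported combinations of words.
  \<open>NS_relations\<close> is the left ideal of all elements which, by the defining relations of the
  fermion algebra and those imposed on \<open>\<Omega>\<close>, have to annihilate \<open>\<Omega>\<close>. It contains the multiples
  \<open>u r v\<close> of the algebra relations \<open>r\<close>, and the left multiples \<open>u r\<close> of the relations \<open>r\<close>
  imposed on \<open>\<Omega>\<close>.\<close>

inductive_set NS_relations :: "(fermion_generator list \<Rightarrow>\<^sub>0 complex) set" where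
  zero: "0 \<in> NS_relations"
| add: "x \<in> NS_relations \<Longrightarrow> y \<in> NS_relations \<Longrightarrow> x + y \<in> NS_relations"
| anticommute:
    "Poly_Mapping.single (u @ [Psi m, Psi n] @ v) c + Poly_Mapping.single (u @ [Psi n, Psi m] @ v) c
       - (if m + n + 1 = 0 then Poly_Mapping.single (u @ [Central] @ v) c else 0) \<in> NS_relations"
| central:
    "Poly_Mapping.single (u @ [Central, Psi m] @ v) c
       - Poly_Mapping.single (u @ [Psi m, Central] @ v) c \<in> NS_relations"
| annihilate: "m \<ge> 0 \<Longrightarrow> Poly_Mapping.single (u @ [Psi m]) c \<in> NS_relations"
| unit: "Poly_Mapping.single (u @ [Central]) c - Poly_Mapping.single u c \<in> NS_relations"

primrec generator_action ::
  "(int \<Rightarrow> 'h \<Rightarrow> 'h) \<Rightarrow> ('h \<Rightarrow> 'h) \<Rightarrow> fermion_generator \<Rightarrow> 'h \<Rightarrow> 'h" where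
  "generator_action psi I (Psi k) = psi k"
| "generator_action psi I Central = I"

text \<open>The element \<open>x \<cdot> \<Omega>\<close>, for \<open>x\<close> in the free algebra.\<close>

definition orbit_map ::
  "(complex \<Rightarrow> 'h::ab_group_add \<Rightarrow> 'h) \<Rightarrow> (int \<Rightarrow> 'h \<Rightarrow> 'h) \<Rightarrow> ('h \<Rightarrow> 'h) \<Rightarrow> 'h \<Rightarrow>
   (fermion_generator list \<Rightarrow>\<^sub>0 complex) \<Rightarrow> 'h" where
  "orbit_map smul psi I \<Omega> x =
     (\<Sum>w\<in>Poly_Mapping.keys x. smul (Poly_Mapping.lookup x w) (foldr (generator_action psi I) w \<Omega>))"

locale fermion_representation = vector_space smul
  for smul :: "complex \<Rightarrow> 'h::ab_group_add \<Rightarrow> 'h" +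
  fixes psi :: "int \<Rightarrow> 'h \<Rightarrow> 'h" and I :: "'h \<Rightarrow> 'h"
  assumes psi_linear: "Vector_Spaces.linear smul smul (psi k)"
    and I_linear: "Vector_Spaces.linear smul smul I"
    and psi_anticommute: "psi m (psi n v) + psi n (psi m v) = (if m + n + 1 = 0 then I v else 0)"
    and I_central: "I (psi m v) = psi m (I v)"

text \<open>Freeness means that all relations satisfied by \<open>\<Omega>\<close> are consequences of the imposed ones,
  i.e. that the module is presented by \<open>NS_relations\<close>.\<close>

locale NS_module = fermion_representation smul psi I + prehilbert smul ip
  for smul :: "complex \<Rightarrow> 'h::ab_group_add \<Rightarrow> 'h" and ip psi I +
  fixes \<Omega> :: 'h
  assumes vacuum_nonzero: "\<Omega> \<noteq> 0"
    and vacuum_annihilated: "m \<ge> 0 \<Longrightarrow> psi m \<Omega> = 0"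
    and I_vacuum: "I \<Omega> = \<Omega>"
    and generated: "surj (orbit_map smul psi I \<Omega>)"
    and free: "orbit_map smul psi I \<Omega> x = 0 \<Longrightarrow> x \<in> NS_relations"
    and ip_vacuum: "ip \<Omega> \<Omega> = 1"
    and psi_adjoint: "ip (psi k u) v = ip u (psi (- k - 1) v)"

end

theory Submission
  imports Defs "HOL-Complex_Analysis.Cauchy_Integral_Formula"
begin

text \<open>
  Locality of two fields is equivalent to the formal identity \<open>(z - w)^N [A(z), B(w)] = 0\<close>, once the matrix
  coefficients of the fields have suitable supports. Consider the fields of given parity which annihilate the vacuum
  with their modes \<open>n \<ge> 0\<close>, are translation covariant with respect to the Virasoro operator \<open>L\<^bsub>-1\<^esub>\<close>, and are local
  with respect to \<open>\<psi>\<close>. By Dong's lemma they contain all iterated products \<open>\<psi>\<^sub>k(\<dots>)\<close>, whose states are the words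
  \<open>\<psi>\<^sub>k \<dots> \<Omega>\<close> spanning \<open>H\<close>; by Goddard's uniqueness theorem such a field is determined by its state. So these fields
  are exactly the combinations of iterated products, and again by Dong's lemma they are mutually local and closed
  under all products.

  The Virasoro operators are the modes of \<open>\<psi>\<^bsub>-2\<^esub>\<psi> / 2\<close>. Their commutators with \<open>\<psi>\<close> are computed from the
  anticommutation relations; hence \<open>[L\<^sub>m, L\<^sub>n] - (m - n) L\<^bsub>m+n\<^esub>\<close> commutes with \<open>\<psi>\<close> and is a scalar, which follows from
  its value at \<open>m = 2\<close> by a recursion coming from \<open>[L\<^bsub>-1\<^esub>, L\<^bsub>-m\<^esub>] = (m - 1) L\<^bsub>-m-1\<^esub>\<close>. All gradings are read off from
  the eigenvectors of \<open>L\<^sub>0\<close> formed by the words.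
\<close>

text \<open>The obstacle is an apparent circle. \<open>generated_fields\<close> admits a product
  only after analytic locality is known, and passing between analytic and formal locality uses that
  the matrix coefficients vanish for very negative modes. This is clear for homogeneous fields, but
  it is no part of the description of the fields under study. That description therefore uses formal
  locality, and only with respect to psi. The missing properties (mutual locality, vanishing for
  negative modes, membership in the span) are proved for combinations of the iterated products,
  which are homogeneous, and are carried to every field of the family by uniqueness of the field
  with a given state. The inner product serves three ends: matrix coefficients determine operators,
  eigenspaces of L_0 are orthogonal, and the vectors killed by all psi_k with k >= 0 are the
  multiples of the vacuum. The factor 1/2 in omega normalises psi_{-2}psi, the normally ordered
  product of psi' and psi, so that psi is primary of weight 1/2; the central charge is then 2 * 1/4
  = 1/2.\<close>

section \<open>Formal calculus in two and three variables\<close>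

text \<open>Multiplication of the series with coefficients \<open>F n m\<close> at \<open>z^(-n-1) w^(-m-1)\<close> by \<open>z - w\<close>.\<close>

definition zw_mult :: "(int \<Rightarrow> int \<Rightarrow> 'a::ab_group_add) \<Rightarrow> int \<Rightarrow> int \<Rightarrow> 'a" where
  "zw_mult F = (\<lambda>n m. F (n + 1) m - F n (m + 1))"

lemma zw_mult_pow_zero [simp]: "(zw_mult ^^ N) (\<lambda>n m. 0) = (\<lambda>n m. 0)"
  by (induction N) (simp_all add: zw_mult_def algebra_simps)

lemma zw_mult_pow_diff:
  "(zw_mult ^^ N) (\<lambda>n m. F n m - G n m) = (\<lambda>n m. (zw_mult ^^ N) F n m - (zw_mult ^^ N) G n m)"
  by (induction N) (simp_all add: zw_mult_def algebra_simps)

lemma zw_mult_pow_add: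
  "(zw_mult ^^ N) (\<lambda>n m. F n m + G n m) = (\<lambda>n m. (zw_mult ^^ N) F n m + (zw_mult ^^ N) G n m)"
  by (induction N) (simp_all add: zw_mult_def algebra_simps)

lemma zw_mult_pow_map:
  assumes "\<And>x y. h (x - y) = h x - h y"
  shows "(zw_mult ^^ N) (\<lambda>n m. h (F n m)) = (\<lambda>n m. h ((zw_mult ^^ N) F n m))"
  by (induction N) (simp_all add: zw_mult_def assms)

text \<open>Exchanging the variables turns z - w into w - z, whence the sign for odd N. It lets
  statements on |z| > |w| be carried over to |w| > |z|.\<close>

lemma zw_mult_pow_swap:
  "(zw_mult ^^ N) (\<lambda>n m. F m n) n m = (if even N then (zw_mult ^^ N) F m n else - (zw_mult ^^ N) F m n)"
  by (induction N arbitrary: n m) (auto simp add: zw_mult_def)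

lemma zw_mult_pow_mono:
  assumes "(zw_mult ^^ N) F = (\<lambda>n m. 0)" "N \<le> M"
  shows "(zw_mult ^^ M) F = (\<lambda>n m. 0)"
proof -
  have "(zw_mult ^^ M) F = (zw_mult ^^ (M - N)) ((zw_mult ^^ N) F)"
    using assms(2) by (metis comp_apply funpow_add le_add_diff_inverse2)
  then show ?thesis using assms(1) by simp
qed

text \<open>A series killed by z - w is constant along each line n + m = const, as the delta
  function is. The support condition forces this constant to be 0, because every such line reaches
  the region m >= M.\<close>

lemma zw_mult_pow_inj:
  assumes "(zw_mult ^^ N) F = (\<lambda>n m. 0)" and "\<And>n m. m \<ge> M \<Longrightarrow> F n m = 0"
  shows "F = (\<lambda>n m. 0)"
  using assms
proof (induction N arbitrary: F)
  case (Suc N)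
  have *: "zw_mult F = (\<lambda>n m. 0)"
    by (rule Suc.IH) (use Suc.prems in \<open>simp_all add: funpow_swap1, simp add: zw_mult_def\<close>)
  have step: "F n m = F (n - 1) (m + 1)" for n m
    using fun_cong[OF fun_cong[OF *, of "n - 1"], of m] by (simp add: zw_mult_def)
  have "F n m = F (n - int j) (m + int j)" for n m j
    by (induction j) (simp, subst (asm) step, simp add: algebra_simps)
  then have "F n m = F (n - int (nat (M - m))) (m + int (nat (M - m)))" for n m
    by blast
  then have "F n m = 0" for n m
    using Suc.prems(2)[of "m + int (nat (M - m))" "n - int (nat (M - m))"] by simp
  then show ?case by blast
qed simp

section \<open>Series in three variables z, w, u\<close>

definition mult12 :: "(int \<Rightarrow> int \<Rightarrow> int \<Rightarrow> 'a::ab_group_add) \<Rightarrow> int \<Rightarrow> int \<Rightarrow> int \<Rightarrow> 'a" where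
  "mult12 F = (\<lambda>i m k. F (i + 1) m k - F i (m + 1) k)"

definition mult13 :: "(int \<Rightarrow> int \<Rightarrow> int \<Rightarrow> 'a::ab_group_add) \<Rightarrow> int \<Rightarrow> int \<Rightarrow> int \<Rightarrow> 'a" where
  "mult13 F = (\<lambda>i m k. F (i + 1) m k - F i m (k + 1))"

definition mult23 :: "(int \<Rightarrow> int \<Rightarrow> int \<Rightarrow> 'a::ab_group_add) \<Rightarrow> int \<Rightarrow> int \<Rightarrow> int \<Rightarrow> 'a" where
  "mult23 F = (\<lambda>i m k. F i (m + 1) k - F i m (k + 1))"

lemma mult12_pow: "(mult12 ^^ N) F i m k = (zw_mult ^^ N) (\<lambda>i m. F i m k) i m"
  by (induction N arbitrary: i m k) (simp_all add: mult12_def zw_mult_def)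

lemma mult13_pow: "(mult13 ^^ N) F i m k = (zw_mult ^^ N) (\<lambda>i k. F i m k) i k"
  by (induction N arbitrary: i m k) (simp_all add: mult13_def zw_mult_def)

lemma mult23_pow: "(mult23 ^^ N) F i m k = (zw_mult ^^ N) (\<lambda>m k. F i m k) m k"
  by (induction N arbitrary: i m k) (simp_all add: mult23_def zw_mult_def)

lemma funpow_commute:
  assumes "\<And>x. f (g x) = g (f x)"
  shows "(f ^^ a) ((g ^^ b) x) = (g ^^ b) ((f ^^ a) x)"
proof -
  have 1: "f ((g ^^ b) x) = (g ^^ b) (f x)" for x
    by (induction b) (simp_all add: assms)
  show ?thesis by (induction a) (simp_all add: 1)
qed

lemma mult_commute:
  "mult12 (mult23 F) = mult23 (mult12 F)" "mult13 (mult23 F) = mult23 (mult13 F)"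
  "mult12 (mult13 F) = mult13 (mult12 F)"
  by (simp_all add: mult12_def mult13_def mult23_def fun_eq_iff algebra_simps)

lemma mult12_pow_zero [simp]: "(mult12 ^^ N) (\<lambda>i m k. 0) = (\<lambda>i m k. 0)"
  by (induction N) (simp_all add: mult12_def)

lemma mult13_pow_zero [simp]: "(mult13 ^^ N) (\<lambda>i m k. 0) = (\<lambda>i m k. 0)"
  by (induction N) (simp_all add: mult13_def algebra_simps)

lemma mult23_pow_zero [simp]: "(mult23 ^^ N) (\<lambda>i m k. 0) = (\<lambda>i m k. 0)"
  by (induction N) (simp_all add: mult23_def algebra_simps)

lemma mult23_pow_diff:
  "(mult23 ^^ N) (\<lambda>i m k. F i m k - G i m k) = (\<lambda>i m k. (mult23 ^^ N) F i m k - (mult23 ^^ N) G i m k)"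
  by (induction N) (simp_all add: mult23_def algebra_simps)

lemma mult13_pow_diff:
  "(mult13 ^^ N) (\<lambda>i m k. F i m k - G i m k) = (\<lambda>i m k. (mult13 ^^ N) F i m k - (mult13 ^^ N) G i m k)"
  by (induction N) (simp_all add: mult13_def algebra_simps)

text \<open>Since \<open>w - u = (z - u) - (z - w)\<close>.\<close>

lemma mult23_pow_vanish:
  assumes "(mult12 ^^ a) F = (\<lambda>i m k. 0)" "(mult13 ^^ b) F = (\<lambda>i m k. 0)"
  shows "(mult23 ^^ (a + b)) F = (\<lambda>i m k. 0)"
  using assms
proof (induction "a + b" arbitrary: a b F)
  case 0
  then show ?case by simp
next
  case (Suc n)
  show ?case
  proof (cases "a = 0 \<or> b = 0")
    case True
    then have "F = (\<lambda>i m k. 0)" using Suc.prems by auto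
    then show ?thesis by simp
  next
    case False
    then obtain a' b' where ab: "a = Suc a'" "b = Suc b'" by (meson not0_implies_Suc)
    \<comment> \<open>\<open>mult12 F\<close> needs one factor z - w less, and (z - u)^b still kills
      it because the multiplications commute; the total a + b drops by one.\<close>
    have 1: "(mult23 ^^ (a' + b)) (mult12 F) = (\<lambda>i m k. 0)"
    proof (rule Suc.hyps(1))
      show "(mult12 ^^ a') (mult12 F) = (\<lambda>i m k. 0)"
        using Suc.prems(1) ab by (simp add: funpow_swap1)
      have "(mult13 ^^ b) ((mult12 ^^ 1) F) = (mult12 ^^ 1) ((mult13 ^^ b) F)"
        by (rule funpow_commute) (simp add: mult_commute)
      then show "(mult13 ^^ b) (mult12 F) = (\<lambda>i m k. 0)"
        using Suc.prems(2) mult12_pow_zero[of 1] by simp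
    qed (use Suc.hyps ab in auto)
    have 2: "(mult23 ^^ (a + b')) (mult13 F) = (\<lambda>i m k. 0)"
    proof (rule Suc.hyps(1))
      show "(mult13 ^^ b') (mult13 F) = (\<lambda>i m k. 0)"
        using Suc.prems(2) ab by (simp add: funpow_swap1)
      have "(mult12 ^^ a) ((mult13 ^^ 1) F) = (mult13 ^^ 1) ((mult12 ^^ a) F)"
        by (rule funpow_commute) (simp add: mult_commute)
      then show "(mult12 ^^ a) (mult13 F) = (\<lambda>i m k. 0)"
        using Suc.prems(1) mult13_pow_zero[of 1] by simp
    qed (use Suc.hyps ab in auto)
    have "mult23 F = (\<lambda>i m k. mult13 F i m k - mult12 F i m k)"
      by (simp add: mult12_def mult13_def mult23_def)
    then have "(mult23 ^^ (a + b)) F = (mult23 ^^ (a' + b)) (\<lambda>i m k. mult13 F i m k - mult12 F i m k)"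
      by (simp add: ab funpow_swap1)
    also have "\<dots> = (\<lambda>i m k. (mult23 ^^ (a + b')) (mult13 F) i m k - (mult23 ^^ (a' + b)) (mult12 F) i m k)"
      by (simp only: mult23_pow_diff) (simp add: ab)
    finally show ?thesis unfolding 1 2 by simp
  qed
qed

section \<open>Products of fields and Dong's lemma\<close>

lemma parity_sign_simps [simp]: "parity_sign 0 = 1" "parity_sign 1 = -1"
  by (simp_all add: parity_sign_def)

lemma parity_sign_add: "parity_sign (a + b) = parity_sign a * parity_sign b"
  by (cases a; cases b) (simp_all add: parity_sign_def)

lemma parity_sign_sq [simp]: "parity_sign a * parity_sign a = 1"
  by (cases a) simp_all

text \<open>The coefficient of \<open>z^(n-p) w^p\<close> in \<open>(z - w)^n\<close>, expanded for \<open>|z| > |w|\<close>.\<close>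

definition zw_coeff :: "int \<Rightarrow> nat \<Rightarrow> complex" where
  "zw_coeff n p = (-1) ^ p * (of_int n gchoose p)"

lemma zw_coeff_0 [simp]: "zw_coeff n 0 = 1" "zw_coeff 0 (Suc p) = 0"
  by (simp_all add: zw_coeff_def)

text \<open>Pascal's rule, which holds for every integer n because the generalised binomial
  coefficient is used.\<close>

lemma zw_coeff_Suc: "zw_coeff (n + 1) (Suc p) = zw_coeff n (Suc p) - zw_coeff n p"
  using gbinomial_Suc_Suc[of "of_int n :: complex" p] by (simp add: zw_coeff_def algebra_simps)

text \<open>The absorption identity. On coefficients it says that d/dw and -d/dz agree on (z - w)^n,
  which is what \<open>field_prod_derivation\<close> rests on.\<close>

lemma zw_coeff_absorb: "of_nat (Suc p) * zw_coeff n (Suc p) = - (of_int n - of_nat p) * zw_coeff n p"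
proof -
  have "of_int n * (of_int n gchoose p :: complex) = of_nat p * (of_int n gchoose p) + of_nat (Suc p) * (of_int n gchoose Suc p)"
    by (rule gbinomial_mult_1)
  then have *: "of_nat (Suc p) * (of_int n gchoose Suc p :: complex) = (of_int n - of_nat p) * (of_int n gchoose p)"
    by (simp add: algebra_simps)
  have "of_nat (Suc p) * zw_coeff n (Suc p) = - ((-1) ^ p) * (of_nat (Suc p) * (of_int n gchoose Suc p :: complex))"
    unfolding zw_coeff_def by simp
  also have "\<dots> = - (of_int n - of_nat p) * zw_coeff n p"
    unfolding * zw_coeff_def by (simp add: algebra_simps)
  finally show ?thesis .
qed

lemma zw_coeff_nat: "zw_coeff (int n) p = (-1) ^ p * of_nat (n choose p)"
  by (simp add: zw_coeff_def binomial_gbinomial)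

lemma zw_coeff_neg:
  assumes "n < 0"
  shows "zw_coeff n p = of_nat (nat (int p - n - 1) choose p)"
proof -
  have "(of_int n gchoose p :: complex) = (-1) ^ p * ((of_int (- n) + of_nat p - 1) gchoose p)"
    using gbinomial_minus[of "of_int (- n) :: complex" p] by simp
  also have "(of_int (- n) + of_nat p - 1 :: complex) = of_int (int p - n - 1)" by simp
  also have "\<dots> = of_nat (nat (int p - n - 1))"
    using assms by (simp add: of_nat_nat)
  finally show ?thesis
    by (simp add: zw_coeff_def binomial_gbinomial flip: power_mult_distrib mult.assoc)
qed

text \<open>The truncation condition that is usually part of the notion of a field: A(z)v has
  finitely many negative powers of z. It makes the sums defining A_nB finite on each vector.\<close>

definition smooth_field :: "'h::zero field \<Rightarrow> bool" where
  "smooth_field A \<longleftrightarrow> (\<forall>v. \<exists>K. \<forall>n\<ge>K. A n v = 0)"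

lemma smooth_field_bound:
  assumes "smooth_field A" "smooth_field B"
  obtains K where "\<And>n. n \<ge> K \<Longrightarrow> A n v = 0" "\<And>n. n \<ge> K \<Longrightarrow> B n w = 0"
  using assms unfolding smooth_field_def
  by (metis (no_types) linorder_linear order_trans)

locale complex_space = vector_space smul
  for smul :: "complex \<Rightarrow> 'h::ab_group_add \<Rightarrow> 'h"
begin

lemma is_field_diff: "is_field smul A \<Longrightarrow> A n (u - v) = A n u - A n v"
  and is_field_add: "is_field smul A \<Longrightarrow> A n (u + v) = A n u + A n v"
  and is_field_scale: "is_field smul A \<Longrightarrow> A n (smul c v) = smul c (A n v)"
  and is_field_zero: "is_field smul A \<Longrightarrow> A n 0 = 0"
  and is_field_sum: "is_field smul A \<Longrightarrow> A n (sum f S) = (\<Sum>x\<in>S. A n (f x))"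
  unfolding is_field_def Vector_Spaces.linear_def
  by (blast intro: module_hom.diff module_hom.add module_hom.scale module_hom.zero module_hom.sum)+

lemma is_fieldI:
  assumes "\<And>n u v. A n (u + v) = A n u + A n v" "\<And>n c v. A n (smul c v) = smul c (A n v)"
  shows "is_field smul A"
  unfolding is_field_def Vector_Spaces.linear_iff
  using assms vector_space_axioms by auto

definition prod_term :: "bit \<Rightarrow> int \<Rightarrow> 'h field \<Rightarrow> 'h field \<Rightarrow> int \<Rightarrow> 'h \<Rightarrow> nat \<Rightarrow> 'h" where
  "prod_term \<epsilon> n A B m v p = smul (zw_coeff n p)
     (A (n - int p) (B (m + int p) v)
        - smul (parity_sign \<epsilon> * (-1) powi n) (B (m + n - int p) (A (int p) v)))"

text \<open>Both cases of \<^const>\<open>field_prod\<close> are instances of this sum: for \<open>n \<ge> 0\<close>, reverse the order of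
  summation in the second half of the supercommutators.\<close>

lemma field_prod_eq_sum:
  assumes "is_field smul A" "is_field smul B"
    and "\<And>p. p \<ge> K \<Longrightarrow> B (m + int p) v = 0" "\<And>p. p \<ge> K \<Longrightarrow> A (int p) v = 0"
  shows "field_prod smul \<epsilon> n A B m v = (\<Sum>p<K. prod_term \<epsilon> n A B m v p)"
proof (cases "n < 0")
  case True
  have z: "prod_term \<epsilon> n A B m v p = 0" if "p \<notin> {..<K}" for p
    using that assms by (simp add: prod_term_def is_field_zero)
  have "field_prod smul \<epsilon> n A B m v = Sum_any (prod_term \<epsilon> n A B m v)"
    using True by (simp add: field_prod_def prod_term_def zw_coeff_neg)
  also have "\<dots> = (\<Sum>p<K. prod_term \<epsilon> n A B m v p)"
    by (rule Sum_any.expand_superset) (use z in auto)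
  finally show ?thesis .
next
  case False
  define N where "N = nat n"
  have n: "n = int N" using False by (simp add: N_def)
  let ?s = "parity_sign \<epsilon>"
  have sg: "(-1::complex) ^ (N - p) = (-1) ^ N * (-1) ^ p" if "p \<le> N" for p
    using that by (cases "even N"; cases "even p") simp_all
  have bs: "N choose (N - p) = N choose p" if "p \<le> N" for p
    using binomial_symmetric[OF that] by simp
  have "field_prod smul \<epsilon> n A B m v = (\<Sum>p=0..N. smul ((-1) ^ p * of_nat (N choose p))
      (A (n - int p) (B (m + int p) v) - smul ?s (B (m + int p) (A (n - int p) v))))"
    by (simp add: field_prod_def n scomm_def)
  also have "\<dots> = (\<Sum>p=0..N. smul (zw_coeff n p) (A (n - int p) (B (m + int p) v)))
      - (\<Sum>p=0..N. smul (zw_coeff n p * ?s) (B (m + int p) (A (n - int p) v)))"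
    by (simp add: n zw_coeff_nat scale_right_diff_distrib sum_subtractf)
  also have "(\<Sum>p=0..N. smul (zw_coeff n p * ?s) (B (m + int p) (A (n - int p) v)))
      = (\<Sum>p=0..N. smul (zw_coeff n p * (?s * (-1) powi n)) (B (m + n - int p) (A (int p) v)))"
    by (subst sum.atLeastAtMost_rev)
       (intro sum.cong refl, auto simp: n zw_coeff_nat sg bs of_nat_diff mult_ac)
  also have "(\<Sum>p=0..N. smul (zw_coeff n p) (A (n - int p) (B (m + int p) v))) - \<dots>
      = (\<Sum>p=0..N. prod_term \<epsilon> n A B m v p)"
    by (simp add: prod_term_def scale_right_diff_distrib sum_subtractf)
  \<comment> \<open>The natural range up to N and the cut-off at K need not be nested: beyond N the
    binomial coefficient vanishes, from K on the modes do.\<close>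
  also have "\<dots> = (\<Sum>p\<in>{..N} \<union> {..<K}. prod_term \<epsilon> n A B m v p)"
    unfolding atLeast0AtMost
    by (rule sum.mono_neutral_left) (auto simp: prod_term_def n zw_coeff_nat)
  also have "\<dots> = (\<Sum>p<K. prod_term \<epsilon> n A B m v p)"
    using assms by (intro sum.mono_neutral_right) (auto simp: prod_term_def is_field_zero)
  finally show ?thesis .
qed

text \<open>Stated for every large K, so that several products can be truncated at one common index
  and compared term by term.\<close>

lemma field_prod_sum_bound:
  assumes "is_field smul A" "is_field smul B" "smooth_field A" "smooth_field B"
  obtains K0 where "\<And>K. K \<ge> K0 \<Longrightarrow> field_prod smul \<epsilon> n A B m v = (\<Sum>p<K. prod_term \<epsilon> n A B m v p)"
proof -
  obtain k where k: "\<And>n. n \<ge> k \<Longrightarrow> A n v = 0" "\<And>n. n \<ge> k \<Longrightarrow> B n v = 0"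
    using smooth_field_bound[OF assms(3,4)] by metis
  show ?thesis
    by (rule that[of "nat (max k (k - m))"], rule field_prod_eq_sum)
       (use k assms in \<open>auto simp: le_max_iff_disj nat_le_iff\<close>)
qed

lemma is_field_prod:
  assumes "is_field smul A" "is_field smul B" "smooth_field A" "smooth_field B"
  shows "is_field smul (field_prod smul \<epsilon> n A B)"
proof (rule is_fieldI)
  fix m u v
  obtain K1 where K1: "\<And>K. K \<ge> K1 \<Longrightarrow> field_prod smul \<epsilon> n A B m u = (\<Sum>p<K. prod_term \<epsilon> n A B m u p)"
    using field_prod_sum_bound[OF assms] by metis
  obtain K2 where K2: "\<And>K. K \<ge> K2 \<Longrightarrow> field_prod smul \<epsilon> n A B m v = (\<Sum>p<K. prod_term \<epsilon> n A B m v p)"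
    using field_prod_sum_bound[OF assms] by metis
  obtain K3 where K3: "\<And>K. K \<ge> K3 \<Longrightarrow> field_prod smul \<epsilon> n A B m (u + v) = (\<Sum>p<K. prod_term \<epsilon> n A B m (u + v) p)"
    using field_prod_sum_bound[OF assms] by metis
  define K where "K = max K1 (max K2 K3)"
  have "K \<ge> K1" "K \<ge> K2" "K \<ge> K3" by (auto simp: K_def)
  moreover have "prod_term \<epsilon> n A B m (u + v) p = prod_term \<epsilon> n A B m u p + prod_term \<epsilon> n A B m v p" for p
    by (simp add: prod_term_def is_field_add[OF assms(1)] is_field_add[OF assms(2)] algebra_simps)
  ultimately show "field_prod smul \<epsilon> n A B m (u + v) = field_prod smul \<epsilon> n A B m u + field_prod smul \<epsilon> n A B m v"
    using K1 K2 K3 by (simp add: sum.distrib)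
next
  fix m c v
  obtain K1 where K1: "\<And>K. K \<ge> K1 \<Longrightarrow> field_prod smul \<epsilon> n A B m v = (\<Sum>p<K. prod_term \<epsilon> n A B m v p)"
    using field_prod_sum_bound[OF assms] by metis
  obtain K2 where K2: "\<And>K. K \<ge> K2 \<Longrightarrow> field_prod smul \<epsilon> n A B m (smul c v) = (\<Sum>p<K. prod_term \<epsilon> n A B m (smul c v) p)"
    using field_prod_sum_bound[OF assms] by metis
  have "prod_term \<epsilon> n A B m (smul c v) p = smul c (prod_term \<epsilon> n A B m v p)" for p
    by (simp add: prod_term_def is_field_scale[OF assms(1)] is_field_scale[OF assms(2)]
        scale_right_diff_distrib mult_ac)
  then show "field_prod smul \<epsilon> n A B m (smul c v) = smul c (field_prod smul \<epsilon> n A B m v)"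
    using K1[of "max K1 K2"] K2[of "max K1 K2"] by (simp add: scale_sum_right)
qed

text \<open>For m beyond the bound of B on v the terms A(n-p)B(m+p)v vanish. The terms in the other
  order involve only the finitely many vectors A(p)v with p < K, so the maximum of their bounds for
  B suffices; \<open>insert 0\<close> keeps that maximum meaningful when K = 0.\<close>

lemma smooth_field_prod:
  assumes "is_field smul A" "is_field smul B" "smooth_field A" "smooth_field B"
  shows "smooth_field (field_prod smul \<epsilon> n A B)"
  unfolding smooth_field_def
proof
  fix v
  obtain k where k: "\<And>n. n \<ge> k \<Longrightarrow> A n v = 0" "\<And>n. n \<ge> k \<Longrightarrow> B n v = 0"
    using smooth_field_bound[OF assms(3,4)] by metis
  define K where "K = nat k"
  have "\<forall>p. \<exists>l. \<forall>m\<ge>l. B m (A (int p) v) = 0"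
    using assms(4) by (simp add: smooth_field_def)
  then obtain l where l: "\<And>p m. m \<ge> l p \<Longrightarrow> B m (A (int p) v) = 0" by metis
  define M where "M = max k (Max (insert 0 ((\<lambda>p. l p - n + int p) ` {..<K})))"
  have M1: "M \<ge> k" by (simp add: M_def)
  have M2: "m + n - int p \<ge> l p" if "p < K" "m \<ge> M" for p m
  proof -
    have "l p - n + int p \<le> Max (insert 0 ((\<lambda>p. l p - n + int p) ` {..<K}))"
      using that by (intro Max_ge) auto
    then have "l p - n + int p \<le> M" unfolding M_def by linarith
    then show ?thesis using that by linarith
  qed
  have "field_prod smul \<epsilon> n A B m v = 0" if "m \<ge> M" for m
  proof -
    have "field_prod smul \<epsilon> n A B m v = (\<Sum>p<K. prod_term \<epsilon> n A B m v p)"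
      by (rule field_prod_eq_sum) (use assms k M1 that in \<open>auto simp: K_def nat_le_iff\<close>)
    also have "\<dots> = 0"
      by (rule sum.neutral)
         (use k M1 that l M2 in \<open>auto simp: prod_term_def is_field_zero[OF assms(1)]\<close>)
    finally show ?thesis .
  qed
  then show "\<exists>K. \<forall>m\<ge>K. field_prod smul \<epsilon> n A B m v = 0" by blast
qed

text \<open>Shifting the modes of \<open>A\<close> by \<open>i\<close> is multiplication by \<open>z^i\<close>, so this says
  \<open>(z - w) \<cdot> (z - w)^n = (z - w)^(n + 1)\<close> for both expansions of the power at once.\<close>

lemma field_prod_shift:
  assumes "is_field smul A" "is_field smul B" "smooth_field A" "smooth_field B"
  shows "field_prod smul \<epsilon> n (\<lambda>k. A (k + (i + 1))) B m v - field_prod smul \<epsilon> n (\<lambda>k. A (k + i)) B (m + 1) v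
     = field_prod smul \<epsilon> (n + 1) (\<lambda>k. A (k + i)) B m v"
proof -
  obtain k where k: "\<And>n. n \<ge> k \<Longrightarrow> A n v = 0" "\<And>n. n \<ge> k \<Longrightarrow> B n v = 0"
    using smooth_field_bound[OF assms(3,4)] by metis
  define K where "K = nat (max (k - i) (k - m))"
  have KA: "A (int p + i) v = 0" if "p \<ge> K" for p
    using that k(1)[of "int p + i"] by (simp add: K_def)
  have KB: "B (m + int p) v = 0" if "p \<ge> K" for p
    using that k(2)[of "m + int p"] by (simp add: K_def)
  have f: "is_field smul (\<lambda>k. A (k + i))" for i using assms(1) by (simp add: is_field_def)
  let ?s = "parity_sign \<epsilon>"
  \<comment> \<open>\<open>P\<close> and \<open>Q\<close> are the two orders of the product, indexed
    as they occur in A_(n+1)B. In each of the two products with n, one of these families appears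
    displaced by one index.\<close>
  define P where "P p = A (n + 1 + i - int p) (B (m + int p) v)" for p
  define Q where "Q p = smul (?s * (-1) powi n) (B (m + n + 1 - int p) (A (int p + i) v))" for p
  have pw: "(-1::complex) powi (n + 1) = - ((-1) powi n)" by (simp add: power_int_add)
  have PK: "P p = 0" if "p \<ge> K" for p
    using KB[OF that] by (simp add: P_def is_field_zero[OF assms(1)])
  have QK: "Q p = 0" if "p \<ge> K" for p
    using KA[OF that] by (simp add: Q_def is_field_zero[OF assms(2)])
  have "field_prod smul \<epsilon> n (\<lambda>k. A (k + (i + 1))) B m v =
     (\<Sum>p<Suc K. prod_term \<epsilon> n (\<lambda>k. A (k + (i + 1))) B m v p)"
    by (rule field_prod_eq_sum)
       (use assms f KB k in \<open>auto intro!: k simp: K_def\<close>)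
  also have "\<dots> = (\<Sum>p<Suc K. smul (zw_coeff n p) (P p)) - (\<Sum>p<Suc K. smul (zw_coeff n p) (Q (Suc p)))"
    unfolding sum_subtractf[symmetric]
    by (intro sum.cong refl) (simp add: prod_term_def P_def Q_def scale_right_diff_distrib algebra_simps)
  finally have 1: "field_prod smul \<epsilon> n (\<lambda>k. A (k + (i + 1))) B m v =
      (\<Sum>p<Suc K. smul (zw_coeff n p) (P p)) - (\<Sum>p<Suc K. smul (zw_coeff n p) (Q (Suc p)))" .
  have "field_prod smul \<epsilon> n (\<lambda>k. A (k + i)) B (m + 1) v =
     (\<Sum>p<Suc K. prod_term \<epsilon> n (\<lambda>k. A (k + i)) B (m + 1) v p)"
    by (rule field_prod_eq_sum)
       (use assms f KA k in \<open>auto intro!: k simp: K_def\<close>)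
  also have "\<dots> = (\<Sum>p<Suc K. smul (zw_coeff n p) (P (Suc p))) - (\<Sum>p<Suc K. smul (zw_coeff n p) (Q p))"
    unfolding sum_subtractf[symmetric]
    by (intro sum.cong refl) (simp add: prod_term_def P_def Q_def scale_right_diff_distrib algebra_simps)
  finally have 2: "field_prod smul \<epsilon> n (\<lambda>k. A (k + i)) B (m + 1) v =
      (\<Sum>p<Suc K. smul (zw_coeff n p) (P (Suc p))) - (\<Sum>p<Suc K. smul (zw_coeff n p) (Q p))" .
  have "field_prod smul \<epsilon> (n + 1) (\<lambda>k. A (k + i)) B m v =
     (\<Sum>p<Suc K. prod_term \<epsilon> (n + 1) (\<lambda>k. A (k + i)) B m v p)"
    by (rule field_prod_eq_sum)
       (use assms f KA KB in \<open>auto\<close>)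
  also have "\<dots> = (\<Sum>p<Suc K. smul (zw_coeff (n + 1) p) (P p)) + (\<Sum>p<Suc K. smul (zw_coeff (n + 1) p) (Q p))"
    unfolding sum.distrib[symmetric] prod_term_def P_def Q_def pw
    by (intro sum.cong refl) (simp add: scale_right_diff_distrib algebra_simps)
  finally have 3: "field_prod smul \<epsilon> (n + 1) (\<lambda>k. A (k + i)) B m v =
      (\<Sum>p<Suc K. smul (zw_coeff (n + 1) p) (P p)) + (\<Sum>p<Suc K. smul (zw_coeff (n + 1) p) (Q p))" .
  \<comment> \<open>Both families obey the same identity: shift p and apply Pascal's rule. The bound
    \<open>Suc K\<close> leaves room for the shift, and the boundary term vanishes with R.\<close>
  have S: "(\<Sum>p<Suc K. smul (zw_coeff n p) (R p)) - (\<Sum>p<Suc K. smul (zw_coeff n p) (R (Suc p)))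
      = (\<Sum>p<Suc K. smul (zw_coeff (n + 1) p) (R p))" if RK: "\<And>p. p \<ge> K \<Longrightarrow> R p = 0" for R
  proof -
    have a: "(\<Sum>p<Suc K. smul (zw_coeff n p) (R (Suc p))) = (\<Sum>p<K. smul (zw_coeff n p) (R (Suc p)))"
      using RK by simp
    have b: "(\<Sum>p<Suc K. smul (zw_coeff n p) (R p)) = R 0 + (\<Sum>p<K. smul (zw_coeff n (Suc p)) (R (Suc p)))"
      unfolding sum.lessThan_Suc_shift by simp
    have c: "(\<Sum>p<Suc K. smul (zw_coeff (n + 1) p) (R p))
        = R 0 + ((\<Sum>p<K. smul (zw_coeff n (Suc p)) (R (Suc p))) - (\<Sum>p<K. smul (zw_coeff n p) (R (Suc p))))"
      unfolding sum.lessThan_Suc_shift zw_coeff_Suc scale_left_diff_distrib sum_subtractf by simp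
    show ?thesis unfolding a b c by (simp only: add_diff_eq)
  qed
  have SP: "(\<Sum>p<Suc K. smul (zw_coeff n p) (P p)) - (\<Sum>p<Suc K. smul (zw_coeff n p) (P (Suc p)))
      = (\<Sum>p<Suc K. smul (zw_coeff (n + 1) p) (P p))" by (rule S) (rule PK)
  have SQ: "(\<Sum>p<Suc K. smul (zw_coeff n p) (Q p)) - (\<Sum>p<Suc K. smul (zw_coeff n p) (Q (Suc p)))
      = (\<Sum>p<Suc K. smul (zw_coeff (n + 1) p) (Q p))" by (rule S) (rule QK)
  have "x - y' - (y - x') = (x - y) + (x' - y')" for x y x' y' :: 'h
    by (simp add: algebra_simps)
  then show ?thesis
    unfolding 1 2 3 by (simp only: SP SQ)
qed

section \<open>Formal locality and Dong's lemma\<close>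

definition formally_local :: "bit \<Rightarrow> 'h field \<Rightarrow> 'h field \<Rightarrow> bool" where
  "formally_local \<epsilon> A B \<longleftrightarrow>
     (\<exists>N. \<forall>v. (zw_mult ^^ N) (\<lambda>n m. scomm smul \<epsilon> (A n) (B m) v) = (\<lambda>n m. 0))"

lemma formally_local_sym:
  assumes "formally_local \<epsilon> A B"
  shows "formally_local \<epsilon> B A"
proof -
  obtain N where N: "\<And>v. (zw_mult ^^ N) (\<lambda>n m. scomm smul \<epsilon> (A n) (B m) v) = (\<lambda>n m. 0)"
    using assms by (auto simp: formally_local_def)
  have "(zw_mult ^^ N) (\<lambda>n m. scomm smul \<epsilon> (B n) (A m) v) = (\<lambda>n m. 0)" for v
  proof -
    have "(\<lambda>n m. scomm smul \<epsilon> (B n) (A m) v) = (\<lambda>n m. smul (- parity_sign \<epsilon>) (scomm smul \<epsilon> (A m) (B n) v))"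
      by (simp add: scomm_def scale_right_diff_distrib)
    then have "(zw_mult ^^ N) (\<lambda>n m. scomm smul \<epsilon> (B n) (A m) v) =
      (\<lambda>n m. smul (- parity_sign \<epsilon>) ((zw_mult ^^ N) (\<lambda>n m. scomm smul \<epsilon> (A m) (B n) v) n m))"
      by (simp only:) (rule zw_mult_pow_map, simp add: scale_right_diff_distrib)
    then show ?thesis
      by (simp add: fun_eq_iff zw_mult_pow_swap[of N "\<lambda>n m. scomm smul \<epsilon> (A n) (B m) v"] N)
  qed
  then show ?thesis by (auto simp: formally_local_def)
qed

lemma formally_local_id: "is_field smul A \<Longrightarrow> formally_local 0 A field_id"
  unfolding formally_local_def
  by (rule exI[of _ 0]) (auto simp: scomm_def field_id_def fun_eq_iff is_field_zero)

lemma formally_local_zero: "is_field smul A \<Longrightarrow> formally_local \<epsilon> A (\<lambda>n v. 0)"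
  unfolding formally_local_def
  by (rule exI[of _ 0]) (auto simp: scomm_def fun_eq_iff is_field_zero)

lemma formally_local_add:
  assumes "is_field smul A" "formally_local \<epsilon> A B" "formally_local \<epsilon> A C"
  shows "formally_local \<epsilon> A (\<lambda>n v. B n v + C n v)"
proof -
  obtain N where N: "\<And>v. (zw_mult ^^ N) (\<lambda>n m. scomm smul \<epsilon> (A n) (B m) v) = (\<lambda>n m. 0)"
    using assms by (auto simp: formally_local_def)
  obtain M where M: "\<And>v. (zw_mult ^^ M) (\<lambda>n m. scomm smul \<epsilon> (A n) (C m) v) = (\<lambda>n m. 0)"
    using assms by (auto simp: formally_local_def)
  have "(\<lambda>n m. scomm smul \<epsilon> (A n) (\<lambda>v. B m v + C m v) v) =
     (\<lambda>n m. scomm smul \<epsilon> (A n) (B m) v + scomm smul \<epsilon> (A n) (C m) v)" for v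
    by (simp add: scomm_def is_field_add[OF assms(1)] scale_right_distrib add_diff_add)
  then have "(zw_mult ^^ (max N M)) (\<lambda>n m. scomm smul \<epsilon> (A n) (\<lambda>v. B m v + C m v) v) = (\<lambda>n m. 0)" for v
    using zw_mult_pow_mono[OF N, of "max N M"] zw_mult_pow_mono[OF M, of "max N M"]
    by (simp add: zw_mult_pow_add)
  then show ?thesis by (auto simp: formally_local_def)
qed

lemma formally_local_scale:
  assumes "is_field smul A" "formally_local \<epsilon> A B"
  shows "formally_local \<epsilon> A (\<lambda>n v. smul c (B n v))"
proof -
  obtain N where N: "\<And>v. (zw_mult ^^ N) (\<lambda>n m. scomm smul \<epsilon> (A n) (B m) v) = (\<lambda>n m. 0)"
    using assms by (auto simp: formally_local_def)
  have "(\<lambda>n m. scomm smul \<epsilon> (A n) (\<lambda>v. smul c (B m v)) v) =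
     (\<lambda>n m. smul c (scomm smul \<epsilon> (A n) (B m) v))" for v
    by (simp add: scomm_def is_field_scale[OF assms(1)] scale_right_diff_distrib mult_ac)
  then have "(zw_mult ^^ N) (\<lambda>n m. scomm smul \<epsilon> (A n) (\<lambda>v. smul c (B m v)) v) = (\<lambda>n m. 0)" for v
    by (simp add: zw_mult_pow_map[of "smul c"] scale_right_diff_distrib N)
  then show ?thesis by (auto simp: formally_local_def)
qed


text \<open>A series of series in which each coefficient is a finite sum, the cut-off depending on
  the coefficient. The multiplications combine finitely many coefficients, so they can be applied
  term by term.\<close>

definition eventual_sum :: "(int \<Rightarrow> int \<Rightarrow> int \<Rightarrow> 'h) \<Rightarrow> (nat \<Rightarrow> int \<Rightarrow> int \<Rightarrow> int \<Rightarrow> 'h) \<Rightarrow> bool" where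
  "eventual_sum F T \<longleftrightarrow> (\<forall>i m k. \<exists>K0. \<forall>K\<ge>K0. F i m k = (\<Sum>p<K. T p i m k))"

lemma eventual_sum_diff:
  assumes "\<And>i m k. \<exists>K0::nat. \<forall>K\<ge>K0. F i m k = (\<Sum>p<K. T p i m k :: 'h)"
  shows "\<exists>K0::nat. \<forall>K\<ge>K0. F i m k - F i' m' k' = (\<Sum>p<K. T p i m k - T p i' m' k')"
proof -
  obtain K1 where K1: "\<And>K. K \<ge> K1 \<Longrightarrow> F i m k = (\<Sum>p<K. T p i m k)" using assms[of i m k] by blast
  obtain K2 where K2: "\<And>K. K \<ge> K2 \<Longrightarrow> F i' m' k' = (\<Sum>p<K. T p i' m' k')" using assms[of i' m' k'] by blast
  have "F i m k - F i' m' k' = (\<Sum>p<K. T p i m k - T p i' m' k')" if "K \<ge> max K1 K2" for K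
  proof -
    have K: "K \<ge> K1" "K \<ge> K2" using that by simp_all
    show ?thesis unfolding K1[OF K(1)] K2[OF K(2)] sum_subtractf ..
  qed
  then show ?thesis by blast
qed

lemma eventual_sum_mult:
  assumes "eventual_sum F T"
  shows "eventual_sum ((mult13 ^^ N) F) (\<lambda>p. (mult13 ^^ N) (T p))"
    and "eventual_sum ((mult23 ^^ N) F) (\<lambda>p. (mult23 ^^ N) (T p))"
proof -
  have "eventual_sum (mult13 F) (\<lambda>p. mult13 (T p))" if "eventual_sum F T" for F T
    using that unfolding eventual_sum_def mult13_def by (intro allI eventual_sum_diff) blast
  then show "eventual_sum ((mult13 ^^ N) F) (\<lambda>p. (mult13 ^^ N) (T p))"
    by (induction N) (simp_all add: assms)
  have "eventual_sum (mult23 F) (\<lambda>p. mult23 (T p))" if "eventual_sum F T" for F T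
    using that unfolding eventual_sum_def mult23_def by (intro allI eventual_sum_diff) blast
  then show "eventual_sum ((mult23 ^^ N) F) (\<lambda>p. (mult23 ^^ N) (T p))"
    by (induction N) (simp_all add: assms)
qed

lemma mult_pow_shift:
  fixes T :: "int \<Rightarrow> int \<Rightarrow> int \<Rightarrow> 'h"
  shows "(mult13 ^^ b) ((mult23 ^^ c) (\<lambda>i m k. T (i + x) (m + y) k)) =
    (\<lambda>i m k. (mult13 ^^ b) ((mult23 ^^ c) T) (i + x) (m + y) k)"
proof -
  have 1: "(mult23 ^^ c) (\<lambda>i m k. T (i + x) (m + y) k) = (\<lambda>i m k. (mult23 ^^ c) T (i + x) (m + y) k)" for T :: "int \<Rightarrow> int \<Rightarrow> int \<Rightarrow> 'h"
    by (induction c) (simp_all add: mult23_def ac_simps)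
  have 2: "(mult13 ^^ b) (\<lambda>i m k. T (i + x) (m + y) k) = (\<lambda>i m k. (mult13 ^^ b) T (i + x) (m + y) k)" for T :: "int \<Rightarrow> int \<Rightarrow> int \<Rightarrow> 'h"
    by (induction b) (simp_all add: mult13_def ac_simps)
  show ?thesis unfolding 1[of T] 2[of "(mult23 ^^ c) T"] ..
qed

lemma mult_pow_scale:
  "(mult13 ^^ b) ((mult23 ^^ c) (\<lambda>i m k. smul s (T i m k))) =
    (\<lambda>i m k. smul s ((mult13 ^^ b) ((mult23 ^^ c) T) i m k))"
proof -
  have 1: "(mult23 ^^ c) (\<lambda>i m k. smul s (T i m k)) = (\<lambda>i m k. smul s ((mult23 ^^ c) T i m k))" for T :: "int \<Rightarrow> int \<Rightarrow> int \<Rightarrow> 'h"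
    by (induction c) (simp_all add: mult23_def scale_right_diff_distrib)
  have 2: "(mult13 ^^ b) (\<lambda>i m k. smul s (T i m k)) = (\<lambda>i m k. smul s ((mult13 ^^ b) T i m k))" for T :: "int \<Rightarrow> int \<Rightarrow> int \<Rightarrow> 'h"
    by (induction b) (simp_all add: mult13_def scale_right_diff_distrib)
  show ?thesis unfolding 1 2 ..
qed

text \<open>Leibniz rule: [AB, C] is the sum of A[B, C], killed by (w - u)^c, and of [A, C]B up to
  sign, killed by (z - u)^b; the parities of A and B with respect to C add.\<close>

lemma scomm_comp_vanish:
  assumes "is_field smul A" "is_field smul B" "is_field smul C"
    and AC: "\<And>v. (zw_mult ^^ b) (\<lambda>n m. scomm smul \<epsilon>\<^sub>1 (A n) (C m) v) = (\<lambda>n m. 0)"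
    and BC: "\<And>v. (zw_mult ^^ c) (\<lambda>n m. scomm smul \<epsilon>\<^sub>2 (B n) (C m) v) = (\<lambda>n m. 0)"
  shows "(mult13 ^^ b) ((mult23 ^^ c) (\<lambda>i m k. scomm smul (\<epsilon>\<^sub>1 + \<epsilon>\<^sub>2) (\<lambda>v. A i (B m v)) (C k) v)) = (\<lambda>i m k. 0)"
proof -
  let ?s1 = "parity_sign \<epsilon>\<^sub>1" and ?s2 = "parity_sign \<epsilon>\<^sub>2"
  define P where "P = (\<lambda>i m k. - A i (scomm smul \<epsilon>\<^sub>2 (B m) (C k) v))"
  define Q where "Q = (\<lambda>i m k. smul ?s2 (scomm smul \<epsilon>\<^sub>1 (A i) (C k) (B m v)))"
  have eq: "scomm smul (\<epsilon>\<^sub>1 + \<epsilon>\<^sub>2) (\<lambda>v. A i (B m v)) (C k) v = Q i m k - P i m k" for i m k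
    unfolding P_def Q_def scomm_def parity_sign_add
    by (simp add: is_field_diff[OF assms(1)] is_field_scale[OF assms(1)]
        scale_right_diff_distrib mult_ac)
  have "(zw_mult ^^ c) (\<lambda>m k. - A i (scomm smul \<epsilon>\<^sub>2 (B m) (C k) v)) = (\<lambda>m k. 0)" for i
    by (subst zw_mult_pow_map[of "\<lambda>x. - A i x"])
       (simp_all add: is_field_diff[OF assms(1)] BC is_field_zero[OF assms(1)])
  then have P: "(mult23 ^^ c) P = (\<lambda>i m k. 0)"
    by (simp add: fun_eq_iff mult23_pow P_def)
  have "(zw_mult ^^ b) (\<lambda>i k. smul ?s2 (scomm smul \<epsilon>\<^sub>1 (A i) (C k) (B m v))) = (\<lambda>i k. 0)" for m
    by (subst zw_mult_pow_map[of "smul ?s2"]) (simp_all add: scale_right_diff_distrib AC)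
  then have Q: "(mult13 ^^ b) Q = (\<lambda>i m k. 0)"
    by (simp add: fun_eq_iff mult13_pow Q_def)
  have "(mult13 ^^ b) ((mult23 ^^ c) Q) = (mult23 ^^ c) ((mult13 ^^ b) Q)"
    by (rule funpow_commute) (rule mult_commute)
  then show ?thesis
    unfolding eq mult23_pow_diff P by (simp add: Q)
qed

text \<open>Dong's lemma. With \<open>G(z,w)\<close> the two-variable series whose residue in \<open>z\<close> is \<open>A\<^sub>nB(w)\<close>, the bracket
  \<open>[G(z,w), C(u)]\<close> is killed by a power of \<open>z - w\<close> and by \<open>(z - u)^b (w - u)^c\<close>.\<close>

lemma formally_local_prod:
  assumes fields: "is_field smul A" "is_field smul B" "is_field smul C"
    and smooth: "smooth_field A" "smooth_field B"
    and AB: "formally_local \<epsilon> A B" and AC: "formally_local \<epsilon>\<^sub>1 A C" and BC: "formally_local \<epsilon>\<^sub>2 B C"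
  shows "formally_local (\<epsilon>\<^sub>1 + \<epsilon>\<^sub>2) (field_prod smul \<epsilon> n A B) C"
proof -
  obtain N where N: "\<And>v. (zw_mult ^^ N) (\<lambda>n m. scomm smul \<epsilon> (A n) (B m) v) = (\<lambda>n m. 0)"
    using AB by (auto simp: formally_local_def)
  obtain b where b: "\<And>v. (zw_mult ^^ b) (\<lambda>n m. scomm smul \<epsilon>\<^sub>1 (A n) (C m) v) = (\<lambda>n m. 0)"
    using AC by (auto simp: formally_local_def)
  obtain c where c: "\<And>v. (zw_mult ^^ c) (\<lambda>n m. scomm smul \<epsilon>\<^sub>2 (B n) (C m) v) = (\<lambda>n m. 0)"
    using BC by (auto simp: formally_local_def)
  let ?s = "parity_sign (\<epsilon>\<^sub>1 + \<epsilon>\<^sub>2)"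
  \<comment> \<open>Row i of \<open>G n\<close> is the coefficient of z^(-i-1), obtained by shifting
    the modes of A; row 0 is A_nB itself.\<close>
  define G where "G n = (\<lambda>i. field_prod smul \<epsilon> n (\<lambda>k. A (k + i)) B)" for n
  \<comment> \<open>Each factor z - w raises n by one. For negative n, -n factors lead to
    \<open>G 0\<close>, the supercommutator, which N further factors kill; for n >= 0 the series
    \<open>G n\<close> is already a multiple of it.\<close>
  define a where "a = N + nat (- n)"
  have fs: "is_field smul (\<lambda>k. A (k + i))" for i using fields by (simp add: is_field_def)
  have ss: "smooth_field (\<lambda>k. A (k + i))" for i
    using smooth(1) unfolding smooth_field_def by (metis add.commute le_add_diff_inverse add_left_mono diff_add_cancel diff_le_eq)
  have Gstep: "G n (i + 1) m v - G n i (m + 1) v = G (n + 1) i m v" for n i m v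
    unfolding G_def using field_prod_shift[OF fields(1,2) smooth] .
  have G0: "G 0 i m v = scomm smul \<epsilon> (A i) (B m) v" for i m v
    by (simp add: G_def field_prod_def scomm_def)
  have Gpow: "(zw_mult ^^ j) (\<lambda>i m. G n i m v) = (\<lambda>i m. G (n + int j) i m v)" for j n v
    by (induction j) (simp_all add: zw_mult_def Gstep algebra_simps)
  have Gz: "(zw_mult ^^ a) (\<lambda>i m. G n i m v) = (\<lambda>i m. 0)" for v
  proof (cases "n \<ge> 0")
    case True
    have "(zw_mult ^^ a) (\<lambda>i m. G n i m v) = (zw_mult ^^ a) ((zw_mult ^^ nat n) (\<lambda>i m. G 0 i m v))"
      using True by (simp add: Gpow)
    also have "\<dots> = (zw_mult ^^ (N + nat n)) (\<lambda>i m. scomm smul \<epsilon> (A i) (B m) v)"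
      using True by (simp add: a_def G0 funpow_add)
    also have "\<dots> = (\<lambda>i m. 0)" by (rule zw_mult_pow_mono[OF N]) simp
    finally show ?thesis .
  next
    case False
    then have "(zw_mult ^^ a) (\<lambda>i m. G n i m v) = (zw_mult ^^ N) (\<lambda>i m. G 0 i m v)"
      by (simp add: a_def funpow_add Gpow)
    then show ?thesis by (simp add: G0 N)
  qed
  have "(zw_mult ^^ (a + b + c)) (\<lambda>m k. scomm smul (\<epsilon>\<^sub>1 + \<epsilon>\<^sub>2) (field_prod smul \<epsilon> n A B m) (C k) v) = (\<lambda>m k. 0)" for v
  proof -
    define F where "F = (\<lambda>i m k. scomm smul (\<epsilon>\<^sub>1 + \<epsilon>\<^sub>2) (G n i m) (C k) v)"
    have "(mult12 ^^ a) F i m k = (zw_mult ^^ a) (\<lambda>i m. G n i m (C k v) - smul ?s (C k (G n i m v))) i m" for i m k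
      by (simp add: mult12_pow F_def scomm_def)
    also have "\<dots> i m k = 0" for i m k
      unfolding zw_mult_pow_diff Gz
      by (subst zw_mult_pow_map[of "\<lambda>x. smul ?s (C k x)"])
         (simp_all add: is_field_diff[OF fields(3)] scale_right_diff_distrib Gz is_field_zero[OF fields(3)])
    finally have F12: "(mult12 ^^ a) F = (\<lambda>i m k. 0)" by (simp add: fun_eq_iff)
    define T1 where "T1 = (\<lambda>i m k. scomm smul (\<epsilon>\<^sub>1 + \<epsilon>\<^sub>2) (\<lambda>v. A i (B m v)) (C k) v)"
    define T2 where "T2 = (\<lambda>i m k. scomm smul (\<epsilon>\<^sub>1 + \<epsilon>\<^sub>2) (\<lambda>v. B m (A i v)) (C k) v)"
    define s where "s = ?s"
    have Fs: "F i m k = G n i m (C k v) - smul s (C k (G n i m v))"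
      and Ts: "T1 i m k = A i (B m (C k v)) - smul s (C k (A i (B m v)))"
        "T2 i m k = B m (A i (C k v)) - smul s (C k (B m (A i v)))" for i m k
      unfolding F_def T1_def T2_def s_def scomm_def by (rule refl)+
    define \<sigma> where "\<sigma> = parity_sign \<epsilon> * (-1) powi n"
    define T where "T = (\<lambda>p i m k. smul (zw_coeff n p) (T1 (i + (n - int p)) (m + int p) k)
       - smul (zw_coeff n p * \<sigma>) (T2 (i + int p) (m + (n - int p)) k))"
    have T1z: "(mult13 ^^ b) ((mult23 ^^ c) T1) = (\<lambda>i m k. 0)"
      unfolding T1_def by (rule scomm_comp_vanish[OF fields b c])
    have T2z: "(mult13 ^^ b) ((mult23 ^^ c) T2) = (\<lambda>i m k. 0)"
    proof -
      let ?T = "\<lambda>m i k. scomm smul (\<epsilon>\<^sub>2 + \<epsilon>\<^sub>1) (\<lambda>v. B m (A i v)) (C k) v"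
      have z: "(mult13 ^^ c) ((mult23 ^^ b) ?T) = (\<lambda>i m k. 0)"
        by (rule scomm_comp_vanish[OF fields(2,1,3) c b])
      \<comment> \<open>Exchanging the first two variables exchanges z - u and w - u, which reduces
        the reversed product BA to the case already treated.\<close>
      have sw: "(mult23 ^^ N) (\<lambda>i m k. T m i k) = (\<lambda>i m k. (mult13 ^^ N) T m i k)"
        "(mult13 ^^ N) (\<lambda>i m k. T m i k) = (\<lambda>i m k. (mult23 ^^ N) T m i k)" for N and T :: "int \<Rightarrow> int \<Rightarrow> int \<Rightarrow> 'h"
        by (simp_all add: fun_eq_iff mult13_pow mult23_pow)
      have "(mult13 ^^ b) ((mult23 ^^ c) T2) = (mult13 ^^ b) ((mult23 ^^ c) (\<lambda>i m k. ?T m i k))"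
        unfolding T2_def by (subst add.commute) (rule refl)
      also have "\<dots> = (\<lambda>i m k. (mult23 ^^ b) ((mult13 ^^ c) ?T) m i k)"
        unfolding sw(1)[of c ?T] sw(2)[of b "(mult13 ^^ c) ?T"] ..
      also have "(mult23 ^^ b) ((mult13 ^^ c) ?T) = (mult13 ^^ c) ((mult23 ^^ b) ?T)"
        by (rule funpow_commute) (rule mult_commute(2)[symmetric])
      finally show ?thesis unfolding z .
    qed
    have Tz: "(mult13 ^^ b) ((mult23 ^^ c) (T p)) = (\<lambda>i m k. 0)" for p
      unfolding T_def mult23_pow_diff mult13_pow_diff mult_pow_scale
        mult_pow_shift[of b c T1] mult_pow_shift[of b c T2] T1z T2z by simp
    have "eventual_sum F T"
      unfolding eventual_sum_def
    proof (intro allI)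
      fix i m k
      obtain K1 where K1: "\<And>K. K \<ge> K1 \<Longrightarrow> G n i m (C k v) = (\<Sum>p<K. prod_term \<epsilon> n (\<lambda>k. A (k + i)) B m (C k v) p)"
        unfolding G_def using field_prod_sum_bound[OF fs fields(2) ss smooth(2)] by metis
      obtain K2 where K2: "\<And>K. K \<ge> K2 \<Longrightarrow> G n i m v = (\<Sum>p<K. prod_term \<epsilon> n (\<lambda>k. A (k + i)) B m v p)"
        unfolding G_def using field_prod_sum_bound[OF fs fields(2) ss smooth(2)] by metis
      have "F i m k = (\<Sum>p<K. T p i m k)" if "K \<ge> max K1 K2" for K
      proof -
        have "F i m k = (\<Sum>p<K. prod_term \<epsilon> n (\<lambda>k. A (k + i)) B m (C k v) p
            - smul s (C k (prod_term \<epsilon> n (\<lambda>k. A (k + i)) B m v p)))"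
          unfolding Fs K1[OF max.cobounded1[THEN order_trans, OF that]] K2[OF max.cobounded2[THEN order_trans, OF that]]
          by (simp add: is_field_sum[OF fields(3)] sum_subtractf scale_sum_right)
        also have "\<dots> = (\<Sum>p<K. T p i m k)"
          by (intro sum.cong refl)
             (simp add: T_def Ts \<sigma>_def prod_term_def is_field_diff[OF fields(3)]
               is_field_scale[OF fields(3)] scale_right_diff_distrib algebra_simps)
        finally show ?thesis .
      qed
      then show "\<exists>K0. \<forall>K\<ge>K0. F i m k = (\<Sum>p<K. T p i m k)" by blast
    qed
    then have "eventual_sum ((mult13 ^^ b) ((mult23 ^^ c) F)) (\<lambda>p. (mult13 ^^ b) ((mult23 ^^ c) (T p)))"
      by (intro eventual_sum_mult)
    then have F3: "(mult13 ^^ b) ((mult23 ^^ c) F) = (\<lambda>i m k. 0)"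
      unfolding Tz eventual_sum_def by (auto simp: fun_eq_iff)
    have "(mult12 ^^ a) ((mult23 ^^ c) F) = (mult23 ^^ c) ((mult12 ^^ a) F)"
      by (rule funpow_commute) (rule mult_commute)
    then have "(mult23 ^^ (a + b)) ((mult23 ^^ c) F) = (\<lambda>i m k. 0)"
      using F3 by (intro mult23_pow_vanish) (simp_all add: F12)
    \<comment> \<open>Multiplication by w - u leaves the index of z alone, so the vanishing can be
      read off in row 0, that is, for A_nB.\<close>
    then have "(mult23 ^^ (a + b + c)) F 0 m k = 0" for m k
      by (simp add: funpow_add)
    then show ?thesis
      by (simp add: mult23_pow fun_eq_iff F_def G_def)
  qed
  then show ?thesis unfolding formally_local_def by blast
qed

text \<open>On the vacuum the reversed terms contain A(p) applied to it with p >= 0 and vanish; of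
  the others only p = 0 can survive, and only for negative m. Thus taking states turns products of
  fields into modes acting on vectors.\<close>

lemma field_prod_state:
  assumes "is_field smul A" "is_field smul B"
    and "\<And>p. p \<ge> 0 \<Longrightarrow> B p \<Omega> = 0" "\<And>p. p \<ge> 0 \<Longrightarrow> A p \<Omega> = 0"
  shows "field_prod smul \<epsilon> n A B (-1) \<Omega> = A n (B (-1) \<Omega>)"
    and "m \<ge> 0 \<Longrightarrow> field_prod smul \<epsilon> n A B m \<Omega> = 0"
proof -
  have "field_prod smul \<epsilon> n A B (-1) \<Omega> = (\<Sum>p<1. prod_term \<epsilon> n A B (-1) \<Omega> p)"
    by (rule field_prod_eq_sum) (use assms in auto)
  then show "field_prod smul \<epsilon> n A B (-1) \<Omega> = A n (B (-1) \<Omega>)"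
    using assms by (simp add: prod_term_def is_field_zero)
  show "field_prod smul \<epsilon> n A B m \<Omega> = 0" if "m \<ge> 0"
  proof -
    have "field_prod smul \<epsilon> n A B m \<Omega> = (\<Sum>p<0. prod_term \<epsilon> n A B m \<Omega> p)"
      by (rule field_prod_eq_sum) (use assms that in auto)
    then show ?thesis by simp
  qed
qed

text \<open>Makes closure under derivatives a case of closure under products. In (z - w)^(-2) the
  coefficient is p + 1, and the single nonzero mode of the identity selects p = -1 - m in one half
  or p = m - 1 in the other; both give -m A(m-1).\<close>

lemma field_deriv_eq_prod:
  assumes "is_field smul A" "smooth_field A"
  shows "field_deriv smul A = field_prod smul 0 (-2) A field_id"
proof (intro ext)
  fix m v
  have idf: "is_field smul field_id"
    by (rule is_fieldI) (simp_all add: field_id_def)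
  obtain k where k: "\<And>n. n \<ge> k \<Longrightarrow> A n v = 0"
    using assms(2) unfolding smooth_field_def by blast
  define K where "K = nat (max k (\<bar>m\<bar> + 2))"
  define u where "u = smul (of_int (- m)) (A (m - 1) v)"
  have z: "zw_coeff (- 2) p = of_nat (Suc p)" for p
    by (simp add: zw_coeff_neg nat_add_distrib Suc_as_int[symmetric])
  have t: "prod_term 0 (-2) A field_id m v p =
      (if int p = - 1 - m then u else 0) + (if int p = m - 1 then u else 0)" for p
  proof -
    consider "m = - 1 - int p" | "m = 1 + int p" | "m + int p \<noteq> - 1" "m \<noteq> 1 + int p" by fastforce
    then show ?thesis
    proof cases
      case 1
      then have "m - 1 = - 2 - int p" "- m = int p + 1" "m + int p = - 1" "m - 2 - int p \<noteq> - 1" "int p \<noteq> m - 1"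
        by simp_all
      then show ?thesis
        unfolding u_def by (simp add: prod_term_def z field_id_def 1 del: of_nat_Suc) (simp add: algebra_simps)
    next
      case 2
      then have "m + int p \<noteq> - 1" "int p \<noteq> - 1 - m" by simp_all
      then show ?thesis
        by (simp add: prod_term_def z field_id_def u_def is_field_zero[OF assms(1)] 2 flip: scale_minus_left)
    next
      case 3
      then have "int p \<noteq> - 1 - m" "int p \<noteq> m - 1" "m - 2 - int p \<noteq> - 1" by auto
      then show ?thesis using 3
        by (simp add: prod_term_def field_id_def is_field_zero[OF assms(1)])
    qed
  qed
  have "field_prod smul 0 (-2) A field_id m v = (\<Sum>p<K. prod_term 0 (-2) A field_id m v p)"
    by (rule field_prod_eq_sum) (use assms idf k in \<open>auto simp: K_def field_id_def\<close>)
  also have "\<dots> = (\<Sum>p<K. if int p = - 1 - m then u else 0) + (\<Sum>p<K. if int p = m - 1 then u else 0)"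
    unfolding t sum.distrib ..
  also have "\<dots> = u"
  proof -
    consider "m < 0" | "m = 0" | "m > 0" by linarith
    then show ?thesis
    proof cases
      case 1
      then have "(int p = - 1 - m) = (p = nat (- 1 - m))" "(int p = m - 1) = False" for p by auto
      then show ?thesis using 1 by (simp add: K_def less_max_iff_disj)
    next
      case 2
      then show ?thesis by (simp add: u_def)
    next
      case 3
      then have "(int p = m - 1) = (p = nat (m - 1))" "(int p = - 1 - m) = False" for p by auto
      then show ?thesis using 3 by (simp add: K_def less_max_iff_disj)
    qed
  qed
  finally show "field_deriv smul A m v = field_prod smul 0 (-2) A field_id m v"
    by (simp add: field_deriv_def u_def)
qed

text \<open>If bracketing with T gives d/dz on A(z) and d/dw on B(w), then it gives the derivative
  on A_nB, because d/dz + d/dw kills (z - w)^n. It is applied with T = L_{-1}.\<close>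

lemma field_prod_derivation:
  assumes "is_field smul A" "is_field smul B" "smooth_field A" "smooth_field B"
    and T: "Vector_Spaces.linear smul smul T"
    and TA: "\<And>k v. T (A k v) = A k (T v) + smul (of_int (- k)) (A (k - 1) v)"
    and TB: "\<And>k v. T (B k v) = B k (T v) + smul (of_int (- k)) (B (k - 1) v)"
  shows "T (field_prod smul \<epsilon> n A B m v) = field_prod smul \<epsilon> n A B m (T v)
     + smul (of_int (- m)) (field_prod smul \<epsilon> n A B (m - 1) v)"
proof -
  interpret T: Vector_Spaces.linear smul smul T by (rule T)
  obtain k1 where k1: "\<And>n. n \<ge> k1 \<Longrightarrow> A n v = 0" "\<And>n. n \<ge> k1 \<Longrightarrow> B n v = 0"
    using smooth_field_bound[OF assms(3,4)] by metis
  obtain k2 where k2: "\<And>n. n \<ge> k2 \<Longrightarrow> A n (T v) = 0" "\<And>n. n \<ge> k2 \<Longrightarrow> B n (T v) = 0"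
    using smooth_field_bound[OF assms(3,4)] by metis
  \<comment> \<open>One cut-off for the expansions at v and at T v and for the modes m and m - 1;
    the extra index in \<open>Suc K\<close> absorbs the shift in m - 1.\<close>
  define K where "K = nat (\<bar>k1\<bar> + \<bar>k2\<bar> + \<bar>m\<bar> + 1)"
  then have "int K = \<bar>k1\<bar> + \<bar>k2\<bar> + \<bar>m\<bar> + 1" by simp
  then have K: "int K \<ge> k1" "int K \<ge> k2" "m + int K \<ge> k1" "m + int K \<ge> k2" "m - 1 + int (Suc K) \<ge> k1"
    by linarith+
  have e1: "field_prod smul \<epsilon> n A B m v = (\<Sum>p<Suc K. prod_term \<epsilon> n A B m v p)"
    by (rule field_prod_eq_sum[OF assms(1,2)]) (rule k1, use K in linarith)+
  have e2: "field_prod smul \<epsilon> n A B m (T v) = (\<Sum>p<Suc K. prod_term \<epsilon> n A B m (T v) p)"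
    by (rule field_prod_eq_sum[OF assms(1,2)]) (rule k2, use K in linarith)+
  have e3: "field_prod smul \<epsilon> n A B (m - 1) v = (\<Sum>p<Suc K. prod_term \<epsilon> n A B (m - 1) v p)"
    by (rule field_prod_eq_sum[OF assms(1,2)]) (rule k1, use K in linarith)+
  define \<sigma> where "\<sigma> = parity_sign \<epsilon> * (-1) powi n"
  define X where "X p = A (n - int p) (B (m - 1 + int p) v)" for p
  define Y where "Y p = B (m - 1 + n - int p) (A (int p) v)" for p
  define c where "c = zw_coeff n"
  have "B (m + int K) v = 0" and YK: "A (int K) v = 0" using k1 K by blast+
  then have XK: "X (Suc K) = 0" by (simp add: X_def is_field_zero assms)
  \<comment> \<open>At p = 0 the difference \<open>p - 1\<close> of naturals is truncated, but there
    the factor p makes both sides zero.\<close>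
  have Yp: "smul (of_nat p) (B (m + n - int p) (A (int p - 1) v)) = smul (of_nat p) (Y (p - 1))" for p
    by (cases p) (simp_all add: Y_def algebra_simps)
  have tm: "T (prod_term \<epsilon> n A B m v p) - prod_term \<epsilon> n A B m (T v) p =
     smul (- c p * of_int (n - int p)) (X (Suc p)) - smul (c p * of_int (m + int p)) (X p)
     + smul (c p * \<sigma> * of_int (m + n - int p)) (Y p) + smul (c p * \<sigma> * of_nat p) (Y (p - 1))" for p
  proof -
    have x: "A (n - int p - 1) (B (m + int p) v) = X (Suc p)" "A (n - int p) (B (m + int p - 1) v) = X p"
      "B (m + n - int p - 1) (A (int p) v) = Y p"
      by (simp_all add: X_def Y_def algebra_simps)
    have "T (prod_term \<epsilon> n A B m v p) - prod_term \<epsilon> n A B m (T v) p =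
      smul (c p) (smul (of_int (-(n - int p))) (X (Suc p)) + smul (of_int (-(m + int p))) (X p)
       - smul \<sigma> (smul (of_int (- (m + n - int p))) (Y p) + smul (- of_nat p) (B (m + n - int p) (A (int p - 1) v))))"
      unfolding prod_term_def c_def[symmetric] \<sigma>_def[symmetric] T.scale T.diff TA TB
      by (simp add: is_field_add[OF assms(1)] is_field_add[OF assms(2)]
        is_field_scale[OF assms(1)] is_field_scale[OF assms(2)] scale_right_distrib scale_right_diff_distrib x
        del: scale_minus_left of_int_minus of_int_add of_int_diff)
        (simp add: algebra_simps)
    also have "smul (- of_nat p) (B (m + n - int p) (A (int p - 1) v)) = smul (- of_nat p) (Y (p - 1))"
      using Yp by simp
    finally show ?thesis
      by (simp add: algebra_simps)
  qed
  have cabs: "of_nat (Suc p) * c (Suc p) = - c p * of_int (n - int p)" for p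
    by (simp add: c_def zw_coeff_absorb algebra_simps del: of_nat_Suc)
  \<comment> \<open>Absorption trades the factor n - p at index p for p + 1 at index p + 1. After
    this shift, here and for \<open>Y\<close> below, the coefficients combine to -m times those of
    mode m - 1.\<close>
  have X: "(\<Sum>p<Suc K. smul (- c p * of_int (n - int p)) (X (Suc p))) = (\<Sum>p<Suc K. smul (of_nat p * c p) (X p))"
  proof -
    have "(\<Sum>p<Suc K. smul (- c p * of_int (n - int p)) (X (Suc p))) = (\<Sum>p<K. smul (of_nat (Suc p) * c (Suc p)) (X (Suc p)))"
      unfolding cabs using XK by simp
    also have "\<dots> = (\<Sum>p<Suc K. smul (of_nat p * c p) (X p))"
      unfolding sum.lessThan_Suc_shift by simp
    finally show ?thesis .
  qed
  have Y: "(\<Sum>p<Suc K. smul (c p * \<sigma> * of_nat p) (Y (p - 1))) = (\<Sum>p<Suc K. smul (- c p * \<sigma> * of_int (n - int p)) (Y p))"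
  proof -
    have "(\<Sum>p<Suc K. smul (c p * \<sigma> * of_nat p) (Y (p - 1))) = (\<Sum>p<K. smul (of_nat (Suc p) * c (Suc p) * \<sigma>) (Y p))"
      unfolding sum.lessThan_Suc_shift by (simp add: mult_ac)
    also have "\<dots> = (\<Sum>p<Suc K. smul (- c p * \<sigma> * of_int (n - int p)) (Y p))"
      unfolding cabs using YK by (simp add: mult_ac Y_def is_field_zero assms)
    finally show ?thesis .
  qed
  have "T (field_prod smul \<epsilon> n A B m v) - field_prod smul \<epsilon> n A B m (T v) =
      (\<Sum>p<Suc K. T (prod_term \<epsilon> n A B m v p) - prod_term \<epsilon> n A B m (T v) p)"
    unfolding e1 e2 T.sum sum_subtractf ..
  also have "\<dots> = (\<Sum>p<Suc K. smul (of_nat p * c p) (X p)) - (\<Sum>p<Suc K. smul (c p * of_int (m + int p)) (X p))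
     + (\<Sum>p<Suc K. smul (c p * \<sigma> * of_int (m + n - int p)) (Y p)) + (\<Sum>p<Suc K. smul (- c p * \<sigma> * of_int (n - int p)) (Y p))"
    unfolding tm sum.distrib sum_subtractf X Y ..
  also have "\<dots> = (\<Sum>p<Suc K. smul (of_int (- m)) (prod_term \<epsilon> n A B (m - 1) v p))"
    unfolding sum.distrib[symmetric] sum_subtractf[symmetric]
    by (intro sum.cong refl)
       (simp add: prod_term_def c_def[symmetric] \<sigma>_def[symmetric] X_def Y_def algebra_simps)
  also have "\<dots> = smul (of_int (- m)) (field_prod smul \<epsilon> n A B (m - 1) v)"
    unfolding e3 scale_sum_right ..
  finally show ?thesis by (simp add: algebra_simps)
qed

text \<open>Every term has the same degree, since p cancels in (\<alpha> - (n - p)) + (\<beta> - (m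
  + p)). Here \<alpha> and \<beta> are conformal weights minus 1.\<close>

lemma field_prod_weight:
  assumes "is_field smul A" "is_field smul B" "smooth_field A" "smooth_field B"
    and T: "Vector_Spaces.linear smul smul D"
    and DA: "\<And>k v. D (A k v) = A k (D v) + smul (\<alpha> - of_int k) (A k v)"
    and DB: "\<And>k v. D (B k v) = B k (D v) + smul (\<beta> - of_int k) (B k v)"
  shows "D (field_prod smul \<epsilon> n A B m v) = field_prod smul \<epsilon> n A B m (D v)
     + smul (\<alpha> + \<beta> - of_int n - of_int m) (field_prod smul \<epsilon> n A B m v)"
proof -
  interpret T: Vector_Spaces.linear smul smul D by (rule T)
  obtain K1 where K1: "\<And>K. K \<ge> K1 \<Longrightarrow> field_prod smul \<epsilon> n A B m v = (\<Sum>p<K. prod_term \<epsilon> n A B m v p)"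
    using field_prod_sum_bound[OF assms(1-4)] by metis
  obtain K2 where K2: "\<And>K. K \<ge> K2 \<Longrightarrow> field_prod smul \<epsilon> n A B m (D v) = (\<Sum>p<K. prod_term \<epsilon> n A B m (D v) p)"
    using field_prod_sum_bound[OF assms(1-4)] by metis
  have "D (prod_term \<epsilon> n A B m v p) = prod_term \<epsilon> n A B m (D v) p
     + smul (\<alpha> + \<beta> - of_int n - of_int m) (prod_term \<epsilon> n A B m v p)" for p
    unfolding prod_term_def T.scale T.diff DA DB
    by (simp add: is_field_add[OF assms(1)] is_field_add[OF assms(2)]
        is_field_diff[OF assms(1)] is_field_diff[OF assms(2)]
        is_field_scale[OF assms(1)] is_field_scale[OF assms(2)] algebra_simps)
  then show ?thesis
    using K1[of "max K1 K2"] K2[of "max K1 K2"]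
    by (simp add: T.sum sum.distrib scale_sum_right)
qed

end

section \<open>Formal and analytic locality\<close>

lemma has_sum_diff:
  fixes f g :: "'a \<Rightarrow> complex"
  assumes "(f has_sum a) A" "(g has_sum b) A"
  shows "((\<lambda>x. f x - g x) has_sum (a - b)) A"
  using has_sum_add[OF assms(1) has_sum_uminusI[OF assms(2)]] by simp

lemma neg_one_power_cancel: "(-1) ^ N * ((-1) ^ N * x) = (x :: 'a::ring_1)"
  by (cases "even N") simp_all

definition laurent_sum :: "(int \<Rightarrow> int \<Rightarrow> complex) \<Rightarrow> complex \<Rightarrow> complex \<Rightarrow> complex \<Rightarrow> bool" where
  "laurent_sum f z w s \<longleftrightarrow>
     ((\<lambda>(n, m). f n m * z powi (- n - 1) * w powi (- m - 1)) has_sum s) UNIV"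

lemma laurent_sum_swap: "laurent_sum (\<lambda>n m. f m n) w z s \<longleftrightarrow> laurent_sum f z w s"
  unfolding laurent_sum_def
  by (rule has_sum_reindex_bij_witness[of _ prod.swap prod.swap]) (auto simp: mult_ac)

lemma laurent_sum_diff:
  "laurent_sum f z w s \<Longrightarrow> laurent_sum g z w t \<Longrightarrow> laurent_sum (\<lambda>n m. f n m - g n m) z w (s - t)"
  unfolding laurent_sum_def
  by (drule (1) has_sum_diff) (simp add: case_prod_unfold algebra_simps)

lemma laurent_sum_zw_mult:
  assumes "laurent_sum f z w s" "z \<noteq> 0" "w \<noteq> 0"
  shows "laurent_sum (zw_mult f) z w ((z - w) * s)"
proof -
  let ?t = "\<lambda>(n, m). f n m * z powi (- n - 1) * w powi (- m - 1)"
  have 1: "((\<lambda>(n, m). z * ?t (n + 1, m)) has_sum z * s) UNIV"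
  proof -
    have "((\<lambda>x. ?t (case x of (n, m) \<Rightarrow> (n + 1, m))) has_sum s) UNIV \<longleftrightarrow> (?t has_sum s) UNIV"
      by (rule has_sum_reindex_bij_betw, rule bij_betwI[of _ _ _ "\<lambda>(n, m). (n - 1, m)"]) auto
    then have "((\<lambda>x. ?t (case x of (n, m) \<Rightarrow> (n + 1, m))) has_sum s) UNIV"
      using assms(1) by (simp add: laurent_sum_def)
    from has_sum_cmult_right[OF this, of z] show ?thesis
      by (simp add: case_prod_unfold)
  qed
  have 2: "((\<lambda>(n, m). w * ?t (n, m + 1)) has_sum w * s) UNIV"
  proof -
    have "((\<lambda>x. ?t (case x of (n, m) \<Rightarrow> (n, m + 1))) has_sum s) UNIV \<longleftrightarrow> (?t has_sum s) UNIV"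
      by (rule has_sum_reindex_bij_betw, rule bij_betwI[of _ _ _ "\<lambda>(n, m). (n, m - 1)"]) auto
    then have "((\<lambda>x. ?t (case x of (n, m) \<Rightarrow> (n, m + 1))) has_sum s) UNIV"
      using assms(1) by (simp add: laurent_sum_def)
    from has_sum_cmult_right[OF this, of w] show ?thesis
      by (simp add: case_prod_unfold)
  qed
  have p: "x powi (- n - 1) = x * x powi (- (n + 1) - 1)" if "x \<noteq> 0" for n and x :: complex
  proof -
    have "x powi (- n - 1) = x powi (1 + (- (n + 1) - 1))"
      by (rule arg_cong[of _ _ "\<lambda>k. x powi k"]) simp
    also have "\<dots> = x * x powi (- (n + 1) - 1)"
      using that by (subst power_int_add) auto
    finally show ?thesis .
  qed
  have "((\<lambda>x. (case x of (n, m) \<Rightarrow> z * ?t (n + 1, m)) - (case x of (n, m) \<Rightarrow> w * ?t (n, m + 1)))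
      has_sum z * s - w * s) UNIV"
    by (rule has_sum_diff[OF 1 2])
  also have "(\<lambda>x. (case x of (n, m) \<Rightarrow> z * ?t (n + 1, m)) - (case x of (n, m) \<Rightarrow> w * ?t (n, m + 1))) =
      (\<lambda>(n, m). zw_mult f n m * z powi (- n - 1) * w powi (- m - 1))"
  proof
    fix x :: "int \<times> int"
    obtain n m where x: "x = (n, m)" by (cases x)
    have "f (n + 1) m * (z * z powi (- (n + 1) - 1)) * w powi (- m - 1)
       - f n (m + 1) * z powi (- n - 1) * (w * w powi (- (m + 1) - 1))
       = zw_mult f n m * z powi (- n - 1) * w powi (- m - 1)"
      unfolding p[OF assms(2), symmetric] p[OF assms(3), symmetric] zw_mult_def
      by (simp only: left_diff_distrib)
    then show "(case x of (n, m) \<Rightarrow> z * ?t (n + 1, m)) - (case x of (n, m) \<Rightarrow> w * ?t (n, m + 1)) =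
        (case x of (n, m) \<Rightarrow> zw_mult f n m * z powi (- n - 1) * w powi (- m - 1))"
      unfolding x by (simp only: prod.case mult_ac)
  qed
  finally show ?thesis by (simp add: laurent_sum_def left_diff_distrib)
qed

lemma laurent_sum_zw_mult_pow:
  assumes "laurent_sum f z w s" "z \<noteq> 0" "w \<noteq> 0"
  shows "laurent_sum ((zw_mult ^^ N) f) z w ((z - w) ^ N * s)"
proof (induction N)
  case (Suc N)
  then show ?case using laurent_sum_zw_mult[OF Suc assms(2,3)] by (simp add: mult_ac)
qed (simp add: assms)

text \<open>Over the complex numbers summability is absolute summability, so the product family is
  summable and may be summed by rows.\<close>

lemma has_sum_complex_product:
  fixes f :: "'a \<Rightarrow> complex" and g :: "'b \<Rightarrow> complex"
  assumes "(f has_sum a) A" "(g has_sum b) B"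
  shows "((\<lambda>(x, y). f x * g y) has_sum a * b) (A \<times> B)"
proof (rule has_sum_SigmaI)
  show "((\<lambda>y. case (x, y) of (x, y) \<Rightarrow> f x * g y) has_sum f x * b) B" for x
    using has_sum_cmult_right[OF assms(2), of "f x"] by simp
  show "((\<lambda>x. f x * b) has_sum a * b) A"
    by (rule has_sum_cmult_left[OF assms(1)])
  have n: "(\<lambda>x. norm (f x)) summable_on A" "(\<lambda>y. norm (g y)) summable_on B"
    using assms has_sum_imp_summable summable_on_iff_abs_summable_on_complex by blast+
  have "(\<lambda>p. norm (case p of (x, y) \<Rightarrow> f x * g y)) summable_on A \<times> B"
  proof (rule summable_on_SigmaI)
    show "((\<lambda>y. norm (case (x, y) of (x, y) \<Rightarrow> f x * g y)) has_sum norm (f x) * infsum (\<lambda>y. norm (g y)) B) B" for x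
      using has_sum_cmult_right[OF has_sum_infsum[OF n(2)], of "norm (f x)"] by (simp add: norm_mult)
    show "(\<lambda>x. norm (f x) * infsum (\<lambda>y. norm (g y)) B) summable_on A"
      by (rule summable_on_cmult_left[OF n(1)])
  qed simp
  then show "(\<lambda>(x, y). f x * g y) summable_on A \<times> B"
    by (rule abs_summable_summable)
qed

text \<open>Multiply by the geometric series of 1/(z - w), which converges for |z| > |w|, and
  collect equal monomials. The resulting inner sums telescope to f n m, because f vanishes far along
  n + m = const.\<close>

lemma laurent_sum_divide:
  assumes g: "laurent_sum (zw_mult f) z w s" and "w \<noteq> 0" "norm z > norm w"
    and f: "\<And>n m. m \<ge> M \<Longrightarrow> f n m = 0"
  shows "laurent_sum f z w (s / (z - w))"
proof -
  have z: "z \<noteq> 0" "z - w \<noteq> 0" using assms(3) by auto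
  have nrm: "norm (w / z) < 1" using assms(3) z by (simp add: norm_divide)
  have "((\<lambda>j. (w / z) ^ j) has_sum 1 / (1 - w / z)) UNIV"
    using nrm by (intro norm_summable_imp_has_sum geometric_sums) (simp_all add: norm_power summable_geometric)
  from has_sum_cmult_right[OF this, of "1 / z"]
  have geo: "((\<lambda>j. z powi (- 1 - int j) * w powi (int j)) has_sum 1 / (z - w)) UNIV"
    using z assms(2) by (simp add: power_int_diff power_divide field_simps power_int_minus)
  let ?g = "\<lambda>(n, m). zw_mult f n m * z powi (- n - 1) * w powi (- m - 1)"
  have prod: "((\<lambda>(x, j). ?g x * (z powi (- 1 - int j) * w powi (int j))) has_sum s * (1 / (z - w))) (UNIV \<times> UNIV)"
    by (rule has_sum_complex_product[OF _ geo]) (use g in \<open>simp add: laurent_sum_def\<close>)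
  let ?h = "\<lambda>((n, m), j). zw_mult f (n - 1 - int j) (m + int j) * z powi (- n - 1) * w powi (- m - 1)"
  have "(?h has_sum s * (1 / (z - w))) (UNIV \<times> UNIV)"
  proof (subst has_sum_reindex_bij_witness[of _ "\<lambda>((n, m), j). ((n + 1 + int j, m - int j), j)" "\<lambda>((n, m), j). ((n - 1 - int j, m + int j), j)"])
    show "((\<lambda>(x, j). ?g x * (z powi (- 1 - int j) * w powi (int j))) has_sum s * (1 / (z - w))) (UNIV \<times> UNIV)"
      by (rule prod)
    show "(case (case a of (x, j) \<Rightarrow> (case x of (n, m) \<Rightarrow> \<lambda>j. ((n - 1 - int j, m + int j), j)) j) of
        (x, j) \<Rightarrow> ?g x * (z powi (- 1 - int j) * w powi (int j))) = ?h a" for a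
    proof -
      obtain n m j where a: "a = ((n, m), j)" by (metis prod.exhaust)
      have 1: "z powi (- (n - 1 - int j) - 1) * z powi (- 1 - int j) = z powi (- n - 1)"
        using z by (subst power_int_add[symmetric]) auto
      have 2: "w powi (- (m + int j) - 1) * w powi (int j) = w powi (- m - 1)"
        using assms(2) by (subst power_int_add[symmetric]) auto
      show ?thesis
        unfolding a by (simp only: prod.case 1[symmetric] 2[symmetric] mult_ac)
    qed
  qed auto
  then have "((\<lambda>(n, m). f n m * z powi (- n - 1) * w powi (- m - 1)) has_sum s * (1 / (z - w))) UNIV"
  proof (rule has_sum_SigmaD)
    fix x :: "int \<times> int"
    obtain n m where x: "x = (n, m)" by (cases x)
    define J where "J = nat (M - m)"
    have tele: "(\<Sum>j<K. zw_mult f (n - 1 - int j) (m + int j)) = f n m - f (n - int K) (m + int K)" for K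
    proof (induction K)
      case (Suc K)
      have "n - 1 - int K + 1 = n - int K" "n - 1 - int K = n - int (Suc K)" "m + int K + 1 = m + int (Suc K)"
        by simp_all
      then have "zw_mult f (n - 1 - int K) (m + int K) = f (n - int K) (m + int K) - f (n - int (Suc K)) (m + int (Suc K))"
        unfolding zw_mult_def by (simp only:)
      then show ?case using Suc by simp
    qed simp
    have "((\<lambda>j. zw_mult f (n - 1 - int j) (m + int j)) has_sum f n m) UNIV"
      by (rule has_sum_finite_neutralI[of "{..<J}"])
         (auto simp: tele f J_def, auto simp: zw_mult_def f)
    from has_sum_cmult_left[OF this, of "z powi (- n - 1) * w powi (- m - 1)"]
    show "((\<lambda>y. ?h (x, y)) has_sum (case x of (n, m) \<Rightarrow> f n m * z powi (- n - 1) * w powi (- m - 1))) UNIV"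
      by (simp add: x mult.assoc)
  qed
  then show ?thesis by (simp add: laurent_sum_def)
qed

lemma zw_mult_pow_support:
  assumes "\<And>n m. m \<ge> M \<Longrightarrow> f n m = 0"
  shows "m \<ge> M \<Longrightarrow> (zw_mult ^^ N) f n m = 0"
  by (induction N arbitrary: n m) (simp_all add: assms zw_mult_def)

lemma zw_mult_pow_support2:
  assumes "\<And>n m. n < K \<Longrightarrow> f n m = 0"
  shows "n < K - int N \<Longrightarrow> (zw_mult ^^ N) f n m = 0"
  by (induction N arbitrary: n m) (simp_all add: assms zw_mult_def)

lemma laurent_sum_divide_pow:
  assumes "laurent_sum ((zw_mult ^^ N) f) z w s" and w: "w \<noteq> 0" "norm z > norm w"
    and f: "\<And>n m. m \<ge> M \<Longrightarrow> f n m = 0"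
  shows "laurent_sum f z w (s / (z - w) ^ N)"
  using assms(1)
proof (induction N arbitrary: s)
  case (Suc N)
  have "laurent_sum ((zw_mult ^^ N) f) z w (s / (z - w))"
    by (rule laurent_sum_divide[OF _ w zw_mult_pow_support]) (use Suc.prems f in auto)
  then have "laurent_sum f z w (s / (z - w) / (z - w) ^ N)" by (rule Suc.IH)
  then show ?case by (simp add: field_simps)
qed simp

text \<open>The mirror case, obtained by exchanging the variables; the sign (-1)^N compensates w - z
  against z - w.\<close>

lemma laurent_sum_divide_pow':
  assumes "laurent_sum ((zw_mult ^^ N) f) z w s" and w: "z \<noteq> 0" "norm w > norm z"
    and f: "\<And>n m. n \<ge> M \<Longrightarrow> f n m = 0"
  shows "laurent_sum f z w (s / (z - w) ^ N)"
proof -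
  define g where "g = (\<lambda>n m. (-1) ^ N * f m n)"
  have sw: "(zw_mult ^^ N) (\<lambda>n m. f m n) n m = (-1) ^ N * (zw_mult ^^ N) f m n" for n m
    by (subst zw_mult_pow_swap) simp
  have "(zw_mult ^^ N) g = (\<lambda>n m. (-1) ^ N * (zw_mult ^^ N) (\<lambda>n m. f m n) n m)"
    unfolding g_def by (rule zw_mult_pow_map[of "\<lambda>x. (-1) ^ N * x"]) (simp add: right_diff_distrib)
  also have "\<dots> = (\<lambda>n m. (zw_mult ^^ N) f m n)"
    by (simp only: sw neg_one_power_cancel)
  finally have "(zw_mult ^^ N) g = (\<lambda>n m. (zw_mult ^^ N) f m n)" .
  then have "laurent_sum ((zw_mult ^^ N) g) w z s"
    using assms(1) laurent_sum_swap[of "(zw_mult ^^ N) f" w z s] by simp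
  then have "laurent_sum g w z (s / (w - z) ^ N)"
    by (rule laurent_sum_divide_pow[OF _ w, of N g s M]) (simp_all add: g_def f)
  then have "laurent_sum (\<lambda>n m. (-1) ^ N * f n m) z w (s / (w - z) ^ N)"
    using laurent_sum_swap[of "\<lambda>n m. (-1) ^ N * f n m" w z] by (simp add: g_def)
  then have "laurent_sum f z w ((-1) ^ N * (s / (w - z) ^ N))"
    unfolding laurent_sum_def
    by (drule_tac c = "(-1) ^ N" in has_sum_cmult_right)
       (simp add: case_prod_unfold mult.assoc neg_one_power_cancel)
  also have "(-1) ^ N * (s / (w - z) ^ N) = s / (z - w) ^ N"
  proof -
    have "(w - z) ^ N = (-1) ^ N * (z - w) ^ N" by (simp flip: power_mult_distrib)
    then show ?thesis by (cases "even N") auto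
  qed
  finally show ?thesis .
qed

section \<open>The identity theorem for double Laurent series\<close>

lemma powser_zero_coeffs:
  fixes c :: "nat \<Rightarrow> complex"
  assumes "\<And>w. 0 < norm w \<Longrightarrow> norm w < 1 \<Longrightarrow> (\<lambda>j. c j * w ^ j) sums 0"
  shows "c j = 0"
proof (rule ccontr)
  assume nz: "c j \<noteq> 0"
  \<comment> \<open>The series is multiplied by w: the nonzero coefficient moves to the positive
    degree \<open>Suc j\<close>, and the value at 0, a point outside the hypothesis, is zero by
    construction.\<close>
  define a where "a n = (case n of 0 \<Rightarrow> 0 | Suc k \<Rightarrow> c k)" for n
  have sm: "(\<lambda>n. a n * (x - 0) ^ n) sums 0" if "norm (x - 0) < 1" for x
  proof (cases "x = 0")
    case True
    have "(\<lambda>n. a n * (x - 0) ^ n) = (\<lambda>n. 0)"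
      using True by (auto simp: a_def split: nat.split)
    then show ?thesis by simp
  next
    case False
    then have "(\<lambda>j. x * (c j * x ^ j)) sums (x * 0)"
      using that assms by (intro sums_mult) auto
    then have "(\<lambda>j. a (Suc j) * (x - 0) ^ Suc j) sums 0"
      by (simp add: a_def mult_ac)
    then show ?thesis by (subst (asm) sums_Suc_iff) (simp add: a_def)
  qed
  show False
  proof (rule powser_0_nonzero[of 1 0 a "\<lambda>_. 0" "Suc j"])
    fix s :: real
    assume "0 < s" and *: "\<And>z :: complex. z \<in> cball 0 s - {0} \<Longrightarrow> 0 \<noteq> (0 :: complex)"
    then have "complex_of_real s \<in> cball 0 s - {0}" by simp
    then show False using * by blast
  qed (use sm nz in \<open>simp_all add: a_def\<close>)
qed

text \<open>With x = 1/z the support makes the series, up to a monomial, a power series in x and w,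
  and the punctured unit bidisc lies in |z| > |w|. The one-variable identity theorem is applied in w
  for fixed x, then in x.\<close>

lemma laurent_sum_zero_imp:
  assumes supp: "\<And>n m. n < K \<Longrightarrow> a n m = 0" "\<And>n m. m \<ge> M \<Longrightarrow> a n m = 0"
    and zero: "\<And>z w. w \<noteq> 0 \<Longrightarrow> norm z > norm w \<Longrightarrow> laurent_sum a z w 0"
  shows "a n m = 0"
proof -
  define b where "b i j = a (int i + K) (M - 1 - int j)" for i j :: nat
  have h: "K \<le> n \<and> m < M" if "a n m \<noteq> 0" for n m
    using that supp by (meson not_le)
  have hs: "((\<lambda>(j, i). b i j * x ^ i * w ^ j) has_sum 0) (UNIV \<times> UNIV)"
    if x: "0 < norm x" "norm x < 1" and w: "0 < norm w" "norm w < 1" for x w :: complex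
  proof -
    have xw: "x \<noteq> 0" "w \<noteq> 0" using x w by auto
    have "1 < norm (1 / x)" using x by (simp add: norm_divide)
    then have "norm w < norm (1 / x)" using w by linarith
    then have "laurent_sum a (1 / x) w 0" using zero xw by blast
    then have "((\<lambda>(n, m). a n m * (1 / x) powi (- n - 1) * w powi (- m - 1)) has_sum 0) UNIV"
      by (simp add: laurent_sum_def)
    also have "?this \<longleftrightarrow> ((\<lambda>(n, m). a n m * (1 / x) powi (- n - 1) * w powi (- m - 1)) has_sum 0) ({K..} \<times> {..<M})"
      by (rule has_sum_cong_neutral) (auto dest: h)
    finally have *: "((\<lambda>(n, m). a n m * (1 / x) powi (- n - 1) * w powi (- m - 1)) has_sum 0) ({K..} \<times> {..<M})" .
    have e: "w powi (- 1 - b) = w powi (- b - 1)" for b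
      by (rule arg_cong[of _ _ "\<lambda>k. w powi k"]) simp
    have "((\<lambda>(j, i). b i j * (1 / x) powi (- (int i + K) - 1) * w powi (- (M - 1 - int j) - 1)) has_sum 0) (UNIV \<times> UNIV)"
      by (rule iffD1[OF has_sum_reindex_bij_witness[of _ "\<lambda>(j, i). (int i + K, M - 1 - int j)" "\<lambda>(n, m). (nat (M - 1 - m), nat (n - K))"] *])
         (auto simp: b_def e)
    from has_sum_cmult_right[OF this, of "(1 / x) powi (K + 1) * w powi M"]
    have "((\<lambda>p. (1 / x) powi (K + 1) * w powi M * (case p of (j, i) \<Rightarrow> b i j * (1 / x) powi (- (int i + K) - 1) * w powi (- (M - 1 - int j) - 1))) has_sum 0) (UNIV \<times> UNIV)"
      by simp
    also have "(\<lambda>p. (1 / x) powi (K + 1) * w powi M * (case p of (j, i) \<Rightarrow> b i j * (1 / x) powi (- (int i + K) - 1) * w powi (- (M - 1 - int j) - 1)))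
       = (\<lambda>(j, i). b i j * x ^ i * w ^ j)"
    proof
      fix p :: "nat \<times> nat"
      obtain j i where p: "p = (j, i)" by (cases p)
      have 1: "(1 / x) powi (K + 1) * (1 / x) powi (- (int i + K) - 1) = x ^ i"
        using xw by (subst power_int_add[symmetric]) (auto simp: power_int_minus power_one_over)
      have 2: "w powi M * w powi (- (M - 1 - int j) - 1) = w ^ j"
        using xw by (subst power_int_add[symmetric]) auto
      show "(1 / x) powi (K + 1) * w powi M * (case p of (j, i) \<Rightarrow> b i j * (1 / x) powi (- (int i + K) - 1) * w powi (- (M - 1 - int j) - 1))
          = (case p of (j, i) \<Rightarrow> b i j * x ^ i * w ^ j)"
        unfolding p prod.case 1[symmetric] 2[symmetric] by (simp only: mult_ac)
    qed
    finally show ?thesis .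
  qed
  have b0: "b i j = 0" for i j
  proof (rule powser_zero_coeffs[of "\<lambda>i. b i j" i])
    fix x :: complex assume x: "0 < norm x" "norm x < 1"
    have sumi: "(\<lambda>i. b i j * x ^ i) summable_on UNIV" for j
    proof -
      \<comment> \<open>Any w with 0 < |w| < 1 would do: summability of the double family at one
        such point gives that of each row, and the factor 2^j then removes the chosen value.\<close>
      have "(\<lambda>(j, i). b i j * x ^ i * (1 / 2) ^ j) summable_on (UNIV \<times> UNIV)"
        using hs[OF x, of "1 / 2"] by (auto dest: has_sum_imp_summable)
      then have "(\<lambda>i. b i j * x ^ i * (1 / 2) ^ j) summable_on UNIV"
        by (rule summable_on_SigmaD1[of "\<lambda>j i. b i j * x ^ i * (1 / 2) ^ j"]) simp
      then have "(\<lambda>i. b i j * x ^ i * (1 / 2) ^ j * 2 ^ j) summable_on UNIV"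
        by (rule summable_on_cmult_left)
      then show ?thesis by (simp add: power_divide)
    qed
    define B where "B j = infsum (\<lambda>i. b i j * x ^ i) UNIV" for j
    have hB: "((\<lambda>i. b i j * x ^ i) has_sum B j) UNIV" for j
      unfolding B_def using sumi by (rule has_sum_infsum)
    have "B j = 0"
    proof (rule powser_zero_coeffs)
      fix w :: complex assume w: "0 < norm w" "norm w < 1"
      have "((\<lambda>j. B j * w ^ j) has_sum 0) UNIV"
        by (rule has_sum_SigmaD[OF hs[OF x w]]) (use has_sum_cmult_left[OF hB] in simp)
      then show "(\<lambda>j. B j * w ^ j) sums 0" by (rule has_sum_imp_sums)
    qed
    then show "(\<lambda>i. b i j * x ^ i) sums 0" using has_sum_imp_sums[OF hB[of j]] by simp
  qed
  show ?thesis
  proof (cases "n < K \<or> m \<ge> M")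
    case False
    then show ?thesis using b0[of "nat (n - K)" "nat (M - 1 - m)"] by (simp add: b_def)
  qed (use supp in auto)
qed

section \<open>Laurent polynomials and comparison of the two notions of locality\<close>

definition laurent_coeff :: "(int \<times> int \<Rightarrow>\<^sub>0 complex) \<Rightarrow> int \<Rightarrow> int \<Rightarrow> complex" where
  "laurent_coeff P n m = Poly_Mapping.lookup P (- n - 1, - m - 1)"

lemma laurent_sum_coeff: "laurent_sum (laurent_coeff P) z w (laurent_eval P z w)"
  unfolding laurent_sum_def
proof (rule has_sum_finite_neutralI[of "(\<lambda>(i, j). (- i - 1, - j - 1)) ` Poly_Mapping.keys P"])
  show "(case x of (n, m) \<Rightarrow> laurent_coeff P n m * z powi (- n - 1) * w powi (- m - 1)) = 0"
    if "x \<in> UNIV - (\<lambda>(i, j). (- i - 1, - j - 1)) ` Poly_Mapping.keys P" for x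
  proof -
    obtain n m where x: "x = (n, m)" by (cases x)
    have "(- n - 1, - m - 1) \<notin> Poly_Mapping.keys P"
      using that by (force simp: x image_iff)
    then show ?thesis by (simp add: x laurent_coeff_def in_keys_iff)
  qed
  have "inj_on (\<lambda>(i, j). (- i - 1, - j - 1)) (Poly_Mapping.keys P)"
    by (auto simp: inj_on_def)
  then show "laurent_eval P z w = (\<Sum>x\<in>(\<lambda>(i, j). (- i - 1, - j - 1)) ` Poly_Mapping.keys P.
      case x of (n, m) \<Rightarrow> laurent_coeff P n m * z powi (- n - 1) * w powi (- m - 1))"
    by (simp add: sum.reindex laurent_eval_def laurent_coeff_def case_prod_unfold)
qed auto

lemma laurent_coeff_bounded: "\<exists>K. \<forall>n m. (\<bar>n\<bar> \<ge> K \<or> \<bar>m\<bar> \<ge> K) \<longrightarrow> laurent_coeff P n m = 0"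
proof -
  define S where "S = insert 0 ((\<lambda>(i, j). max \<bar>i\<bar> \<bar>j\<bar>) ` Poly_Mapping.keys P)"
  have S: "finite S" by (simp add: S_def)
  have "laurent_coeff P n m = 0" if h: "\<bar>n\<bar> \<ge> Max S + 2 \<or> \<bar>m\<bar> \<ge> Max S + 2" for n m
  proof (rule ccontr)
    assume "laurent_coeff P n m \<noteq> 0"
    then have "(- n - 1, - m - 1) \<in> Poly_Mapping.keys P"
      by (simp add: laurent_coeff_def in_keys_iff)
    then have "max \<bar>- n - 1\<bar> \<bar>- m - 1\<bar> \<in> S" unfolding S_def by force
    then have "max \<bar>- n - 1\<bar> \<bar>- m - 1\<bar> \<le> Max S" by (rule Max_ge[OF S])
    then show False using h by auto
  qed
  then show ?thesis by blast
qed

lemma laurent_coeff_surj: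
  assumes "\<And>n m. n < K \<or> n \<ge> L \<or> m < K \<or> m \<ge> L \<Longrightarrow> p n m = 0"
  shows "\<exists>P. laurent_coeff P = p"
proof -
  define q where "q = (\<lambda>(i, j). p (- i - 1) (- j - 1))"
  have h: "K \<le> n \<and> n < L \<and> K \<le> m \<and> m < L" if "p n m \<noteq> 0" for n m
    using that assms[of n m] by (meson not_le)
  have "{x. q x \<noteq> 0} \<subseteq> {- L - 1..- K - 1} \<times> {- L - 1..- K - 1}"
  proof
    fix x assume "x \<in> {x. q x \<noteq> 0}"
    then show "x \<in> {- L - 1..- K - 1} \<times> {- L - 1..- K - 1}"
      using h[of "- fst x - 1" "- snd x - 1"] by (auto simp: q_def case_prod_unfold mem_Times_iff)
  qed
  then have "finite {x. q x \<noteq> 0}" by (rule finite_subset) auto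
  then have "Poly_Mapping.lookup (Abs_poly_mapping q) = q" by simp
  then have "laurent_coeff (Abs_poly_mapping q) = p"
    by (simp add: laurent_coeff_def q_def fun_eq_iff)
  then show ?thesis by blast
qed

text \<open>After multiplication by (z - w)^N both families have the same sum on |z| > |w|, and
  their difference still has bounded support in the required directions, so the identity theorem
  applies.\<close>

lemma laurent_sum_imp_coeff:
  assumes supp: "\<And>n m. n < K \<Longrightarrow> a n m = 0" "\<And>n m. m \<ge> M \<Longrightarrow> a n m = 0"
    and sum: "\<And>z w. w \<noteq> 0 \<Longrightarrow> norm z > norm w \<Longrightarrow> laurent_sum a z w (laurent_eval P z w / (z - w) ^ N)"
  shows "(zw_mult ^^ N) a = laurent_coeff P"
proof (intro ext)
  fix n m
  obtain B where B: "\<And>n m. \<bar>n\<bar> \<ge> B \<or> \<bar>m\<bar> \<ge> B \<Longrightarrow> laurent_coeff P n m = 0"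
    using laurent_coeff_bounded by metis
  have "(\<lambda>n m. (zw_mult ^^ N) a n m - laurent_coeff P n m) n m = 0"
  proof (rule laurent_sum_zero_imp)
    fix n m
    show "(zw_mult ^^ N) a n m - laurent_coeff P n m = 0" if "n < min (K - int N) (- \<bar>B\<bar>)"
    proof -
      have "\<bar>n\<bar> \<ge> B" "n < K - int N" using that by linarith+
      then show ?thesis using zw_mult_pow_support2[of K a n N m] supp B by simp
    qed
    show "(zw_mult ^^ N) a n m - laurent_coeff P n m = 0" if "m \<ge> max M \<bar>B\<bar>"
    proof -
      have "\<bar>m\<bar> \<ge> B" "m \<ge> M" using that by linarith+
      then show ?thesis using zw_mult_pow_support[of M a m N n] supp B by simp
    qed
  next
    fix z w :: complex assume zw: "w \<noteq> 0" "norm z > norm w"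
    then have nz: "z \<noteq> 0" "z - w \<noteq> 0" by auto
    have "laurent_sum ((zw_mult ^^ N) a) z w ((z - w) ^ N * (laurent_eval P z w / (z - w) ^ N))"
      by (rule laurent_sum_zw_mult_pow[OF sum]) (use zw nz in auto)
    then have "laurent_sum ((zw_mult ^^ N) a) z w (laurent_eval P z w)"
      using nz by simp
    from laurent_sum_diff[OF this laurent_sum_coeff[of P z w]]
    show "laurent_sum (\<lambda>n m. (zw_mult ^^ N) a n m - laurent_coeff P n m) z w 0"
      by simp
  qed
  then show "(zw_mult ^^ N) a n m = laurent_coeff P n m" by simp
qed

lemma laurent_sum_imp_coeff':
  assumes supp: "\<And>n m. m < K \<Longrightarrow> a n m = 0" "\<And>n m. n \<ge> M \<Longrightarrow> a n m = 0"
    and sum: "\<And>z w. z \<noteq> 0 \<Longrightarrow> norm w > norm z \<Longrightarrow> laurent_sum a z w (laurent_eval P z w / (z - w) ^ N)"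
  shows "(zw_mult ^^ N) a = laurent_coeff P"
proof (intro ext)
  fix n m
  obtain B where B: "\<And>n m. \<bar>n\<bar> \<ge> B \<or> \<bar>m\<bar> \<ge> B \<Longrightarrow> laurent_coeff P n m = 0"
    using laurent_coeff_bounded by metis
  have s1: "(zw_mult ^^ N) a n m = 0" if "m < K - int N" for n m
  proof -
    have "(zw_mult ^^ N) (\<lambda>n m. a m n) m n = 0"
      by (rule zw_mult_pow_support2[of K]) (use supp that in auto)
    then show ?thesis using zw_mult_pow_swap[of N a m n] by (simp split: if_splits)
  qed
  have s2: "(zw_mult ^^ N) a n m = 0" if "n \<ge> M" for n m
  proof -
    have "(zw_mult ^^ N) (\<lambda>n m. a m n) m n = 0"
      by (rule zw_mult_pow_support[of M]) (use supp that in auto)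
    then show ?thesis using zw_mult_pow_swap[of N a m n] by (simp split: if_splits)
  qed
  have "(\<lambda>m n. (zw_mult ^^ N) a n m - laurent_coeff P n m) m n = 0"
  proof (rule laurent_sum_zero_imp[of "min (K - int N) (- \<bar>B\<bar>)" "\<lambda>m n. (zw_mult ^^ N) a n m - laurent_coeff P n m"
        "max M \<bar>B\<bar>" m n])
    fix m n
    show "(zw_mult ^^ N) a n m - laurent_coeff P n m = 0" if "m < min (K - int N) (- \<bar>B\<bar>)"
    proof -
      have "\<bar>m\<bar> \<ge> B" "m < K - int N" using that by linarith+
      then show ?thesis using s1[of m n] B by simp
    qed
    show "(zw_mult ^^ N) a n m - laurent_coeff P n m = 0" if "n \<ge> max M \<bar>B\<bar>"
    proof -
      have "\<bar>n\<bar> \<ge> B" "n \<ge> M" using that by linarith+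
      then show ?thesis using s2[of n m] B by simp
    qed
  next
    fix w z :: complex assume zw: "z \<noteq> 0" "norm w > norm z"
    then have nz: "w \<noteq> 0" "z - w \<noteq> 0" by auto
    have "laurent_sum ((zw_mult ^^ N) a) z w ((z - w) ^ N * (laurent_eval P z w / (z - w) ^ N))"
      by (rule laurent_sum_zw_mult_pow[OF sum]) (use zw nz in auto)
    then have "laurent_sum ((zw_mult ^^ N) a) z w (laurent_eval P z w)"
      using nz by simp
    from laurent_sum_diff[OF this laurent_sum_coeff[of P z w]]
    show "laurent_sum (\<lambda>m n. (zw_mult ^^ N) a n m - laurent_coeff P n m) w z 0"
      by (subst laurent_sum_swap) simp
  qed
  then show "(zw_mult ^^ N) a n m = laurent_coeff P n m" by simp
qed


text \<open>For cosmooth \<open>A\<close>, \<open>B\<close> that are also smooth, the coefficients of \<open>(A(z)B(w)c,d)\<close> are bounded below in one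
  index and above in the other, and conversely for \<open>(B(w)A(z)c,d)\<close>; hence a series that has both kinds of
  support is a Laurent polynomial.\<close>

definition cosmooth_field :: "('h \<Rightarrow> 'h \<Rightarrow> complex) \<Rightarrow> 'h field \<Rightarrow> bool" where
  "cosmooth_field ip A \<longleftrightarrow> (\<forall>d. \<exists>K. \<forall>n<K. \<forall>u. ip (A n u) d = 0)"

context prehilbert
begin

sublocale complex_space smul ..

lemma ip_zero [simp]: "ip 0 v = 0"
  using ip_scale[of 0 0 v] by simp

lemma ip_minus: "ip (- u) v = - ip u v"
  using ip_scale[of "-1" u v] by simp

lemma ip_diff: "ip (u - v) w = ip u w - ip v w"
  using ip_add[of u "- v" w] by (simp add: ip_minus)

lemma ip_sum: "ip (sum f S) w = (\<Sum>x\<in>S. ip (f x) w)"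
  by (induction S rule: infinite_finite_induct) (simp_all add: ip_add)

lemma ip_zero_right [simp]: "ip v 0 = 0"
  by (subst ip_sym) simp

lemma ip_add_right: "ip w (u + v) = ip w u + ip w v"
  by (subst (1 2 3) ip_sym) (simp add: ip_add)

lemma ip_scale_right: "ip w (smul c u) = cnj c * ip w u"
  by (subst (1 2) ip_sym) (simp add: ip_scale)

lemma ip_eq_zero_iff [simp]: "ip u u = 0 \<longleftrightarrow> u = 0"
  using ip_pos[of u] by (cases "u = 0") auto

lemma ip_nondegenerate: "(\<And>d. ip u d = 0) \<Longrightarrow> u = 0"
  using ip_eq_zero_iff by blast

lemma local_fields_iff_laurent_sum:
  "local_fields ip \<epsilon> A B \<longleftrightarrow> (\<exists>N::nat. \<forall>c d. \<exists>P.
     (\<forall>z w. w \<noteq> 0 \<and> norm z > norm w \<longrightarrow>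
       laurent_sum (\<lambda>n m. ip (A n (B m c)) d) z w (laurent_eval P z w / (z - w) ^ N)) \<and>
     (\<forall>z w. z \<noteq> 0 \<and> norm w > norm z \<longrightarrow>
       laurent_sum (\<lambda>n m. parity_sign \<epsilon> * ip (B m (A n c)) d) z w (laurent_eval P z w / (z - w) ^ N)))"
  by (simp add: local_fields_def laurent_sum_def)

lemma matrix_coeff_support:
  assumes "is_field smul A" "is_field smul B" "smooth_field A" "smooth_field B" "cosmooth_field ip A" "cosmooth_field ip B"
  obtains K M where "\<And>n m. n < K \<Longrightarrow> ip (A n (B m c)) d = 0" "\<And>n m. m \<ge> M \<Longrightarrow> ip (A n (B m c)) d = 0"
    "\<And>n m. m < K \<Longrightarrow> parity_sign \<epsilon> * ip (B m (A n c)) d = 0" "\<And>n m. n \<ge> M \<Longrightarrow> parity_sign \<epsilon> * ip (B m (A n c)) d = 0"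
proof -
  obtain K1 where K1: "\<And>n u. n < K1 \<Longrightarrow> ip (A n u) d = 0"
    using assms(5) unfolding cosmooth_field_def by metis
  obtain K2 where K2: "\<And>n u. n < K2 \<Longrightarrow> ip (B n u) d = 0"
    using assms(6) unfolding cosmooth_field_def by metis
  obtain M where M: "\<And>n. n \<ge> M \<Longrightarrow> A n c = 0" "\<And>n. n \<ge> M \<Longrightarrow> B n c = 0"
    using smooth_field_bound[OF assms(3,4)] by metis
  show ?thesis
    by (rule that[of "min K1 K2" M])
       (simp_all add: K1 K2 M is_field_zero[OF assms(1)] is_field_zero[OF assms(2)])
qed

lemma zw_mult_pow_ip:
  "(zw_mult ^^ N) (\<lambda>n m. ip (F n m) d) = (\<lambda>n m. ip ((zw_mult ^^ N) F n m) d)"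
  by (rule zw_mult_pow_map[of "\<lambda>x. ip x d"]) (rule ip_diff)

text \<open>From analytic to formal: both orders, multiplied by (z - w)^N, have the coefficients of
  one Laurent polynomial, so the supercommutator is killed in every matrix coefficient. Conversely
  the common family is a Laurent polynomial, and division by (z - w)^N is performed separately in
  each region.\<close>

lemma local_fields_iff_formally_local:
  assumes A: "is_field smul A" "is_field smul B" "smooth_field A" "smooth_field B" "cosmooth_field ip A" "cosmooth_field ip B"
  shows "local_fields ip \<epsilon> A B \<longleftrightarrow> formally_local \<epsilon> A B"
proof
  assume "local_fields ip \<epsilon> A B"
  then obtain N where "\<forall>c d. \<exists>P.
     (\<forall>z w. w \<noteq> 0 \<and> norm z > norm w \<longrightarrow>
       laurent_sum (\<lambda>n m. ip (A n (B m c)) d) z w (laurent_eval P z w / (z - w) ^ N)) \<and>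
     (\<forall>z w. z \<noteq> 0 \<and> norm w > norm z \<longrightarrow>
       laurent_sum (\<lambda>n m. parity_sign \<epsilon> * ip (B m (A n c)) d) z w (laurent_eval P z w / (z - w) ^ N))"
    unfolding local_fields_iff_laurent_sum by blast
  then obtain P where P: "\<And>c d z w. w \<noteq> 0 \<Longrightarrow> norm z > norm w \<Longrightarrow>
       laurent_sum (\<lambda>n m. ip (A n (B m c)) d) z w (laurent_eval (P c d) z w / (z - w) ^ N)"
     "\<And>c d z w. z \<noteq> 0 \<Longrightarrow> norm w > norm z \<Longrightarrow>
       laurent_sum (\<lambda>n m. parity_sign \<epsilon> * ip (B m (A n c)) d) z w (laurent_eval (P c d) z w / (z - w) ^ N)"
    by metis
  have "(zw_mult ^^ N) (\<lambda>n m. scomm smul \<epsilon> (A n) (B m) c) = (\<lambda>n m. 0)" for c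
  proof (intro ext ip_nondegenerate)
    fix n m d
    obtain K M where KM: "\<And>n m. n < K \<Longrightarrow> ip (A n (B m c)) d = 0" "\<And>n m. m \<ge> M \<Longrightarrow> ip (A n (B m c)) d = 0"
      "\<And>n m. m < K \<Longrightarrow> parity_sign \<epsilon> * ip (B m (A n c)) d = 0" "\<And>n m. n \<ge> M \<Longrightarrow> parity_sign \<epsilon> * ip (B m (A n c)) d = 0"
      using matrix_coeff_support[OF A, of c d \<epsilon>] by blast
    have 1: "(zw_mult ^^ N) (\<lambda>n m. ip (A n (B m c)) d) = laurent_coeff (P c d)"
      by (rule laurent_sum_imp_coeff[OF KM(1,2) P(1)])
    have 2: "(zw_mult ^^ N) (\<lambda>n m. parity_sign \<epsilon> * ip (B m (A n c)) d) = laurent_coeff (P c d)"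
      by (rule laurent_sum_imp_coeff'[OF KM(3,4) P(2)])
    have "(\<lambda>n m. ip (scomm smul \<epsilon> (A n) (B m) c) d) = (\<lambda>n m. ip (A n (B m c)) d - parity_sign \<epsilon> * ip (B m (A n c)) d)"
      by (simp add: scomm_def ip_diff ip_scale)
    then have "(zw_mult ^^ N) (\<lambda>n m. ip (scomm smul \<epsilon> (A n) (B m) c) d) = (\<lambda>n m. 0)"
      by (simp only: zw_mult_pow_diff 1 2) simp
    then show "ip ((zw_mult ^^ N) (\<lambda>n m. scomm smul \<epsilon> (A n) (B m) c) n m) d = 0"
      unfolding zw_mult_pow_ip by meson
  qed
  then show "formally_local \<epsilon> A B" unfolding formally_local_def by blast
next
  assume "formally_local \<epsilon> A B"
  then obtain N where N: "\<And>v. (zw_mult ^^ N) (\<lambda>n m. scomm smul \<epsilon> (A n) (B m) v) = (\<lambda>n m. 0)"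
    by (auto simp: formally_local_def)
  show "local_fields ip \<epsilon> A B"
    unfolding local_fields_iff_laurent_sum
  proof (intro exI[of _ N] allI)
    fix c d
    let ?a = "\<lambda>n m. ip (A n (B m c)) d" and ?b = "\<lambda>n m. parity_sign \<epsilon> * ip (B m (A n c)) d"
    obtain K M where KM: "\<And>n m. n < K \<Longrightarrow> ?a n m = 0" "\<And>n m. m \<ge> M \<Longrightarrow> ?a n m = 0"
      "\<And>n m. m < K \<Longrightarrow> ?b n m = 0" "\<And>n m. n \<ge> M \<Longrightarrow> ?b n m = 0"
      using matrix_coeff_support[OF A, of c d \<epsilon>] by blast
    define p where "p = (zw_mult ^^ N) ?a"
    have "(\<lambda>n m. ip (scomm smul \<epsilon> (A n) (B m) c) d) = (\<lambda>n m. ?a n m - ?b n m)"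
      by (simp add: scomm_def ip_diff ip_scale)
    then have "(\<lambda>n m. (zw_mult ^^ N) ?a n m - (zw_mult ^^ N) ?b n m) = (\<lambda>n m. 0)"
      using zw_mult_pow_ip[of N "\<lambda>n m. scomm smul \<epsilon> (A n) (B m) c" d]
      by (simp only: N zw_mult_pow_diff ip_zero)
    then have pb: "(zw_mult ^^ N) ?b = p"
      unfolding p_def by (simp add: fun_eq_iff)
    have swap: "p n m = 0" if "(zw_mult ^^ N) (\<lambda>n m. ?b m n) m n = 0" for n m
      using that zw_mult_pow_swap[of N ?b m n] unfolding pb by (simp split: if_splits)
    have "p n m = 0" if "n < K - int N \<or> n \<ge> M \<or> m < K - int N \<or> m \<ge> M" for n m
    proof -
      have "n < K - int N \<Longrightarrow> p n m = 0" unfolding p_def by (rule zw_mult_pow_support2[OF KM(1)])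
      moreover have "m \<ge> M \<Longrightarrow> p n m = 0" unfolding p_def by (rule zw_mult_pow_support[OF KM(2)])
      moreover have "m < K - int N \<Longrightarrow> p n m = 0" by (rule swap, rule zw_mult_pow_support2[OF KM(3)])
      moreover have "n \<ge> M \<Longrightarrow> p n m = 0" by (rule swap, rule zw_mult_pow_support[OF KM(4)])
      ultimately show ?thesis using that by blast
    qed
    then obtain P where P: "laurent_coeff P = p" using laurent_coeff_surj by blast
    show "\<exists>P. (\<forall>z w. w \<noteq> 0 \<and> norm z > norm w \<longrightarrow> laurent_sum ?a z w (laurent_eval P z w / (z - w) ^ N)) \<and>
     (\<forall>z w. z \<noteq> 0 \<and> norm w > norm z \<longrightarrow> laurent_sum ?b z w (laurent_eval P z w / (z - w) ^ N))"
    proof (intro exI[of _ P] conjI allI impI)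
      fix z w :: complex assume zw: "w \<noteq> 0 \<and> norm z > norm w"
      show "laurent_sum ?a z w (laurent_eval P z w / (z - w) ^ N)"
      proof (rule laurent_sum_divide_pow)
        show "laurent_sum ((zw_mult ^^ N) ?a) z w (laurent_eval P z w)"
          using laurent_sum_coeff[of P z w] unfolding P p_def .
      qed (use zw KM(2) in blast)+
    next
      fix z w :: complex assume zw: "z \<noteq> 0 \<and> norm w > norm z"
      show "laurent_sum ?b z w (laurent_eval P z w / (z - w) ^ N)"
      proof (rule laurent_sum_divide_pow')
        show "laurent_sum ((zw_mult ^^ N) ?b) z w (laurent_eval P z w)"
          using laurent_sum_coeff[of P z w] unfolding P pb .
      qed (use zw KM(4) in blast)+
    qed
  qed
qed

end

section \<open>The fermion module and its Virasoro operators\<close>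

lemma sum_int_delta:
  "(\<Sum>p<K. if int p = a then x else 0) = (if 0 \<le> a \<and> a < int K then x else (0 :: 'a::comm_monoid_add))"
proof (cases "0 \<le> a")
  case True
  then have "(int p = a) = (p = nat a)" for p by auto
  then show ?thesis using True by (simp add: zless_nat_conj nat_less_iff)
qed auto

definition int_parity :: "int \<Rightarrow> bit" where
  "int_parity j = (if even j then 0 else 1)"

lemma direct_sum_onI:
  assumes finite_sum: "\<And>u. u \<in> U \<Longrightarrow> \<exists>f. finite {i. f i \<noteq> 0} \<and> (\<forall>i\<in>I. f i \<in> W i) \<and> (\<forall>i. i \<notin> I \<longrightarrow> f i = 0)
      \<and> (\<Sum>i | f i \<noteq> 0. f i) = u"
    and closed: "\<And>f. finite {i. f i \<noteq> 0} \<Longrightarrow> (\<forall>i\<in>I. f i \<in> W i) \<Longrightarrow> (\<forall>i. i \<notin> I \<longrightarrow> f i = 0)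
      \<Longrightarrow> (\<Sum>i | f i \<noteq> 0. f i) \<in> U"
    and diff: "\<And>i x y. i \<in> I \<Longrightarrow> x \<in> W i \<Longrightarrow> y \<in> W i \<Longrightarrow> x - y \<in> W i"
    and indep: "\<And>f A. finite A \<Longrightarrow> A \<subseteq> I \<Longrightarrow> (\<forall>i\<in>A. f i \<in> W i) \<Longrightarrow> (\<Sum>i\<in>A. f i) = 0 \<Longrightarrow> \<forall>i\<in>A. f i = 0"
  shows "direct_sum_on I W U"
  unfolding direct_sum_on_def
proof (rule bij_betw_imageI)
  show "inj_on (\<lambda>f. \<Sum>i | f i \<noteq> 0. f i)
    {f. finite {i. f i \<noteq> 0} \<and> (\<forall>i\<in>I. f i \<in> W i) \<and> (\<forall>i. i \<notin> I \<longrightarrow> f i = 0)}"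
  proof (rule inj_onI, clarify)
    fix f g
    assume f: "finite {i. f i \<noteq> 0}" "\<forall>i\<in>I. f i \<in> W i" "\<forall>i. i \<notin> I \<longrightarrow> f i = 0"
      and g: "finite {i. g i \<noteq> 0}" "\<forall>i\<in>I. g i \<in> W i" "\<forall>i. i \<notin> I \<longrightarrow> g i = 0"
      and eq: "(\<Sum>i | f i \<noteq> 0. f i) = (\<Sum>i | g i \<noteq> 0. g i)"
    define A where "A = {i. f i \<noteq> 0} \<union> {i. g i \<noteq> 0}"
    have A: "finite A" "A \<subseteq> I" using f g by (auto simp: A_def)
    have "(\<Sum>i | f i \<noteq> 0. f i) = (\<Sum>i\<in>A. f i)" "(\<Sum>i | g i \<noteq> 0. g i) = (\<Sum>i\<in>A. g i)"
      by (rule sum.mono_neutral_left; use A in \<open>auto simp: A_def\<close>)+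
    then have "(\<Sum>i\<in>A. f i - g i) = 0" using eq by (simp add: sum_subtractf)
    then have "\<forall>i\<in>A. f i - g i = 0"
      using A f g diff by (intro indep) auto
    then have "f i - g i = 0" if "i \<in> A" for i using that by blast
    moreover have "f i = 0 \<and> g i = 0" if "i \<notin> A" for i using that unfolding A_def by blast
    ultimately show "f = g" by (metis eq_iff_diff_eq_0 ext)
  qed
  show "(\<lambda>f. \<Sum>i | f i \<noteq> 0. f i) `
    {f. finite {i. f i \<noteq> 0} \<and> (\<forall>i\<in>I. f i \<in> W i) \<and> (\<forall>i. i \<notin> I \<longrightarrow> f i = 0)} = U"
  proof (intro subset_antisym subsetI)
    fix u assume "u \<in> U"
    from finite_sum[OF this] show "u \<in> (\<lambda>f. \<Sum>i | f i \<noteq> 0. f i) `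
      {f. finite {i. f i \<noteq> 0} \<and> (\<forall>i\<in>I. f i \<in> W i) \<and> (\<forall>i. i \<notin> I \<longrightarrow> f i = 0)}" by blast
  qed (use closed in blast)
qed

lemma (in prehilbert) orthogonal_sum_zero:
  assumes "finite A" "(\<Sum>i\<in>A. f i) = 0"
    and orth: "\<And>i j. i \<in> A \<Longrightarrow> j \<in> A \<Longrightarrow> i \<noteq> j \<Longrightarrow> ip (f i) (f j) = 0"
    and j: "j \<in> A"
  shows "f j = 0"
proof -
  have "0 = ip (\<Sum>i\<in>A. f i) (f j)" by (simp add: assms)
  also have "\<dots> = (\<Sum>i\<in>A. if i = j then ip (f j) (f j) else 0)"
    unfolding ip_sum by (intro sum.cong refl) (auto simp: orth j)
  also have "\<dots> = ip (f j) (f j)" using assms by simp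
  finally show "f j = 0" by simp
qed

text \<open>Independence of the summands comes from orthogonality and positivity, so for the
  gradings of H only the spanning property remains.\<close>

lemma (in prehilbert) direct_sum_on_orthogonal:
  assumes W: "\<And>i. i \<in> I \<Longrightarrow> subspace (W i)"
    and orth: "\<And>i j u v. i \<in> I \<Longrightarrow> j \<in> I \<Longrightarrow> i \<noteq> j \<Longrightarrow> u \<in> W i \<Longrightarrow> v \<in> W j \<Longrightarrow> ip u v = 0"
    and U: "U = span (\<Union>i\<in>I. W i)"
  shows "direct_sum_on I W U"
proof (rule direct_sum_onI)
  fix u assume "u \<in> U"
  then have "u \<in> span (\<Union>i\<in>I. W i)" by (simp add: U)
  then show "\<exists>f. finite {i. f i \<noteq> 0} \<and> (\<forall>i\<in>I. f i \<in> W i) \<and> (\<forall>i. i \<notin> I \<longrightarrow> f i = 0)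
      \<and> (\<Sum>i | f i \<noteq> 0. f i) = u"
  proof (induction rule: span_induct_alt)
    case base
    show ?case by (rule exI[of _ "\<lambda>_. 0"]) (use W subspace_0 in auto)
  next
    case (step c x y)
    then obtain i f where i: "i \<in> I" "x \<in> W i"
      and f: "finite {i. f i \<noteq> 0}" "\<forall>i\<in>I. f i \<in> W i" "\<forall>i. i \<notin> I \<longrightarrow> f i = 0" "(\<Sum>i | f i \<noteq> 0. f i) = y"
      by blast
    define g where "g = f(i := smul c x + f i)"
    have fin: "finite {i. g i \<noteq> 0}"
      by (rule finite_subset[of _ "insert i {i. f i \<noteq> 0}"]) (use f in \<open>auto simp: g_def\<close>)
    have "(\<Sum>i | g i \<noteq> 0. g i) = (\<Sum>j\<in>insert i {i. f i \<noteq> 0}. g j)"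
      using f(1) by (intro sum.mono_neutral_left) (auto simp: g_def)
    also have "\<dots> = (\<Sum>j\<in>insert i {i. f i \<noteq> 0}. (if j = i then smul c x else 0) + f j)"
      by (intro sum.cong) (auto simp: g_def)
    also have "\<dots> = smul c x + (\<Sum>j\<in>insert i {i. f i \<noteq> 0}. f j)"
      using f(1) by (simp add: sum.distrib)
    also have "(\<Sum>j\<in>insert i {i. f i \<noteq> 0}. f j) = y"
      unfolding f(4)[symmetric] using f(1) by (intro sum.mono_neutral_right) auto
    finally have sum: "(\<Sum>i | g i \<noteq> 0. g i) = smul c x + y" .
    have "smul c x + f i \<in> W i"
      using i f(2) W[OF i(1)] by (intro subspace_add subspace_scale) auto
    then have "\<forall>j\<in>I. g j \<in> W j" "\<forall>j. j \<notin> I \<longrightarrow> g j = 0"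
      using f i by (auto simp: g_def)
    then show ?case using fin sum by blast
  qed
next
  fix f assume f: "finite {i. f i \<noteq> 0}" "\<forall>i\<in>I. f i \<in> W i" "\<forall>i. i \<notin> I \<longrightarrow> f i = 0"
  show "(\<Sum>i | f i \<noteq> 0. f i) \<in> U"
    unfolding U by (rule span_sum, rule span_base) (use f in auto)
next
  fix f A assume A: "finite A" "A \<subseteq> I" "\<forall>i\<in>A. f i \<in> W i" "(\<Sum>i\<in>A. f i) = 0"
  have "f j = 0" if "j \<in> A" for j
    by (rule orthogonal_sum_zero[OF A(1,4) _ that]) (rule orth; use A in blast)
  then show "\<forall>i\<in>A. f i = 0" by blast
qed (use W subspace_diff in blast)

context NS_module
begin

section \<open>Words and energy levels\<close>

lemma psi_field: "is_field smul psi"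
  using psi_linear by (simp add: is_field_def)

lemmas psi_add = is_field_add[OF psi_field]
  and psi_diff = is_field_diff[OF psi_field]
  and psi_scale = is_field_scale[OF psi_field]
  and psi_zero = is_field_zero[OF psi_field]
  and psi_sum = is_field_sum[OF psi_field]

definition word :: "int list \<Rightarrow> 'h" where
  "word ws = foldr psi ws \<Omega>"

lemma word_simps [simp]: "word [] = \<Omega>" "word (k # ws) = psi k (word ws)"
  by (simp_all add: word_def)

lemma I_word: "I (word ws) = word ws"
  by (induction ws) (simp_all add: I_vacuum I_central)

lemma span_range_word: "span (range word) = UNIV"
proof -
  have "\<exists>ks. foldr (generator_action psi I) w \<Omega> = word ks" for w
  proof (induction w)
    case Nil
    show ?case by (rule exI[of _ "[]"]) simp
  next
    case (Cons a w)
    then obtain ks where ks: "foldr (generator_action psi I) w \<Omega> = word ks" by blast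
    show ?case
    proof (cases a)
      case (Psi k)
      then show ?thesis using ks by (intro exI[of _ "k # ks"]) simp
    next
      case Central
      then show ?thesis using ks by (intro exI[of _ ks]) (simp add: I_word)
    qed
  qed
  then have "orbit_map smul psi I \<Omega> x \<in> span (range word)" for x
    unfolding orbit_map_def by (intro span_sum span_scale span_base) (metis rangeI)
  then show ?thesis using generated by (metis UNIV_eq_I surjD)
qed

lemma I_id: "I v = v"
proof -
  interpret I: Vector_Spaces.linear smul smul I by (rule I_linear)
  have "v \<in> span (range word)" by (simp add: span_range_word)
  then show ?thesis
    by (induction rule: span_induct_alt) (auto simp: I_word I.add I.scale I.zero)
qed

lemma psi_swap: "psi m (psi n v) = (if m + n + 1 = 0 then v else 0) - psi n (psi m v)"
  using psi_anticommute[of m n v] by (simp add: I_id eq_diff_eq)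

text \<open>Energies are doubled, so that they are integers: \<open>psi k\<close>, that is \<open>\<psi>\<close> of index \<open>k + 1/2\<close>, raises the
  eigenvalue of \<open>L 0\<close> by \<open>- k - 1/2\<close>.\<close>

definition energy :: "int list \<Rightarrow> int" where
  "energy ws = (\<Sum>k\<leftarrow>ws. - 2 * k - 1)"

lemma energy_simps [simp]: "energy [] = 0" "energy (k # ws) = energy ws - 2 * k - 1"
  by (simp_all add: energy_def)

definition creation :: "int list \<Rightarrow> bool" where
  "creation ws \<longleftrightarrow> (\<forall>k\<in>set ws. k < 0)"

lemma creation_simps [simp]: "creation []" "creation (k # ws) \<longleftrightarrow> k < 0 \<and> creation ws"
  by (simp_all add: creation_def)

lemma energy_nonneg: "creation ws \<Longrightarrow> energy ws \<ge> int (length ws)"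
  by (induction ws) auto

text \<open>Spanned by creation words in any order and with repetitions; no basis is chosen. The
  levels turn out to be the eigenspaces of L_0 in \<open>eigenspace_eq_level\<close>.\<close>

definition level :: "int \<Rightarrow> 'h set" where
  "level j = span {word ws | ws. creation ws \<and> energy ws = j}"

lemma word_level: "creation ws \<Longrightarrow> word ws \<in> level (energy ws)"
  unfolding level_def by (rule span_base) blast

lemma vacuum_level: "\<Omega> \<in> level 0"
  using word_level[of "[]"] by simp

lemma subspace_level: "subspace (level j)"
  by (simp add: level_def)

lemma psi_level_creation:
  assumes "k < 0" "v \<in> level j"
  shows "psi k v \<in> level (j - 2 * k - 1)"
  using assms(2) unfolding level_def[of j]
proof (induction rule: span_induct_alt)
  case base
  then show ?case by (simp add: psi_zero subspace_0[OF subspace_level])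
next
  case (step c x y)
  then obtain ws where ws: "x = word ws" "creation ws" "energy ws = j" by blast
  then have "psi k x \<in> level (j - 2 * k - 1)"
    using word_level[of "k # ws"] assms(1) by simp
  then show ?case using step by (simp add: psi_add psi_scale subspace_add subspace_scale subspace_level)
qed

text \<open>An annihilation mode is moved to the right through the word. A contraction occurs for k
  + a + 1 = 0, where the energies of the two letters cancel, so it lies in the same level.\<close>

lemma psi_level_word: "creation ws \<Longrightarrow> psi k (word ws) \<in> level (energy ws - 2 * k - 1)"
proof (induction ws)
  case Nil
  then show ?case
    using psi_level_creation[OF _ vacuum_level, of k]
    by (cases "k < 0") (auto simp: vacuum_annihilated subspace_0[OF subspace_level])
next
  case (Cons a us)
  show ?case
  proof (cases "k < 0")
    case True
    then show ?thesis using psi_level_creation word_level[OF Cons.prems] by blast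
  next
    case False
    have "psi a (psi k (word us)) \<in> level (energy us - 2 * k - 1 - 2 * a - 1)"
      by (rule psi_level_creation) (use Cons in auto)
    moreover have "(if k + a + 1 = 0 then word us else 0) \<in> level (energy us - 2 * k - 1 - 2 * a - 1)"
    proof (cases "k + a + 1 = 0")
      case True
      then have e: "energy us - 2 * k - 1 - 2 * a - 1 = energy us" by linarith
      show ?thesis unfolding e using True Cons.prems word_level by simp
    qed (simp add: subspace_0[OF subspace_level])
    ultimately have "psi k (psi a (word us)) \<in> level (energy us - 2 * k - 1 - 2 * a - 1)"
      unfolding psi_swap[of k a] by (intro subspace_diff subspace_level)
    then show ?thesis by (simp add: algebra_simps)
  qed
qed

lemma psi_level:
  assumes "v \<in> level j"
  shows "psi k v \<in> level (j - 2 * k - 1)"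
  using assms unfolding level_def[of j]
proof (induction rule: span_induct_alt)
  case base
  then show ?case by (simp add: psi_zero subspace_0[OF subspace_level])
next
  case (step c x y)
  then have "psi k x \<in> level (j - 2 * k - 1)"
    using psi_level_word by blast
  then show ?case using step by (simp add: psi_add psi_scale subspace_add subspace_scale subspace_level)
qed

lemma level_neg: "j < 0 \<Longrightarrow> level j = {0}"
proof -
  assume "j < 0"
  then have "{word ws | ws. creation ws \<and> energy ws = j} = {}"
    using energy_nonneg by force
  then show ?thesis unfolding level_def by (simp only: span_empty)
qed

text \<open>By \<open>psi_level\<close> an arbitrary word lies in some level, and each level is
  spanned by creation words.\<close>

lemma span_creation: "span {word ws | ws. creation ws} = UNIV"
proof -
  have lev: "level j \<subseteq> span {word ws | ws. creation ws}" for j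
    unfolding level_def by (rule span_mono) blast
  have "\<exists>j. word ws \<in> level j" for ws
    by (induction ws) (use vacuum_level psi_level in auto)
  then have "range word \<subseteq> span {word ws | ws. creation ws}"
    using lev by blast
  then have "span (range word) \<subseteq> span {word ws | ws. creation ws}"
    by (rule span_minimal) simp
  then show ?thesis using span_range_word by auto
qed

lemma creation_induct [case_names zero add scale word]:
  assumes "P 0" "\<And>u v. P u \<Longrightarrow> P v \<Longrightarrow> P (u + v)" "\<And>c u. P u \<Longrightarrow> P (smul c u)"
    "\<And>ws. creation ws \<Longrightarrow> P (word ws)"
  shows "P v"
proof -
  have "v \<in> span {word ws | ws. creation ws}" by (simp add: span_creation)
  then show ?thesis
    by (induction rule: span_induct_alt) (use assms in auto)
qed

text \<open>\<open>psi n\<close> lowers the doubled energy by 2n + 1, and levels of negative energy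
  are zero.\<close>

lemma smooth_psi: "smooth_field psi"
  unfolding smooth_field_def
proof
  show "\<exists>K. \<forall>n\<ge>K. psi n v = 0" for v
  proof (induction v rule: creation_induct)
    case zero
    then show ?case by (simp add: psi_zero)
  next
    case (add u v)
    then obtain K1 K2 where "\<forall>n\<ge>K1. psi n u = 0" "\<forall>n\<ge>K2. psi n v = 0" by blast
    then show ?case by (intro exI[of _ "max K1 K2"]) (simp add: psi_add)
  next
    case (scale c u)
    then show ?case by (auto simp: psi_scale)
  next
    case (word ws)
    have "psi n (word ws) = 0" if "n \<ge> energy ws" for n
    proof -
      have "energy ws - 2 * n - 1 < 0" using that energy_nonneg[OF word] by linarith
      then show ?thesis using psi_level_word[OF word, of n] level_neg by blast
    qed
    then show ?case by blast
  qed
qed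

text \<open>The anticommutator is the delta function: it depends on n + m only, so a single factor z
  - w kills it.\<close>

lemma psi_local: "formally_local 1 psi psi"
  unfolding formally_local_def
proof (intro exI[of _ "1::nat"] allI)
  fix v
  have "scomm smul 1 (psi n) (psi m) v = (if n + m + 1 = 0 then v else 0)" for n m
    unfolding scomm_def parity_sign_simps psi_swap[of n m] by simp
  then show "(zw_mult ^^ 1) (\<lambda>n m. scomm smul 1 (psi n) (psi m) v) = (\<lambda>n m. 0)"
    by (simp add: zw_mult_def fun_eq_iff algebra_simps)
qed

section \<open>The Virasoro operators and their eigenspaces\<close>

lemma psi_quadratic_commutator:
  "psi a (psi b (psi k v)) - psi k (psi a (psi b v)) =
     (if b + k + 1 = 0 then psi a v else 0) - (if a + k + 1 = 0 then psi b v else 0)"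
proof -
  have "psi a (psi b (psi k v)) = (if b + k + 1 = 0 then psi a v else 0) - psi a (psi k (psi b v))"
    unfolding psi_swap[of b k] psi_diff by (simp add: psi_zero)
  also have "psi a (psi k (psi b v)) = (if a + k + 1 = 0 then psi b v else 0) - psi k (psi a (psi b v))"
    by (rule psi_swap)
  finally show ?thesis by simp
qed

text \<open>The mode is n + 1 because L_n is the coefficient of z^(-n-2).\<close>

definition vir :: "int \<Rightarrow> 'h \<Rightarrow> 'h" where
  "vir n v = smul (1 / 2) (field_prod smul 1 (-2) psi psi (n + 1) v)"

lemma vir_linear: "Vector_Spaces.linear smul smul (vir n)"
proof -
  have "is_field smul vir"
    unfolding vir_def
    by (rule is_fieldI) (simp_all add: is_field_add[OF is_field_prod[OF psi_field psi_field smooth_psi smooth_psi]]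
      is_field_scale[OF is_field_prod[OF psi_field psi_field smooth_psi smooth_psi]] scale_right_distrib mult.commute)
  then show ?thesis by (simp add: is_field_def)
qed

lemma vir_field: "is_field smul vir"
  using vir_linear by (simp add: is_field_def)

lemmas vir_add = is_field_add[OF vir_field]
  and vir_scale = is_field_scale[OF vir_field]
  and vir_zero = is_field_zero[OF vir_field]

text \<open>The factor p + 1 comes from expanding (z - w)^(-2). The plus sign is the minus of the
  product formula times the sign -1 of two odd fields.\<close>

definition vir_term :: "int \<Rightarrow> nat \<Rightarrow> 'h \<Rightarrow> 'h" where
  "vir_term n p v = smul (of_nat (Suc p) / 2)
     (psi (- 2 - int p) (psi (n + 1 + int p) v) + psi (n - 1 - int p) (psi (int p) v))"

lemma vir_eq_sum: obtains K0 where "\<And>K. K \<ge> K0 \<Longrightarrow> vir n v = (\<Sum>p<K. vir_term n p v)"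
proof -
  obtain K0 where K0: "\<And>K. K \<ge> K0 \<Longrightarrow> field_prod smul 1 (-2) psi psi (n + 1) v = (\<Sum>p<K. prod_term 1 (-2) psi psi (n + 1) v p)"
    using field_prod_sum_bound[OF psi_field psi_field smooth_psi smooth_psi] by metis
  have "zw_coeff (- 2) p = of_nat (Suc p)" for p
    by (simp add: zw_coeff_neg nat_add_distrib Suc_as_int[symmetric])
  then have "smul (1 / 2) (prod_term 1 (-2) psi psi (n + 1) v p) = vir_term n p v" for p
    by (simp add: prod_term_def vir_term_def scale_right_distrib ac_simps del: of_nat_Suc)
  then have "vir n v = (\<Sum>p<K. vir_term n p v)" if "K \<ge> K0" for K
    unfolding vir_def K0[OF that] by (simp add: scale_sum_right)
  then show ?thesis using that by blast
qed

text \<open>In terms of r = k + 1/2 this is [L_n, \<psi>_r] = -(n/2 + r) \<psi>_{n+r}: the field is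
  primary of weight 1/2.\<close>

lemma vir_psi: "vir n (psi k v) = psi k (vir n v) + smul (- of_int (n + 2 * k + 1) / 2) (psi (n + k) v)"
proof -
  obtain K1 where K1: "\<And>K. K \<ge> K1 \<Longrightarrow> vir n (psi k v) = (\<Sum>p<K. vir_term n p (psi k v))" using vir_eq_sum by metis
  obtain K2 where K2: "\<And>K. K \<ge> K2 \<Longrightarrow> vir n v = (\<Sum>p<K. vir_term n p v)" using vir_eq_sum by metis
  define K where "K = K1 + K2 + nat (\<bar>n\<bar> + \<bar>k\<bar> + 1)"
  have K: "K \<ge> K1" "K \<ge> K2" and "K \<ge> nat (\<bar>n\<bar> + \<bar>k\<bar> + 1)" by (simp_all add: K_def)
  then have Kb: "int K > \<bar>n\<bar> + \<bar>k\<bar>" by linarith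
  define x where "x = psi (n + k) v"
  \<comment> \<open>Contracting \<open>psi k\<close> with each of the four factors in
    \<open>vir_term\<close> fixes p, and the remaining factor is always
    \<open>psi (n + k)\<close>.\<close>
  have t: "vir_term n p (psi k v) - psi k (vir_term n p v) =
      (if int p = - n - k - 2 then smul (- of_int (n + k + 1) / 2) x else 0)
      - (if int p = k - 1 then smul (of_int k / 2) x else 0)
      + (if int p = - k - 1 then smul (- of_int k / 2) x else 0)
      - (if int p = n + k then smul (of_int (n + k + 1) / 2) x else 0)" for p
  proof -
    have "vir_term n p (psi k v) - psi k (vir_term n p v) = smul (of_nat (Suc p) / 2)
       ((psi (- 2 - int p) (psi (n + 1 + int p) (psi k v)) - psi k (psi (- 2 - int p) (psi (n + 1 + int p) v)))
       + (psi (n - 1 - int p) (psi (int p) (psi k v)) - psi k (psi (n - 1 - int p) (psi (int p) v))))"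
      by (simp add: vir_term_def psi_add psi_scale algebra_simps del: of_nat_Suc)
    also have "\<dots> = (if int p = - n - k - 2 then smul (of_nat (Suc p) / 2) (psi (- 2 - int p) v) else 0)
      - (if int p = k - 1 then smul (of_nat (Suc p) / 2) (psi (n + 1 + int p) v) else 0)
      + (if int p = - k - 1 then smul (of_nat (Suc p) / 2) (psi (n - 1 - int p) v) else 0)
      - (if int p = n + k then smul (of_nat (Suc p) / 2) (psi (int p) v) else 0)"
    proof -
      have "(n + 1 + int p + k + 1 = 0) = (int p = - n - k - 2)" "(- 2 - int p + k + 1 = 0) = (int p = k - 1)"
        "(int p + k + 1 = 0) = (int p = - k - 1)" "(n - 1 - int p + k + 1 = 0) = (int p = n + k)"
        by auto
      then show ?thesis
        unfolding psi_quadratic_commutator by (simp add: scale_right_distrib scale_right_diff_distrib del: of_nat_Suc)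
    qed
    also have "(if int p = - n - k - 2 then smul (of_nat (Suc p) / 2) (psi (- 2 - int p) v) else 0) =
        (if int p = - n - k - 2 then smul (- of_int (n + k + 1) / 2) x else 0)"
    proof (cases "int p = - n - k - 2")
      case True
      then have "int (Suc p) = - (n + k + 1)" "- 2 - int p = n + k" by simp_all
      then have "of_nat (Suc p) = (- of_int (n + k + 1) :: complex)" "psi (- 2 - int p) v = x"
        unfolding x_def by (metis of_int_minus of_int_of_nat_eq, simp only:)
      then show ?thesis by (simp only:)
    qed simp
    also have "(if int p = k - 1 then smul (of_nat (Suc p) / 2) (psi (n + 1 + int p) v) else 0) =
        (if int p = k - 1 then smul (of_int k / 2) x else 0)"
    proof (cases "int p = k - 1")
      case True
      then have "int (Suc p) = k" "n + 1 + int p = n + k" by simp_all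
      then have "of_nat (Suc p) = (of_int k :: complex)" "psi (n + 1 + int p) v = x"
        unfolding x_def by (metis of_int_of_nat_eq, simp only:)
      then show ?thesis by (simp only:)
    qed simp
    also have "(if int p = - k - 1 then smul (of_nat (Suc p) / 2) (psi (n - 1 - int p) v) else 0) =
        (if int p = - k - 1 then smul (- of_int k / 2) x else 0)"
    proof (cases "int p = - k - 1")
      case True
      then have "int (Suc p) = - k" "n - 1 - int p = n + k" by simp_all
      then have "of_nat (Suc p) = (- of_int k :: complex)" "psi (n - 1 - int p) v = x"
        unfolding x_def by (metis of_int_minus of_int_of_nat_eq, simp only:)
      then show ?thesis by (simp only:)
    qed simp
    also have "(if int p = n + k then smul (of_nat (Suc p) / 2) (psi (int p) v) else 0) =
        (if int p = n + k then smul (of_int (n + k + 1) / 2) x else 0)"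
    proof (cases "int p = n + k")
      case True
      then have "int (Suc p) = n + k + 1" by simp
      then have "of_nat (Suc p) = (of_int (n + k + 1) :: complex)"
        by (metis of_int_of_nat_eq)
      then show ?thesis unfolding x_def using True by (simp only:)
    qed simp
    finally show ?thesis .
  qed
  have "vir n (psi k v) - psi k (vir n v) = (\<Sum>p<K. vir_term n p (psi k v) - psi k (vir_term n p v))"
    unfolding K1[OF K(1)] K2[OF K(2)] psi_sum sum_subtractf ..
  also have "\<dots> = (if 0 \<le> - n - k - 2 then smul (- of_int (n + k + 1) / 2) x else 0)
      - (if 0 \<le> k - 1 then smul (of_int k / 2) x else 0)
      + (if 0 \<le> - k - 1 then smul (- of_int k / 2) x else 0)
      - (if 0 \<le> n + k then smul (of_int (n + k + 1) / 2) x else 0)"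
    unfolding t sum.distrib sum_subtractf sum_int_delta
  proof -
    have "- n - k - 2 < int K" "k - 1 < int K" "- k - 1 < int K" "n + k < int K" using Kb by linarith+
    then show "(if 0 \<le> - n - k - 2 \<and> - n - k - 2 < int K then smul (- of_int (n + k + 1) / 2) x else 0) -
      (if 0 \<le> k - 1 \<and> k - 1 < int K then smul (of_int k / 2) x else 0) +
      (if 0 \<le> - k - 1 \<and> - k - 1 < int K then smul (- of_int k / 2) x else 0) -
      (if 0 \<le> n + k \<and> n + k < int K then smul (of_int (n + k + 1) / 2) x else 0) =
      (if 0 \<le> - n - k - 2 then smul (- of_int (n + k + 1) / 2) x else 0)
      - (if 0 \<le> k - 1 then smul (of_int k / 2) x else 0)
      + (if 0 \<le> - k - 1 then smul (- of_int k / 2) x else 0)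
      - (if 0 \<le> n + k then smul (of_int (n + k + 1) / 2) x else 0)" by (simp only: simp_thms)
  qed
  \<comment> \<open>The four terms form two pairs with equal contributions. In each pair exactly one
    condition holds, except at n + k + 1 = 0 or k = 0, where the coefficient is zero anyway.\<close>
  also have "\<dots> = smul (- of_int (n + k + 1) / 2) x - smul (of_int k / 2) x"
  proof -
    have "(if 0 \<le> - n - k - 2 then smul (- of_int (n + k + 1) / 2) x else 0)
        - (if 0 \<le> n + k then smul (of_int (n + k + 1) / 2) x else 0) = smul (- of_int (n + k + 1) / 2) x"
    proof -
      consider "0 \<le> - n - k - 2" "\<not> 0 \<le> n + k" | "\<not> 0 \<le> - n - k - 2" "0 \<le> n + k" | "n + k + 1 = 0" by linarith
      then show ?thesis by cases (simp_all del: of_int_add of_int_diff of_int_minus)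
    qed
    moreover have "(if 0 \<le> - k - 1 then smul (- of_int k / 2) x else 0)
        - (if 0 \<le> k - 1 then smul (of_int k / 2) x else 0) = - smul (of_int k / 2) x"
    proof -
      consider "0 \<le> - k - 1" "\<not> 0 \<le> k - 1" | "\<not> 0 \<le> - k - 1" "0 \<le> k - 1" | "k = 0" by linarith
      then show ?thesis by cases simp_all
    qed
    ultimately show ?thesis by (simp add: algebra_simps)
  qed
  also have "\<dots> = smul (- of_int (n + 2 * k + 1) / 2) x"
  proof -
    have "(- of_int (n + 2 * k + 1) / 2 :: complex) = - of_int (n + k + 1) / 2 - of_int k / 2"
      by (simp add: field_simps)
    then show ?thesis by (simp only: scale_left_diff_distrib)
  qed
  finally show ?thesis by (simp add: x_def algebra_simps)
qed

lemma vir_vacuum: "n \<ge> -1 \<Longrightarrow> vir n \<Omega> = 0"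
  using field_prod_state(2)[OF psi_field psi_field, of \<Omega> "n + 1" 1 "-2"] by (simp add: vir_def vacuum_annihilated)

lemma vir_vacuum_conformal: "vir (-2) \<Omega> = smul (1 / 2) (psi (-2) (psi (-1) \<Omega>))"
  using field_prod_state(1)[OF psi_field psi_field, of \<Omega> 1 "-2"] by (simp add: vir_def vacuum_annihilated)

lemma vir0_level:
  assumes "v \<in> level j"
  shows "vir 0 v = smul (of_int j / 2) v"
proof -
  have w: "vir 0 (word ws) = smul (of_int (energy ws) / 2) (word ws)" for ws
    by (induction ws)
       (simp_all add: vir_vacuum vir_psi psi_scale diff_divide_distrib add_divide_distrib algebra_simps flip: scale_left_distrib)
  show ?thesis
    using assms unfolding level_def
    by (induction rule: span_induct_alt) (auto simp: vir_zero vir_add vir_scale w scale_right_distrib mult.commute)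
qed

lemma psi_adjoint': "ip u (psi k v) = ip (psi (- k - 1) u) v"
  using psi_adjoint[of "- k - 1" u v] by simp

text \<open>As \<open>psi k\<close> has adjoint \<open>psi (- k - 1)\<close>, each of the two
  monomials in \<open>vir_term\<close> is its own adjoint when n = 0.\<close>

lemma vir0_selfadjoint: "ip (vir 0 u) v = ip u (vir 0 v)"
proof -
  obtain K1 where K1: "\<And>K. K \<ge> K1 \<Longrightarrow> vir 0 u = (\<Sum>p<K. vir_term 0 p u)" using vir_eq_sum by metis
  obtain K2 where K2: "\<And>K. K \<ge> K2 \<Longrightarrow> vir 0 v = (\<Sum>p<K. vir_term 0 p v)" using vir_eq_sum by metis
  define K where "K = max K1 K2"
  have K: "K \<ge> K1" "K \<ge> K2" by (simp_all add: K_def)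
  have ip_sum_right: "ip u (sum f S) = (\<Sum>x\<in>S. ip u (f x))" for f and S :: "nat set"
    by (induction S rule: infinite_finite_induct) (simp_all add: ip_add_right)
  have e: "psi (- int p - 1) = psi (- 1 - int p)" "psi (- int p - 2) = psi (- 2 - int p)" for p
    by (rule arg_cong[of _ _ psi], simp)+
  have "ip (vir_term 0 p u) v = ip u (vir_term 0 p v)" for p
    by (simp add: vir_term_def ip_scale ip_add ip_scale_right ip_add_right psi_adjoint algebra_simps e)
  then show ?thesis
    unfolding K1[OF K(1)] K2[OF K(2)] ip_sum ip_sum_right by simp
qed

lemma vir0_orthogonal:
  assumes "vir 0 u = smul (of_real a) u" "vir 0 v = smul (of_real b) v" "a \<noteq> b"
  shows "ip u v = 0"
proof -
  have "of_real a * ip u v = of_real b * ip u v"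
    using vir0_selfadjoint[of u v] by (simp add: assms ip_scale ip_scale_right)
  then show ?thesis using assms(3) by simp
qed

lemma vir0_level_real: "v \<in> level j \<Longrightarrow> vir 0 v = smul (of_real (of_int j / 2)) v"
  by (simp add: vir0_level)

lemma level_orthogonal: "u \<in> level i \<Longrightarrow> v \<in> level j \<Longrightarrow> i \<noteq> j \<Longrightarrow> ip u v = 0"
  by (rule vir0_orthogonal[OF vir0_level_real vir0_level_real]) auto

text \<open>Split an eigenvector v as a + b with a in the level and b in the span of the other
  levels. Then b is an eigenvector for the same value, hence orthogonal to all other levels and so
  to itself.\<close>

lemma eigenspace_eq_level: "{v. vir 0 v = smul (of_real (of_int j / 2)) v} = level j"
proof (intro subset_antisym subsetI)
  fix v assume "v \<in> {v. vir 0 v = smul (of_real (of_int j / 2)) v}"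
  then have v: "vir 0 v = smul (of_real (of_int j / 2)) v" by simp
  let ?S = "{word ws | ws. creation ws \<and> energy ws = j}" and ?T = "{word ws | ws. creation ws \<and> energy ws \<noteq> j}"
  have "v \<in> span (?S \<union> ?T)"
  proof -
    have "?S \<union> ?T = {word ws | ws. creation ws}" by blast
    then show ?thesis by (simp only: span_creation UNIV_I)
  qed
  then obtain a b where ab: "v = a + b" "a \<in> level j" "b \<in> span ?T"
    unfolding span_Un level_def by blast
  have b: "vir 0 b = smul (of_real (of_int j / 2)) b"
    using v vir0_level_real[OF ab(2)] by (simp add: ab(1) vir_add scale_right_distrib)
  have "ip x b = 0" if "x \<in> span ?T" for x
    using that
  proof (induction rule: span_induct_alt)
    case (step c x y)
    then obtain ws where "x = word ws" "creation ws" "energy ws \<noteq> j" by blast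
    then have "ip x b = 0"
      using vir0_orthogonal[OF vir0_level_real[OF word_level] b] by auto
    then show ?case using step by (simp add: ip_add ip_scale)
  qed simp
  from this[OF ab(3)] have "b = 0" by simp
  then show "v \<in> level j" using ab by simp
qed (simp add: vir0_level)

lemma psi_weight: "vir 0 (psi k v) = psi k (vir 0 v) + smul (- 1 / 2 - of_int k) (psi k v)"
proof -
  have "- of_int (0 + 2 * k + 1) / 2 = (- 1 / 2 - of_int k :: complex)" by (simp add: field_simps)
  then show ?thesis using vir_psi[of 0 k v] by simp
qed

lemma vir_weight: "vir 0 (vir n v) = vir n (vir 0 v) + smul (- of_int n) (vir n v)"
proof -
  \<comment> \<open>Each -1/2 is the weight 1/2 minus 1; with the index -2 and the mode n + 1 the
    total is -n.\<close>
  have "vir 0 (field_prod smul 1 (-2) psi psi (n + 1) v) = field_prod smul 1 (-2) psi psi (n + 1) (vir 0 v)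
     + smul (- 1 / 2 + (- 1 / 2) - of_int (-2) - of_int (n + 1)) (field_prod smul 1 (-2) psi psi (n + 1) v)"
    by (rule field_prod_weight[OF psi_field psi_field smooth_psi smooth_psi vir_linear]) (rule psi_weight)+
  then have "vir 0 (field_prod smul 1 (-2) psi psi (n + 1) v) = field_prod smul 1 (-2) psi psi (n + 1) (vir 0 v)
     + smul (- of_int n) (field_prod smul 1 (-2) psi psi (n + 1) v)"
    by simp
  then show ?thesis
    unfolding vir_def[of n] vir_scale by (simp add: scale_right_distrib scale_right_diff_distrib mult.commute)
qed

lemma vir_level:
  assumes "v \<in> level j"
  shows "vir n v \<in> level (j - 2 * n)"
proof -
  have "vir 0 (vir n v) = smul (of_real (of_int (j - 2 * n) / 2)) (vir n v)"
    unfolding vir_weight vir0_level[OF assms] vir_scale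
    by (simp add: diff_divide_distrib scale_left_diff_distrib)
  then show ?thesis using eigenspace_eq_level[of "j - 2 * n"] by blast
qed

text \<open>Subtracting the projection to the vacuum leaves a vector orthogonal to the vacuum and,
  by adjunction, to every word that begins with a creation mode.\<close>

lemma vacuum_unique:
  assumes "\<And>k. k \<ge> 0 \<Longrightarrow> psi k v = 0"
  shows "v = smul (ip v \<Omega>) \<Omega>"
proof -
  define u where "u = v - smul (ip v \<Omega>) \<Omega>"
  have u: "psi k u = 0" if "k \<ge> 0" for k
    using that assms by (simp add: u_def psi_diff psi_scale vacuum_annihilated)
  have "ip u d = 0" for d
  proof (induction d rule: creation_induct)
    case (word ws)
    then show ?case
    proof (cases ws)
      case Nil
      then show ?thesis by (simp add: u_def ip_diff ip_scale ip_vacuum)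
    next
      case (Cons k us)
      then show ?thesis using u[of "- k - 1"] word by (simp add: psi_adjoint')
    qed
  qed (simp_all add: ip_add_right ip_scale_right)
  then have "u = 0" by (rule ip_nondegenerate)
  then show ?thesis by (simp add: u_def)
qed

text \<open>For n <= 0 the leftmost factor of each monomial in L_n is a creation mode, and its
  adjoint kills the vacuum.\<close>

lemma ip_vir_vacuum: "n \<le> 0 \<Longrightarrow> ip (vir n u) \<Omega> = 0"
proof -
  assume n: "n \<le> 0"
  obtain K where K: "\<And>K'. K' \<ge> K \<Longrightarrow> vir n u = (\<Sum>p<K'. vir_term n p u)" using vir_eq_sum by metis
  have "ip (vir_term n p u) \<Omega> = 0" for p
    using n by (simp add: vir_term_def ip_scale ip_add psi_adjoint vacuum_annihilated)
  then show ?thesis using K[of K] by (simp add: ip_sum)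
qed

section \<open>The Virasoro relations and the central term\<close>

definition vir_anomaly :: "int \<Rightarrow> int \<Rightarrow> 'h \<Rightarrow> 'h" where
  "vir_anomaly m n v = vir m (vir n v) - vir n (vir m v) - smul (of_int (m - n)) (vir (m + n) v)"

lemma vir_anomaly_psi: "vir_anomaly m n (psi k v) = psi k (vir_anomaly m n v)"
proof -
  define a :: "int \<Rightarrow> int \<Rightarrow> complex" where "a n k = - of_int (n + 2 * k + 1) / 2" for n k
  have vp: "vir n (psi k v) = psi k (vir n v) + smul (a n k) (psi (n + k) v)" for n k v
    unfolding a_def by (rule vir_psi)
  \<comment> \<open>The operators taking \<open>psi k\<close> to \<open>a n k\<close> times
    \<open>psi (n + k)\<close> satisfy the Witt relations; this is why the anomaly commutes with
    \<open>psi\<close>.\<close>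
  have c: "a n k * a m (n + k) - a m k * a n (m + k) = of_int (m - n) * a (m + n) k"
    by (simp add: a_def field_simps)
  have e: "psi (m + (n + k)) v = psi (m + n + k) v" "psi (n + (m + k)) v = psi (m + n + k) v"
    by (simp_all add: algebra_simps)
  have "vir_anomaly m n (psi k v) = psi k (vir_anomaly m n v)
     + smul (a n k * a m (n + k) - a m k * a n (m + k) - of_int (m - n) * a (m + n) k) (psi (m + n + k) v)"
    unfolding vir_anomaly_def vp vir_add vir_scale e psi_diff psi_scale
    by (simp add: scale_right_distrib scale_left_diff_distrib algebra_simps)
  then show ?thesis by (simp add: c)
qed

text \<open>The anomaly commutes with all \<open>psi k\<close>, so it maps the vacuum to a vector annihilated by \<open>psi k\<close> for
  \<open>k \<ge> 0\<close>, and it is determined by this vector.\<close>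

lemma vir_anomaly_scalar: "vir_anomaly m n v = smul (ip (vir_anomaly m n \<Omega>) \<Omega>) v"
proof -
  have field: "vir_anomaly m n 0 = 0" "vir_anomaly m n (u + v) = vir_anomaly m n u + vir_anomaly m n v"
    "vir_anomaly m n (smul c v) = smul c (vir_anomaly m n v)" for u v c
    by (simp_all add: vir_anomaly_def vir_zero vir_add vir_scale scale_right_distrib scale_right_diff_distrib
        mult.commute)
  have vac: "vir_anomaly m n \<Omega> = smul (ip (vir_anomaly m n \<Omega>) \<Omega>) \<Omega>"
    by (rule vacuum_unique) (simp add: vacuum_annihilated field flip: vir_anomaly_psi)
  show ?thesis
  proof (induction v rule: creation_induct)
    case (word ws)
    show ?case
      by (induction ws) (use vac in \<open>simp_all add: vir_anomaly_psi psi_scale\<close>)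
  qed (simp_all add: field scale_right_distrib mult.commute)
qed

lemma ip_vir_vacuum_vacuum: "ip (vir n \<Omega>) \<Omega> = 0"
  by (cases "n \<le> 0") (simp_all add: ip_vir_vacuum vir_vacuum)

text \<open>The scalar by which the anomaly acts is a vacuum expectation value, and for m + n
  different from 0 it pairs vectors of different levels.\<close>

lemma vir_commutator_generic:
  assumes "m + n \<noteq> 0"
  shows "vir m (vir n v) = vir n (vir m v) + smul (of_int (m - n)) (vir (m + n) v)"
proof -
  have "vir i (vir j \<Omega>) \<in> level (0 - 2 * j - 2 * i)" for i j
    by (intro vir_level vacuum_level)
  note lev = this
  have "ip (vir i (vir j \<Omega>)) \<Omega> = 0" if "i + j \<noteq> 0" for i j
    by (rule level_orthogonal[OF lev vacuum_level]) (use that in presburger)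
  then have "ip (vir_anomaly m n \<Omega>) \<Omega> = 0"
    using assms by (simp add: vir_anomaly_def ip_diff ip_scale ip_vir_vacuum_vacuum add.commute)
  then have "vir_anomaly m n v = 0" using vir_anomaly_scalar[of m n v] by simp
  then show ?thesis by (simp add: vir_anomaly_def algebra_simps)
qed

text \<open>Both contractions give 1, so only the square of the factor 1/2 remains.\<close>

lemma conformal_norm: "ip (vir (-2) \<Omega>) (vir (-2) \<Omega>) = 1 / 4"
proof -
  have 1: "psi 1 (psi (-2) (psi (-1) \<Omega>)) = psi (-1) \<Omega>"
    unfolding psi_swap[of 1 "-2"] psi_swap[of 1 "-1"] by (simp add: vacuum_annihilated psi_zero)
  have 0: "psi 0 (psi (-1) \<Omega>) = \<Omega>"
    unfolding psi_swap[of 0 "-1"] by (simp add: vacuum_annihilated psi_zero)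
  show ?thesis
    unfolding vir_vacuum_conformal
    by (simp add: ip_scale ip_scale_right psi_adjoint 1 0 ip_vacuum)
qed

lemma central_term: "ip (vir (int m) (vir (- int m) \<Omega>)) \<Omega> = of_int (int m * (int m ^ 2 - 1)) / 24"
proof -
  define c where "c m = ip (vir (int m) (vir (- int m) \<Omega>)) \<Omega>" for m
  \<comment> \<open>Insert [L_{-1}, L_{-m}] = (m - 1) L_{-m-1} on the vacuum, then commute L_{m+1}
    past L_{-1}, which yields (m + 2) L_m; the term starting with L_{-1} is orthogonal to the
    vacuum.\<close>
  have rec: "(of_nat m - 1) * c (Suc m) = (of_nat m + 2) * c m" if "m \<ge> 1" for m
  proof -
    have "vir (- 1) (vir (- int m) \<Omega>) = smul (of_int (int m - 1)) (vir (- int (Suc m)) \<Omega>)"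
      using vir_commutator_generic[of "-1" "- int m" \<Omega>] that by (simp add: vir_vacuum vir_zero)
    then have "(of_nat m - 1) * c (Suc m) = ip (vir (int (Suc m)) (vir (- 1) (vir (- int m) \<Omega>))) \<Omega>"
      by (simp add: c_def vir_scale ip_scale)
    also have "\<dots> = (of_nat m + 2) * c m"
      using vir_commutator_generic[of "int (Suc m)" "-1" "vir (- int m) \<Omega>"] that
      by (simp add: c_def ip_add ip_scale ip_vir_vacuum)
    finally show ?thesis .
  qed
  \<comment> \<open>At m = 1 the factor m - 1 vanishes, so the recursion does not reach 2. This
    value is the independent datum that carries the central charge.\<close>
  have c2: "c 2 = 1 / 4"
  proof -
    have 0: "psi 0 (psi (-1) \<Omega>) = \<Omega>"
      unfolding psi_swap[of 0 "-1"] by (simp add: vacuum_annihilated psi_zero)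
    have "vir 2 (psi (-2) (psi (-1) \<Omega>)) = smul (1 / 2) \<Omega>"
      by (simp add: vir_psi vir_vacuum vacuum_annihilated psi_zero 0)
    then show ?thesis
      by (simp add: c_def vir_vacuum_conformal vir_scale ip_scale ip_vacuum)
  qed
  have c3: "c (Suc (Suc m)) = of_int (int (Suc (Suc m)) * (int (Suc (Suc m)) ^ 2 - 1)) / 24" for m
  proof (induction m)
    case 0
    then show ?case using c2 by (simp add: numeral_2_eq_2)
  next
    case (Suc m)
    have "(of_nat m + 1) * c (Suc (Suc (Suc m))) = (of_nat m + 4) * c (Suc (Suc m))"
      using rec[of "Suc (Suc m)"] by (simp add: algebra_simps)
    also have "\<dots> = (of_nat m + 1) * (of_int (int (Suc (Suc (Suc m))) * (int (Suc (Suc (Suc m))) ^ 2 - 1)) / 24)"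
      unfolding Suc.IH by (simp add: power2_eq_square field_simps)
    finally show ?case
      by (metis mult_left_cancel of_nat_Suc of_nat_eq_0_iff nat.distinct(1) add.commute)
  qed
  consider "m = 0" | "m = 1" | k where "m = Suc (Suc k)" by (metis One_nat_def not0_implies_Suc)
  then have "c m = of_int (int m * (int m ^ 2 - 1)) / 24"
    by cases (simp_all add: c3, simp_all add: c_def vir_vacuum vir_zero)
  then show ?thesis by (simp add: c_def)
qed

text \<open>The constant 1/24 is c/12 with c = 1/2. For m + n = 0 and negative m the relation
  follows from the positive case by antisymmetry.\<close>

lemma virasoro_relation:
  "vir m (vir n v) - vir n (vir m v) = smul (of_int (m - n)) (vir (m + n) v)
     + smul (if m + n = 0 then of_int (m * (m ^ 2 - 1)) / 24 else 0) v"
proof (cases "m + n = 0")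
  case False
  then show ?thesis using vir_commutator_generic[OF False, of v] by simp
next
  case True
  then have n: "n = - m" by simp
  have pos: "vir (int k) (vir (- int k) v) - vir (- int k) (vir (int k) v) = smul (of_int (2 * int k)) (vir 0 v)
     + smul (of_int (int k * (int k ^ 2 - 1)) / 24) v" for k
  proof -
    have "ip (vir_anomaly (int k) (- int k) \<Omega>) \<Omega> = of_int (int k * (int k ^ 2 - 1)) / 24"
      unfolding vir_anomaly_def by (simp add: ip_diff ip_scale ip_vir_vacuum ip_vir_vacuum_vacuum central_term)
    then have "vir_anomaly (int k) (- int k) v = smul (of_int (int k * (int k ^ 2 - 1)) / 24) v"
      using vir_anomaly_scalar[of "int k" "- int k" v] by simp
    then show ?thesis by (simp add: vir_anomaly_def algebra_simps)
  qed
  show ?thesis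
  proof (cases "m \<ge> 0")
    case True
    then obtain k where "m = int k" using nonneg_int_cases by blast
    then show ?thesis using pos[of k] by (simp add: n)
  next
    case False
    define k where "k = nat (- m)"
    have k: "m = - int k" using False by (simp add: k_def)
    have "vir m (vir n v) - vir n (vir m v) = - (smul (of_int (2 * int k)) (vir 0 v)
       + smul (of_int (int k * (int k ^ 2 - 1)) / 24) v)"
      unfolding pos[of k, symmetric] by (simp add: n k)
    also have "\<dots> = smul (of_int (m - n)) (vir (m + n) v) + smul (of_int (m * (m ^ 2 - 1)) / 24) v"
    proof -
      have "of_int (m - n) = (- of_int (2 * int k) :: complex)" "m + n = 0"
        "of_int (m * (m ^ 2 - 1)) / 24 = (- (of_int (int k * (int k ^ 2 - 1)) / 24) :: complex)"
        by (simp_all add: n k)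
      then show ?thesis by (simp only: scale_minus_left minus_add_distrib)
    qed
    finally show ?thesis using n by simp
  qed
qed

end

section \<open>The fields generated by the fermion field\<close>

lemma (in complex_space) vector_space_fields: "vector_space (field_scale smul)"
  by unfold_locales (simp_all add: field_scale_def fun_eq_iff algebra_simps)

context NS_module
begin

section \<open>Parity, good fields and Goddard uniqueness\<close>

definition par :: "bit \<Rightarrow> 'h set" where
  "par p = span {word ws | ws. creation ws \<and> int_parity (energy ws) = p}"

lemma subspace_par: "subspace (par p)"
  by (simp add: par_def)

lemma level_par: "level j \<subseteq> par (int_parity j)"
  unfolding level_def par_def by (rule span_mono) blast

lemma vacuum_par: "\<Omega> \<in> par 0"
  using vacuum_level level_par[of 0] by (auto simp: int_parity_def)

lemma psi_par:
  assumes "v \<in> par p"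
  shows "psi k v \<in> par (1 + p)"
  using assms unfolding par_def[of p]
proof (induction rule: span_induct_alt)
  case base
  then show ?case by (simp add: psi_zero subspace_0[OF subspace_par])
next
  case (step c x y)
  then obtain ws where ws: "x = word ws" "creation ws" "int_parity (energy ws) = p" by blast
  have "int_parity (energy ws - 2 * k - 1) = 1 + p"
    using ws(3) by (auto simp: int_parity_def split: if_splits)
  then have "psi k x \<in> par (1 + p)"
    using subsetD[OF level_par psi_level_word[OF ws(2)], of k] by (simp only: ws(1))
  then show ?case using step by (simp add: psi_add psi_scale subspace_add subspace_scale subspace_par del: add_bit_eq_xor)
qed

lemma par_decomposition: "\<exists>a\<in>par 0. \<exists>b\<in>par 1. v = a + b"
proof -
  have "{word ws | ws. creation ws} = {word ws | ws. creation ws \<and> int_parity (energy ws) = 0} \<union>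
      {word ws | ws. creation ws \<and> int_parity (energy ws) = 1}"
    by (auto simp: int_parity_def)
  then have "span ({word ws | ws. creation ws \<and> int_parity (energy ws) = 0} \<union>
      {word ws | ws. creation ws \<and> int_parity (energy ws) = 1}) = UNIV"
    by (simp only: span_creation[symmetric])
  then have "v \<in> {x + y | x y. x \<in> par 0 \<and> y \<in> par 1}"
    unfolding span_Un par_def by blast
  then show ?thesis by blast
qed

lemma par_orthogonal:
  assumes "u \<in> par p" "v \<in> par q" "p \<noteq> q"
  shows "ip u v = 0"
proof -
  have 1: "ip (word ws) v = 0" if ws: "creation ws" "int_parity (energy ws) = p" for ws
    using assms(2) unfolding par_def
  proof (induction rule: span_induct_alt)
    case (step c x y)
    then obtain us where us: "x = word us" "creation us" "int_parity (energy us) = q" by blast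
    have "ip (word ws) x = 0"
      unfolding us(1) by (rule level_orthogonal[OF word_level word_level]) (use us ws assms(3) in auto)
    then show ?case using step by (simp add: ip_add_right ip_scale_right)
  qed simp
  show ?thesis
    using assms(1) unfolding par_def
    by (induction rule: span_induct_alt) (auto simp: ip_add ip_scale 1)
qed

lemma par_inter: "u \<in> par p \<Longrightarrow> u \<in> par q \<Longrightarrow> p \<noteq> q \<Longrightarrow> u = 0"
  using par_orthogonal[of u p u q] by simp

text \<open>The fields of parity \<open>p\<close> that will turn out to form \<open>\<S>\<^sub>p\<close>; by Goddard's uniqueness theorem below
  they are determined by their states.\<close>

definition good :: "bit \<Rightarrow> 'h field set" where
  "good p = {A. is_field smul A \<and> smooth_field A \<and> (\<forall>n\<ge>0. A n \<Omega> = 0) \<and>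
     (\<forall>n v. vir (-1) (A n v) = A n (vir (-1) v) + smul (of_int (- n)) (A (n - 1) v)) \<and>
     formally_local p A psi \<and> (\<forall>n q. \<forall>v\<in>par q. A n v \<in> par (p + q))}"

lemma goodD:
  assumes "A \<in> good p"
  shows "is_field smul A" "smooth_field A" "n \<ge> 0 \<Longrightarrow> A n \<Omega> = 0"
    "vir (-1) (A n v) = A n (vir (-1) v) + smul (of_int (- n)) (A (n - 1) v)"
    "formally_local p A psi" "v \<in> par q \<Longrightarrow> A n v \<in> par (p + q)"
  using assms by (auto simp: good_def)

lemma good_state: "A \<in> good p \<Longrightarrow> A n \<Omega> \<in> par p"
  using goodD(6)[OF _ vacuum_par, of A p n] unfolding add_0_right .

lemma good_psi: "psi \<in> good 1"
proof -
  have "vir (-1) (psi n v) = psi n (vir (-1) v) + smul (of_int (- n)) (psi (n - 1) v)" for n v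
    using vir_psi[of "-1" n v] by simp
  then show ?thesis
    using psi_field smooth_psi vacuum_annihilated psi_local psi_par unfolding good_def by blast
qed

lemma is_field_id: "is_field smul field_id"
  by (rule is_fieldI) (simp_all add: field_id_def)

lemma good_id: "field_id \<in> good 0"
proof -
  have "smooth_field (field_id :: 'h field)"
    unfolding smooth_field_def field_id_def by (intro allI exI[of _ 0]) simp
  moreover have "formally_local 0 field_id psi"
    by (rule formally_local_sym) (rule formally_local_id[OF psi_field])
  moreover have "vir (-1) (field_id n v) = field_id n (vir (-1) v) + smul (of_int (- n)) (field_id (n - 1) v)" for n v
    by (simp add: field_id_def vir_zero)
  ultimately show ?thesis
    using is_field_id by (auto simp: good_def field_id_def subspace_0[OF subspace_par])
qed

lemma good_zero: "(\<lambda>n v. 0) \<in> good p"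
proof -
  have "is_field smul (\<lambda>n v. 0 :: 'h)" by (rule is_fieldI) simp_all
  moreover have "formally_local p (\<lambda>n v. 0) psi"
    by (rule formally_local_sym) (rule formally_local_zero[OF psi_field])
  ultimately show ?thesis
    by (auto simp: good_def smooth_field_def vir_zero subspace_0[OF subspace_par])
qed

lemma good_add:
  assumes A: "A \<in> good p" and B: "B \<in> good p"
  shows "(\<lambda>n v. A n v + B n v) \<in> good p"
proof -
  have "is_field smul (\<lambda>n v. A n v + B n v)"
    by (rule is_fieldI)
       (simp_all add: is_field_add[OF goodD(1)[OF A]] is_field_add[OF goodD(1)[OF B]] is_field_scale[OF goodD(1)[OF A]]
         is_field_scale[OF goodD(1)[OF B]] scale_right_distrib)
  moreover have "smooth_field (\<lambda>n v. A n v + B n v)"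
    unfolding smooth_field_def
  proof
    fix v
    obtain K where "\<And>n. n \<ge> K \<Longrightarrow> A n v = 0" "\<And>n. n \<ge> K \<Longrightarrow> B n v = 0"
      using smooth_field_bound[OF goodD(2)[OF A] goodD(2)[OF B]] by metis
    then show "\<exists>K. \<forall>n\<ge>K. A n v + B n v = 0" by (intro exI[of _ K]) simp
  qed
  moreover have "formally_local p (\<lambda>n v. A n v + B n v) psi"
    by (rule formally_local_sym, rule formally_local_add[OF psi_field])
       (rule formally_local_sym, rule goodD(5), rule A B)+
  moreover have "A n v + B n v \<in> par (p + q)" if "v \<in> par q" for n q v
    by (rule subspace_add[OF subspace_par]) (use goodD(6) A B that in blast)+
  moreover have "vir (-1) (A n v + B n v) = A n (vir (-1) v) + B n (vir (-1) v)
      + smul (of_int (- n)) (A (n - 1) v + B (n - 1) v)" for n v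
    by (simp add: vir_add goodD(4)[OF A] goodD(4)[OF B] scale_right_distrib)
  ultimately show ?thesis
    using goodD(3)[OF A] goodD(3)[OF B] unfolding good_def by auto
qed

lemma good_scale:
  assumes A: "A \<in> good p"
  shows "(\<lambda>n v. smul c (A n v)) \<in> good p"
proof -
  have "is_field smul (\<lambda>n v. smul c (A n v))"
    by (rule is_fieldI)
       (simp_all add: is_field_add[OF goodD(1)[OF A]] is_field_scale[OF goodD(1)[OF A]] scale_right_distrib mult.commute)
  moreover have "smooth_field (\<lambda>n v. smul c (A n v))"
    using goodD(2)[OF A] unfolding smooth_field_def by (metis scale_zero_right)
  moreover have "formally_local p (\<lambda>n v. smul c (A n v)) psi"
    by (rule formally_local_sym, rule formally_local_scale[OF psi_field], rule formally_local_sym, rule goodD(5), rule A)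
  moreover have "smul c (A n v) \<in> par (p + q)" if "v \<in> par q" for n q v
    by (rule subspace_scale[OF subspace_par]) (use goodD(6) A that in blast)
  moreover have "vir (-1) (smul c (A n v)) = smul c (A n (vir (-1) v)) + smul (of_int (- n)) (smul c (A (n - 1) v))" for n v
    by (simp add: vir_scale goodD(4)[OF A] scale_right_distrib scale_right_diff_distrib mult.commute)
  ultimately show ?thesis
    using goodD(3)[OF A] unfolding good_def by auto
qed

text \<open>The sign \<epsilon> is left free, because \<open>generated_fields\<close> allows every
  sign for which the factors are local; the parity of the product depends on p and q alone.\<close>

lemma good_prod:
  assumes A: "A \<in> good p" and B: "B \<in> good q" and loc: "formally_local \<epsilon> A B"
  shows "field_prod smul \<epsilon> n A B \<in> good (p + q)"
proof -
  note f = goodD(1)[OF A] goodD(1)[OF B] goodD(2)[OF A] goodD(2)[OF B]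
  have par: "field_prod smul \<epsilon> n A B m v \<in> par (p + q + r)" if v: "v \<in> par r" for m v r
  proof -
    obtain K where K: "\<And>K'. K' \<ge> K \<Longrightarrow> field_prod smul \<epsilon> n A B m v = (\<Sum>l<K'. prod_term \<epsilon> n A B m v l)"
      using field_prod_sum_bound[OF f] by metis
    have "A i (B j v) \<in> par (p + q + r)" "B j (A i v) \<in> par (p + q + r)" for i j
      using goodD(6)[OF A goodD(6)[OF B v], of i j] goodD(6)[OF B goodD(6)[OF A v], of j i] by (simp_all only: ac_simps)
    then have "prod_term \<epsilon> n A B m v l \<in> par (p + q + r)" for l
      unfolding prod_term_def by (intro subspace_scale subspace_diff subspace_par)
    then show ?thesis unfolding K[OF order_refl] by (intro subspace_sum subspace_par)
  qed
  have der: "vir (-1) (field_prod smul \<epsilon> n A B m v) = field_prod smul \<epsilon> n A B m (vir (-1) v)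
      + smul (of_int (- m)) (field_prod smul \<epsilon> n A B (m - 1) v)" for m v
    by (rule field_prod_derivation[OF f vir_linear]) (rule goodD(4)[OF A], rule goodD(4)[OF B])
  have vac: "field_prod smul \<epsilon> n A B m \<Omega> = 0" if "m \<ge> 0" for m
    by (rule field_prod_state(2)[OF f(1,2) goodD(3)[OF B] goodD(3)[OF A] that])
  show ?thesis
    unfolding good_def
    by (intro CollectI conjI allI impI ballI is_field_prod[OF f] smooth_field_prod[OF f] vac der par
      formally_local_prod[OF f(1,2) psi_field f(3,4) loc goodD(5)[OF A] goodD(5)[OF B]])
qed

text \<open>Goddard's uniqueness theorem: locality moves \<open>A\<close> past any product of modes of \<open>\<psi>\<close>, up to powers of
  \<open>z - w\<close>, and these can be cancelled because \<open>\<psi>\<close> is smooth.\<close>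

lemma good_unique:
  assumes A: "A \<in> good p" and zero: "A (-1) \<Omega> = 0"
  shows "A = (\<lambda>n v. 0)"
proof -
  \<comment> \<open>On the vacuum, translation covariance gives (j + 1) A(-j-2) as L_{-1} applied to
    A(-j-1), so the state determines all further modes.\<close>
  have neg: "A (- 1 - int j) \<Omega> = 0" for j
  proof (induction j)
    case (Suc j)
    have "smul (of_nat (Suc j)) (A (- 1 - int j - 1) \<Omega>) = 0"
      using goodD(4)[OF A, of "- 1 - int j" \<Omega>] Suc by (simp add: vir_vacuum is_field_zero[OF goodD(1)[OF A]] vir_zero add.commute)
    then have "A (- 1 - int j - 1) \<Omega> = 0" by (simp del: of_nat_Suc)
    then show ?case by (simp add: algebra_simps)
  qed (simp add: zero)
  have vac: "A n \<Omega> = 0" for n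
    using goodD(3)[OF A, of n] neg[of "nat (- 1 - n)"] by (cases "n \<ge> 0") auto
  obtain N where N: "\<And>v. (zw_mult ^^ N) (\<lambda>n m. scomm smul p (A n) (psi m) v) = (\<lambda>n m. 0)"
    using goodD(5)[OF A] by (auto simp: formally_local_def)
  have word: "A n (word ws) = 0" for n ws
  proof (induction ws arbitrary: n)
    case (Cons k ws)
    obtain M where M: "\<And>m. m \<ge> M \<Longrightarrow> psi m (word ws) = 0"
      using smooth_psi unfolding smooth_field_def by blast
    have "(\<lambda>n m. scomm smul p (A n) (psi m) (word ws)) = (\<lambda>n m. A n (psi m (word ws)))"
      by (simp add: scomm_def Cons psi_zero)
    then have "(zw_mult ^^ N) (\<lambda>n m. A n (psi m (word ws))) = (\<lambda>n m. 0)"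
      using N[of "word ws"] by simp
    then have "(\<lambda>n m. A n (psi m (word ws))) = (\<lambda>n m. 0)"
      by (rule zw_mult_pow_inj[of _ _ M]) (simp add: M is_field_zero[OF goodD(1)[OF A]])
    then have "A n (psi k (word ws)) = 0" by meson
    then show ?case by simp
  qed (simp add: vac)
  have "A n v = 0" for n v
    by (induction v rule: creation_induct)
       (simp_all add: word is_field_zero[OF goodD(1)[OF A]] is_field_add[OF goodD(1)[OF A]] is_field_scale[OF goodD(1)[OF A]])
  then show ?thesis by blast
qed

lemma good_eqI:
  assumes A: "A \<in> good p" and B: "B \<in> good p" and eq: "A (-1) \<Omega> = B (-1) \<Omega>"
  shows "A = B"
proof -
  have "(\<lambda>n v. A n v + smul (-1) (B n v)) = (\<lambda>n v. 0)"
    by (rule good_unique[OF good_add[OF A good_scale[OF B]]]) (simp add: eq)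
  then have "A n v - B n v = 0" for n v by (simp add: fun_eq_iff)
  then show ?thesis by (simp add: fun_eq_iff)
qed

text \<open>A(n) raises the doubled energy by e - 2 - 2n and creation words have nonnegative energy,
  so for very negative n all images lie above the energy of d.\<close>

lemma cosmooth_of_weight:
  assumes A: "is_field smul A"
    and wt: "\<And>n v. vir 0 (A n v) = A n (vir 0 v) + smul (of_int e / 2 - 1 - of_int n) (A n v)"
  shows "cosmooth_field ip A"
  unfolding cosmooth_field_def
proof
  show "\<exists>K. \<forall>n<K. \<forall>u. ip (A n u) d = 0" for d
  proof (induction d rule: creation_induct)
    case (add d d')
    then obtain K K' where "\<forall>n<K. \<forall>u. ip (A n u) d = 0" "\<forall>n<K'. \<forall>u. ip (A n u) d' = 0" by blast
    then show ?case by (intro exI[of _ "min K K'"]) (simp add: ip_add_right)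
  next
    case (word ds)
    \<comment> \<open>For n < K even the vacuum is sent strictly above the energy of
      \<open>ds\<close>.\<close>
    define K where "K = (e - 2 - energy ds) div 2"
    have "ip (A n u) (word ds) = 0" if n: "n < K" for n u
    proof (induction u rule: creation_induct)
      case (word us)
      have "vir 0 (A n (word us)) = smul (of_real (of_int (energy us + e - 2 - 2 * n) / 2)) (A n (word us))"
        unfolding wt vir0_level[OF word_level[OF word]] is_field_scale[OF A]
        by (simp add: diff_divide_distrib add_divide_distrib scale_left_diff_distrib scale_left_distrib)
      moreover have "energy us + e - 2 - 2 * n \<noteq> energy ds"
        using n energy_nonneg[OF word] unfolding K_def by linarith
      then have "real_of_int (energy us + e - 2 - 2 * n) / 2 \<noteq> real_of_int (energy ds) / 2"
        by (metis divide_cancel_right of_int_eq_iff zero_neq_numeral)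
      ultimately show ?case
        using vir0_orthogonal vir0_level_real[OF word_level[OF \<open>creation ds\<close>]] by blast
    qed (simp_all add: is_field_zero[OF A] is_field_add[OF A] is_field_scale[OF A] ip_add ip_scale)
    then show ?case by blast
  qed (auto simp: ip_scale_right)
qed

text \<open>The iterated product with state \<open>word ws\<close>. Since \<open>psi\<close> is odd,
  its locality sign with the inner field is the parity of that field.\<close>

primrec word_field :: "int list \<Rightarrow> 'h field" where
  "word_field [] = field_id"
| "word_field (k # ws) = field_prod smul (int_parity (energy ws)) k psi (word_field ws)"

lemma int_parity_Cons: "int_parity (energy (k # ws)) = 1 + int_parity (energy ws)"
  by (auto simp: int_parity_def)

lemma word_field_good: "word_field ws \<in> good (int_parity (energy ws))"
proof (induction ws)
  case Nil
  then show ?case using good_id by (simp add: int_parity_def)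
next
  case (Cons k ws)
  show ?case
    unfolding int_parity_Cons word_field.simps
    by (rule good_prod[OF good_psi Cons formally_local_sym[OF goodD(5)[OF Cons]]])
qed

lemma word_field_state: "word_field ws (-1) \<Omega> = word ws"
proof (induction ws)
  case (Cons k ws)
  then show ?case
    using field_prod_state(1)[OF psi_field goodD(1)[OF word_field_good[of ws]], where \<Omega> = \<Omega>]
      goodD(3)[OF word_field_good[of ws]] by (simp add: vacuum_annihilated)
qed (simp add: field_id_def)

text \<open>\<open>good\<close> demands locality with \<open>psi\<close> alone; Dong's lemma
  propagates it along the word, starting from the identity field.\<close>

lemma word_field_local:
  assumes C: "C \<in> good q"
  shows "formally_local (q * int_parity (energy ws)) C (word_field ws)"
proof (induction ws)
  case Nil
  then show ?case using formally_local_id[OF goodD(1)[OF C]] by (simp add: int_parity_def)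
next
  case (Cons k ws)
  have "formally_local (q + q * int_parity (energy ws)) (word_field (k # ws)) C"
    unfolding word_field.simps
    by (rule formally_local_prod[OF psi_field goodD(1)[OF word_field_good] goodD(1)[OF C] smooth_psi
          goodD(2)[OF word_field_good] formally_local_sym[OF goodD(5)[OF word_field_good]]])
       (rule formally_local_sym, rule goodD(5)[OF C] Cons)+
  moreover have "q + q * int_parity (energy ws) = q * int_parity (energy (k # ws))"
    unfolding int_parity_Cons by (simp only: distrib_left mult_1_right)
  ultimately show ?case by (metis formally_local_sym)
qed

lemma word_field_weight:
  "vir 0 (word_field ws n v) = word_field ws n (vir 0 v) + smul (of_int (energy ws) / 2 - 1 - of_int n) (word_field ws n v)"
proof (induction ws arbitrary: n v)
  case Nil
  then show ?case by (simp add: field_id_def vir_zero)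
next
  case (Cons k ws)
  have "vir 0 (word_field (k # ws) n v) = word_field (k # ws) n (vir 0 v)
     + smul (- 1 / 2 + (of_int (energy ws) / 2 - 1) - of_int k - of_int n) (word_field (k # ws) n v)"
    unfolding word_field.simps
    by (rule field_prod_weight[OF psi_field goodD(1)[OF word_field_good] smooth_psi goodD(2)[OF word_field_good]
          vir_linear, where \<alpha> = "- 1 / 2" and \<beta> = "of_int (energy ws) / 2 - 1"]) (rule psi_weight Cons)+
  moreover have "- 1 / 2 + (of_int (energy ws) / 2 - 1) - of_int k - of_int n
      = (of_int (energy (k # ws)) / 2 - 1 - of_int n :: complex)"
    by (simp add: field_simps)
  ultimately show ?case by simp
qed

lemma word_field_cosmooth: "cosmooth_field ip (word_field ws)"
  by (rule cosmooth_of_weight[OF goodD(1)[OF word_field_good]]) (rule word_field_weight)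

lemma psi_cosmooth: "cosmooth_field ip psi"
  by (rule cosmooth_of_weight[OF psi_field, of 1]) (simp add: psi_weight)

text \<open>The generating rule asks for analytic locality. The homogeneous word fields are
  cosmooth, so the formal locality contained in \<open>good\<close> supplies it.\<close>

lemma word_field_generated: "word_field ws \<in> generated_fields smul ip psi"
proof (induction ws)
  case Nil
  then show ?case by (simp add: generated_fields.identity)
next
  case (Cons k ws)
  have "local_fields ip (int_parity (energy ws)) psi (word_field ws)"
    using local_fields_iff_formally_local[OF psi_field goodD(1)[OF word_field_good] smooth_psi
        goodD(2)[OF word_field_good] psi_cosmooth word_field_cosmooth]
      formally_local_sym[OF goodD(5)[OF word_field_good]] by blast
  then show ?case
    by (simp add: generated_fields.product[OF generated_fields.generator Cons])
qed

section \<open>The span of the generated fields and the vertex map\<close>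

interpretation F: vector_space "field_scale smul"
  by (rule vector_space_fields)

lemma good_subspace: "F.subspace (good p)"
  by (rule F.subspaceI)
     (use good_zero good_add good_scale in \<open>simp_all add: zero_fun_def plus_fun_def field_scale_def\<close>)

text \<open>Besides surjectivity on states, this provides for one field with each state the
  properties that \<open>good\<close> does not contain; \<open>good_properties\<close> extends them
  to all fields by uniqueness.\<close>

lemma par_good_ex:
  assumes "a \<in> par p"
  shows "\<exists>A\<in>good p. A (-1) \<Omega> = a \<and> (\<forall>q. \<forall>C\<in>good q. formally_local (q * p) C A) \<and> cosmooth_field ip A
     \<and> A \<in> field_space smul ip psi"
  using assms unfolding par_def
proof (induction rule: span_induct_alt)
  case base
  have "0 \<in> field_space smul ip psi"
    unfolding field_space_def by (rule F.span_zero)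
  then show ?case
    using good_zero[of p] formally_local_zero[OF goodD(1)]
    by (intro bexI[of _ "\<lambda>n v. 0"]) (auto simp: cosmooth_field_def zero_fun_def)
next
  case (step c x y)
  then obtain ws where ws: "x = word ws" "creation ws" "int_parity (energy ws) = p" by blast
  from step obtain A where A: "A \<in> good p" "A (-1) \<Omega> = y" "\<And>q C. C \<in> good q \<Longrightarrow> formally_local (q * p) C A"
    "cosmooth_field ip A" "A \<in> field_space smul ip psi" by blast
  define W where "W = word_field ws"
  have W: "W \<in> good p" "W (-1) \<Omega> = x" "\<And>q C. C \<in> good q \<Longrightarrow> formally_local (q * p) C W"
    "cosmooth_field ip W" "W \<in> generated_fields smul ip psi"
    using word_field_good[of ws] word_field_state[of ws] word_field_local[of _ _ ws] word_field_cosmooth[of ws]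
      word_field_generated[of ws] by (simp_all only: W_def ws)
  let ?B = "\<lambda>n v. smul c (W n v) + A n v"
  have "field_scale smul c W + A \<in> field_space smul ip psi"
    unfolding field_space_def
    by (rule F.span_add[OF F.span_scale[OF F.span_base[OF W(5)]] A(5)[unfolded field_space_def]])
  then have "?B \<in> field_space smul ip psi"
    by (simp add: field_scale_def plus_fun_def)
  moreover have "?B \<in> good p" by (intro good_add good_scale W A)
  moreover have "formally_local (q * p) C ?B" if "C \<in> good q" for C q
    by (rule formally_local_add[OF goodD(1)[OF that] formally_local_scale[OF goodD(1)[OF that] W(3)[OF that]] A(3)[OF that]])
  moreover have "cosmooth_field ip ?B"
    unfolding cosmooth_field_def
  proof
    fix d
    obtain K1 where K1: "\<forall>n<K1. \<forall>u. ip (W n u) d = 0" using W(4) unfolding cosmooth_field_def by blast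
    obtain K2 where K2: "\<forall>n<K2. \<forall>u. ip (A n u) d = 0" using A(4) unfolding cosmooth_field_def by blast
    show "\<exists>K. \<forall>n<K. \<forall>u. ip (?B n u) d = 0"
      by (rule exI[of _ "min K1 K2"]) (use K1 K2 in \<open>simp add: ip_add ip_scale\<close>)
  qed
  ultimately show ?case
    by (intro bexI[of _ ?B]) (simp_all add: W A)
qed

lemma good_properties:
  assumes "A \<in> good p"
  shows "C \<in> good q \<Longrightarrow> formally_local (q * p) C A" "cosmooth_field ip A" "A \<in> field_space smul ip psi"
proof -
  obtain B where B: "B \<in> good p" "B (-1) \<Omega> = A (-1) \<Omega>" "\<And>q C. C \<in> good q \<Longrightarrow> formally_local (q * p) C B"
    "cosmooth_field ip B" "B \<in> field_space smul ip psi"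
    using par_good_ex[OF good_state[OF assms, of "-1"]] by blast
  have "B = A" by (rule good_eqI[OF B(1) assms B(2)])
  then show "C \<in> good q \<Longrightarrow> formally_local (q * p) C A" "cosmooth_field ip A" "A \<in> field_space smul ip psi"
    using B by auto
qed

lemma good_local_iff:
  assumes "A \<in> good p" "B \<in> good q"
  shows "local_fields ip \<epsilon> A B \<longleftrightarrow> formally_local \<epsilon> A B"
  using assms by (intro local_fields_iff_formally_local goodD(1,2) good_properties(2))

lemma good_deriv: "A \<in> good p \<Longrightarrow> field_deriv smul A \<in> good p"
  using good_prod[OF _ good_id formally_local_id, of A p "-2"] field_deriv_eq_prod[of A] goodD(1,2)[of A p]
  unfolding add_0_right by metis

text \<open>In the product case analytic locality is turned into formal locality. This is possible
  because good fields are already known to be cosmooth.\<close>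

lemma generated_good: "A \<in> generated_fields smul ip psi \<Longrightarrow> \<exists>p. A \<in> good p"
proof (induction rule: generated_fields.induct)
  case (product A B \<epsilon> n)
  then obtain p q where "A \<in> good p" "B \<in> good q" by blast
  then show ?case using good_prod[of A p B q \<epsilon>] good_local_iff[of A p B q \<epsilon>] product.hyps(3) by blast
qed (use good_id good_psi good_deriv in blast)+

lemma field_space_decomposition:
  assumes "A \<in> field_space smul ip psi"
  shows "\<exists>A0\<in>good 0. \<exists>A1\<in>good 1. A = A0 + A1"
proof -
  have g: "generated_fields smul ip psi \<subseteq> good 0 \<union> good 1"
  proof
    fix A assume "A \<in> generated_fields smul ip psi"
    then obtain p where "A \<in> good p" using generated_good by blast
    then show "A \<in> good 0 \<union> good 1" by (cases p) auto
  qed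
  have "A \<in> F.span (good 0 \<union> good 1)"
    using assms F.span_mono[OF g] unfolding field_space_def by blast
  then show ?thesis
    unfolding F.span_Un using good_subspace by (auto simp: F.span_eq_iff[THEN iffD2])
qed

lemma subspace_field_space: "F.subspace (field_space smul ip psi)"
  unfolding field_space_def by simp

text \<open>Uniqueness is available within one parity. Two fields with the same state differ by an
  even and an odd good field whose states add up to zero; lying in complementary parts, both states
  vanish.\<close>

lemma state_bij: "bij_betw (state \<Omega>) (field_space smul ip psi) UNIV"
proof (rule bij_betw_imageI)
  show "inj_on (state \<Omega>) (field_space smul ip psi)"
  proof (rule inj_onI)
    fix A B assume AB: "A \<in> field_space smul ip psi" "B \<in> field_space smul ip psi" "state \<Omega> A = state \<Omega> B"
    obtain D0 D1 where D: "D0 \<in> good 0" "D1 \<in> good 1" "A - B = D0 + D1"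
      using field_space_decomposition[OF F.subspace_diff[OF subspace_field_space AB(1,2)]] by blast
    have "D0 (-1) \<Omega> + D1 (-1) \<Omega> = 0"
      using AB(3) D(3) by (simp add: state_def fun_eq_iff) (metis right_minus_eq)
    then have "D0 (-1) \<Omega> = - D1 (-1) \<Omega>" by (simp add: eq_neg_iff_add_eq_0)
    moreover have "- D1 (-1) \<Omega> \<in> par 1"
      by (rule subspace_neg[OF subspace_par good_state[OF D(2)]])
    ultimately have "D0 (-1) \<Omega> = 0"
      using par_inter[of "D0 (-1) \<Omega>" 0 1] good_state[OF D(1), of "-1"] by simp
    moreover from this have "D1 (-1) \<Omega> = 0" using \<open>D0 (-1) \<Omega> = - D1 (-1) \<Omega>\<close> by simp
    ultimately have "D0 = 0" "D1 = 0"
      unfolding zero_fun_def by (blast intro: good_unique[OF D(1)] good_unique[OF D(2)])+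
    then show "A = B" using D(3) by simp
  qed
  have "\<exists>A\<in>field_space smul ip psi. A (-1) \<Omega> = v" for v
  proof -
    obtain a b where ab: "a \<in> par 0" "b \<in> par 1" "v = a + b" using par_decomposition by blast
    obtain A B where "A \<in> field_space smul ip psi" "B \<in> field_space smul ip psi" "A (-1) \<Omega> = a" "B (-1) \<Omega> = b"
      using par_good_ex[OF ab(1)] par_good_ex[OF ab(2)] by blast
    then show ?thesis
      using ab(3) F.subspace_add[OF subspace_field_space] by (intro bexI[of _ "A + B"]) simp_all
  qed
  then show "state \<Omega> ` field_space smul ip psi = UNIV"
    by (auto simp: state_def image_iff) metis
qed

definition V :: "'h \<Rightarrow> 'h field" where
  "V = vertex_map smul ip psi \<Omega>"

lemma V_field_space: "V a \<in> field_space smul ip psi"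
  unfolding V_def vertex_map_def
  by (rule the_inv_into_into[OF bij_betw_imp_inj_on[OF state_bij]]) (use state_bij in \<open>auto simp: bij_betw_def\<close>)

lemma V_state: "V a (-1) \<Omega> = a"
proof -
  have "state \<Omega> (V a) = a"
    unfolding V_def vertex_map_def by (rule f_the_inv_into_f_bij_betw[OF state_bij]) simp
  then show ?thesis by (simp add: state_def)
qed

lemma V_eqI: "A \<in> field_space smul ip psi \<Longrightarrow> A (-1) \<Omega> = a \<Longrightarrow> V a = A"
  unfolding V_def vertex_map_def
  using the_inv_into_f_f[OF bij_betw_imp_inj_on[OF state_bij]] by (auto simp: state_def)

lemma V_good: "a \<in> par p \<Longrightarrow> V a \<in> good p"
  using par_good_ex V_eqI by metis

text \<open>With this, locality and products in the superalgebra become statements about good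
  fields.\<close>

lemma V_par: "V ` par p = good p"
proof (intro subset_antisym subsetI)
  fix A assume A: "A \<in> good p"
  then have "V (A (-1) \<Omega>) = A" by (intro V_eqI good_properties(3)) auto
  then show "A \<in> V ` par p" using good_state[OF A] by (metis image_eqI)
qed (use V_good in blast)

lemma V_add: "V (a + b) = V a + V b"
  by (rule V_eqI) (simp_all add: F.subspace_add[OF subspace_field_space] V_field_space V_state)

lemma V_scale: "V (smul c a) = field_scale smul c (V a)"
  by (rule V_eqI)
     (simp_all add: F.subspace_scale[OF subspace_field_space] V_field_space V_state, simp add: field_scale_def V_state)

lemma V_linear: "Vector_Spaces.linear smul (field_scale smul) V"
  unfolding Vector_Spaces.linear_iff
  using vector_space_axioms vector_space_fields V_add V_scale by blast

lemma V_word: "V (word ws) = word_field ws"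
  by (rule V_eqI[OF good_properties(3)[OF word_field_good] word_field_state])

lemma V_vacuum: "V \<Omega> = field_id"
  using V_word[of "[]"] by simp

lemma V_psi: "V (psi (-1) \<Omega>) = psi"
  by (rule V_eqI[OF good_properties(3)[OF good_psi] refl])

lemma V_conformal: "V (smul (1 / 2) (psi (-2) (psi (-1) \<Omega>))) n = vir (n - 1)"
proof -
  have "word_field [-1] = psi"
    using V_word[of "[-1]"] V_psi by simp
  then have "word_field [-2, -1] = field_prod smul 1 (-2) psi psi"
    by (simp add: int_parity_def)
  then show ?thesis
    unfolding V_scale using V_word[of "[-2, -1]"] by (simp add: field_scale_def vir_def fun_eq_iff)
qed


section \<open>The vertex operator superalgebra\<close>

abbreviation eigenspace :: "real \<Rightarrow> 'h set" where
  "eigenspace \<alpha> \<equiv> {v. vir 0 v = smul (of_real \<alpha>) v}"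

text \<open>\<open>J\<close> is a set of doubled energies, so that one statement covers the grading
  of H and those of its even and odd parts.\<close>

lemma direct_sum_eigenspaces:
  assumes "N = (\<lambda>j. real_of_int j / 2) ` J"
  shows "direct_sum_on N eigenspace (span {word ws | ws. creation ws \<and> energy ws \<in> J})"
proof (rule direct_sum_on_orthogonal)
  show "subspace (eigenspace \<alpha>)" for \<alpha>
    by (rule subspaceI) (simp_all add: vir_zero vir_add vir_scale scale_right_distrib mult.commute)
  show "ip u v = 0" if "\<alpha> \<noteq> \<beta>" "u \<in> eigenspace \<alpha>" "v \<in> eigenspace \<beta>" for \<alpha> \<beta> u v
    using that vir0_orthogonal by blast
  have U: "(\<Union>\<alpha>\<in>N. eigenspace \<alpha>) = (\<Union>j\<in>J. level j)"
    unfolding assms image_image eigenspace_eq_level ..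
  show "span {word ws | ws. creation ws \<and> energy ws \<in> J} = span (\<Union>\<alpha>\<in>N. eigenspace \<alpha>)"
    unfolding U
  proof (rule subset_antisym)
    show "span {word ws | ws. creation ws \<and> energy ws \<in> J} \<subseteq> span (\<Union>j\<in>J. level j)"
      by (rule span_mono) (use word_level in blast)
    have "level j \<subseteq> span {word ws | ws. creation ws \<and> energy ws \<in> J}" if "j \<in> J" for j
      unfolding level_def by (rule span_mono) (use that in blast)
    then show "span (\<Union>j\<in>J. level j) \<subseteq> span {word ws | ws. creation ws \<and> energy ws \<in> J}"
      by (intro span_minimal subspace_span) blast
  qed
qed

lemma half_naturals: "{real k / 2 | k. True} = (\<lambda>j. real_of_int j / 2) ` {0..}"
proof (intro subset_antisym subsetI)
  fix x assume "x \<in> (\<lambda>j. real_of_int j / 2) ` {0..}"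
  then obtain j where "x = real_of_int j / 2" "j \<ge> 0" by auto
  then have "x = real (nat j) / 2" by simp
  then show "x \<in> {real k / 2 | k. True}" by blast
next
  fix x assume "x \<in> {real k / 2 | k. True}"
  then obtain k where "x = real k / 2" by blast
  then show "x \<in> (\<lambda>j. real_of_int j / 2) ` {0..}" by (intro image_eqI[of _ _ "int k"]) simp_all
qed

lemma even_levels: "{real k | k. True} = (\<lambda>j. real_of_int j / 2) ` {j. j \<ge> 0 \<and> int_parity j = 0}"
proof (intro subset_antisym subsetI)
  fix x assume "x \<in> (\<lambda>j. real_of_int j / 2) ` {j. j \<ge> 0 \<and> int_parity j = 0}"
  then obtain j where j: "x = real_of_int j / 2" "j \<ge> 0" "even j"
    by (auto simp: int_parity_def split: if_splits)
  then obtain i where "j = 2 * i" by (elim evenE)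
  then have "x = real (nat i)" using j by simp
  then show "x \<in> {real k | k. True}" by blast
next
  fix x assume "x \<in> {real k | k. True}"
  then obtain k where "x = real k" by blast
  then show "x \<in> (\<lambda>j. real_of_int j / 2) ` {j. j \<ge> 0 \<and> int_parity j = 0}"
    by (intro image_eqI[of _ _ "2 * int k"]) (simp_all add: int_parity_def)
qed

lemma odd_levels: "{real k + 1 / 2 | k. True} = (\<lambda>j. real_of_int j / 2) ` {j. j \<ge> 0 \<and> int_parity j = 1}"
proof (intro subset_antisym subsetI)
  fix x assume "x \<in> (\<lambda>j. real_of_int j / 2) ` {j. j \<ge> 0 \<and> int_parity j = 1}"
  then obtain j where j: "x = real_of_int j / 2" "j \<ge> 0" "odd j"
    by (auto simp: int_parity_def split: if_splits)
  then obtain i where "j = 2 * i + 1" by (elim oddE)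
  then have "x = real (nat i) + 1 / 2" using j by simp
  then show "x \<in> {real k + 1 / 2 | k. True}" by blast
next
  fix x assume "x \<in> {real k + 1 / 2 | k. True}"
  then obtain k where "x = real k + 1 / 2" by blast
  then show "x \<in> (\<lambda>j. real_of_int j / 2) ` {j. j \<ge> 0 \<and> int_parity j = 1}"
    by (intro image_eqI[of _ _ "2 * int k + 1"]) (simp_all add: int_parity_def field_simps)
qed

lemma energy_ge_0: "creation ws \<Longrightarrow> energy ws \<ge> 0"
  using energy_nonneg[of ws] by linarith

lemma grading: "direct_sum_on {real k / 2 | k. True} eigenspace UNIV"
proof -
  have "{word ws | ws. creation ws \<and> energy ws \<in> {0..}} = {word ws | ws. creation ws}"
    using energy_ge_0 by auto
  then show ?thesis
    using direct_sum_eigenspaces[OF half_naturals] by (simp only: span_creation)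
qed

lemma parity_grading:
  "direct_sum_on {real k | k. True} eigenspace (par 0)"
  "direct_sum_on {real k + 1 / 2 | k. True} eigenspace (par 1)"
proof -
  have "{word ws | ws. creation ws \<and> energy ws \<in> {j. j \<ge> 0 \<and> int_parity j = p}} =
      {word ws | ws. creation ws \<and> int_parity (energy ws) = p}" for p
    using energy_ge_0 by auto
  then show "direct_sum_on {real k | k. True} eigenspace (par 0)"
    "direct_sum_on {real k + 1 / 2 | k. True} eigenspace (par 1)"
    using direct_sum_eigenspaces[OF even_levels] direct_sum_eigenspaces[OF odd_levels] by (simp_all only: par_def)
qed

lemma energy_bound: "creation ws \<Longrightarrow> k \<in> set ws \<Longrightarrow> - 2 * k - 1 \<le> energy ws"
proof (induction ws)
  case (Cons a ws)
  then show ?case using energy_ge_0[of ws] by auto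
qed simp

text \<open>Each letter of a creation word contributes at least 1 to the doubled energy, which
  bounds the length, and at most the total, which bounds the letter; so finitely many words span a
  level.\<close>

lemma level_finite_dim: "\<exists>B. finite B \<and> span B = level j"
proof (intro exI conjI)
  have "ws \<in> {xs. set xs \<subseteq> {- j - 1..0} \<and> length xs \<le> nat j}" if ws: "creation ws" "energy ws = j" for ws
  proof -
    have "k \<in> {- j - 1..0}" if k: "k \<in> set ws" for k
    proof -
      have "k < 0" using ws k by (simp add: creation_def)
      moreover have "- 2 * k - 1 \<le> j" using energy_bound[OF ws(1) k] ws by simp
      ultimately show ?thesis by simp
    qed
    then show ?thesis using energy_nonneg[OF ws(1)] ws by auto
  qed
  then have "{word ws | ws. creation ws \<and> energy ws = j} \<subseteq> word ` {xs. set xs \<subseteq> {- j - 1..0} \<and> length xs \<le> nat j}"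
    by blast
  then show "finite {word ws | ws. creation ws \<and> energy ws = j}"
    by (rule finite_subset) (intro finite_imageI finite_lists_length_le finite_atLeastAtMost_int)
  show "span {word ws | ws. creation ws \<and> energy ws = j} = level j"
    by (simp add: level_def)
qed

text \<open>An increasing filtration that measures progress in the irreducibility proof, where
  vectors need not be homogeneous.\<close>

definition bounded_energy :: "int \<Rightarrow> 'h set" where
  "bounded_energy N = span {word ws | ws. creation ws \<and> energy ws \<le> N}"

lemma level_bounded_energy: "j \<le> N \<Longrightarrow> level j \<subseteq> bounded_energy N"
  unfolding level_def bounded_energy_def by (rule span_mono) blast

lemma psi_bounded_energy:
  assumes "v \<in> bounded_energy N"
  shows "psi k v \<in> bounded_energy (N - 2 * k - 1)"
  using assms unfolding bounded_energy_def[of N]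
proof (induction rule: span_induct_alt)
  case base
  then show ?case by (simp add: psi_zero bounded_energy_def span_zero)
next
  case (step c x y)
  then obtain ws where ws: "x = word ws" "creation ws" "energy ws \<le> N" by blast
  have "psi k x \<in> bounded_energy (N - 2 * k - 1)"
    using subsetD[OF level_bounded_energy psi_level_word[OF ws(2)], of k "N - 2 * k - 1"] ws by simp
  then show ?case using step by (simp add: psi_add psi_scale bounded_energy_def span_add span_scale)
qed

lemma bounded_energy_neg: "N < 0 \<Longrightarrow> bounded_energy N = {0}"
proof -
  assume "N < 0"
  then have "{word ws | ws. creation ws \<and> energy ws \<le> N} = {}"
    using energy_ge_0 by force
  then show ?thesis unfolding bounded_energy_def by (simp only: span_empty)
qed

lemma bounded_energy_ex: "\<exists>N::nat. v \<in> bounded_energy (int N)"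
proof (induction v rule: creation_induct)
  case zero
  then show ?case by (simp add: bounded_energy_def span_zero)
next
  case (add u v)
  then obtain M N :: nat where "u \<in> bounded_energy (int M)" "v \<in> bounded_energy (int N)" by blast
  moreover have "bounded_energy (int M) \<subseteq> bounded_energy (int (max M N))"
    "bounded_energy (int N) \<subseteq> bounded_energy (int (max M N))"
    unfolding bounded_energy_def by (rule span_mono; force)+
  ultimately have "u + v \<in> bounded_energy (int (max M N))"
    unfolding bounded_energy_def by (intro span_add) auto
  then show ?case by blast
next
  case (scale c u)
  then show ?case unfolding bounded_energy_def using span_scale by blast
next
  case (word ws)
  have "word ws \<in> bounded_energy (energy ws)"
    by (rule subsetD[OF level_bounded_energy word_level[OF word]]) simp
  then show ?case
    by (intro exI[of _ "nat (energy ws)"]) (simp add: energy_ge_0[OF word])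
qed

text \<open>Annihilation modes are applied to a nonzero vector of W as long as one of them gives a
  nonzero result. The energy bound drops each time, so this ends at a vector killed by all of them,
  a nonzero multiple of the vacuum, which generates H.\<close>

lemma irreducible:
  assumes W: "subspace W" and inv: "\<And>n. psi n ` W \<subseteq> W"
  shows "W = {0} \<or> W = UNIV"
proof (cases "W = {0}")
  case False
  then obtain w where w: "w \<in> W" "w \<noteq> 0" using subspace_0[OF W] by blast
  have "\<Omega> \<in> W" if "w \<in> W" "w \<noteq> 0" "w \<in> bounded_energy (int N)" for w N
    using that
  proof (induction N arbitrary: w rule: less_induct)
    case (less N)
    show ?case
    proof (cases "\<forall>k\<ge>0. psi k w = 0")
      case True
      then have eq: "w = smul (ip w \<Omega>) \<Omega>" by (intro vacuum_unique) auto
      then have "ip w \<Omega> \<noteq> 0" using less.prems(2) by (metis scale_zero_left)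
      then have "\<Omega> = smul (1 / ip w \<Omega>) w" by (subst eq) simp
      then show ?thesis using subspace_scale[OF W less.prems(1)] by metis
    next
      case False
      then obtain k where k: "k \<ge> 0" "psi k w \<noteq> 0" by blast
      define M where "M = int N - 2 * k - 1"
      have M: "psi k w \<in> bounded_energy M"
        unfolding M_def by (rule psi_bounded_energy[OF less.prems(3)])
      then have "M \<ge> 0" using k(2) bounded_energy_neg[of M] by force
      then have "nat M < N" "int (nat M) = M" using k(1) by (simp_all add: M_def)
      then show ?thesis using less.IH[of "nat M" "psi k w"] M k inv less.prems(1) by auto
    qed
  qed
  then have vac: "\<Omega> \<in> W" using w bounded_energy_ex by blast
  have "word ws \<in> W" for ws
    by (induction ws) (use vac inv in auto)
  then have "v \<in> W" for v
    by (induction v rule: creation_induct)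
       (use subspace_0[OF W] subspace_add[OF W] subspace_scale[OF W] in auto)
  then show ?thesis by blast
qed simp

section \<open>Transport of the structure along the vertex map\<close>

lemma UNIV_bit_eq: "(UNIV :: bit set) = {0, 1}"
  by auto

lemma finite_bit_set: "finite (A :: bit set)"
  by (rule finite_subset[OF subset_UNIV]) (simp only: UNIV_bit_eq finite.intros)

lemma V_zero: "V 0 = 0"
  using V_scale[of 0 0] by (simp add: field_scale_def zero_fun_def)

lemma V_sum: "V (\<Sum>i\<in>A. f i) = (\<Sum>i\<in>A. V (f i))"
  by (induction A rule: infinite_finite_induct) (simp_all add: V_add V_zero)

lemma V_eq_0: "V a = 0 \<Longrightarrow> a = 0"
  using V_state[of a] by simp

lemma direct_sum_par: "direct_sum_on UNIV par UNIV"
proof (rule direct_sum_on_orthogonal)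
  show "ip u v = 0" if "i \<noteq> j" "u \<in> par i" "v \<in> par j" for i j u v
    using par_orthogonal that by blast
  have "v \<in> span (\<Union>i. par i)" for v
  proof -
    obtain a b where "a \<in> par 0" "b \<in> par 1" "v = a + b" using par_decomposition by blast
    then show ?thesis by (metis UN_I UNIV_I span_add span_base)
  qed
  then show "UNIV = span (\<Union>i. par i)" by blast
qed (rule subspace_par)

text \<open>V is linear and injective, so independence is checked on states, where the two parities
  are orthogonal.\<close>

lemma direct_sum_fields: "direct_sum_on UNIV (\<lambda>\<epsilon>. V ` par \<epsilon>) (range V)"
proof (rule direct_sum_onI)
  fix u assume "u \<in> range V"
  then obtain a where a: "u = V a" by blast
  obtain b c where bc: "b \<in> par 0" "c \<in> par 1" "a = b + c" using par_decomposition by blast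
  define f where "f i = (if i = (0 :: bit) then V b else V c)" for i
  have "(\<Sum>i | f i \<noteq> 0. f i) = (\<Sum>i\<in>UNIV. f i)"
    by (rule sum.mono_neutral_left) (auto simp: UNIV_bit_eq)
  also have "\<dots> = u"
    unfolding UNIV_bit_eq by (simp add: f_def a bc V_add)
  finally have s: "(\<Sum>i | f i \<noteq> 0. f i) = u" .
  have "f i \<in> V ` par i" for i
    using bc by (cases i) (auto simp: f_def)
  then show "\<exists>f. finite {i. f i \<noteq> 0} \<and> (\<forall>i\<in>UNIV. f i \<in> V ` par i) \<and> (\<forall>i. i \<notin> UNIV \<longrightarrow> f i = 0)
      \<and> (\<Sum>i | f i \<noteq> 0. f i) = u"
    using s finite_bit_set by (intro exI[of _ f]) simp
next
  fix f :: "bit \<Rightarrow> 'h field"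
  assume "\<forall>i\<in>UNIV. f i \<in> V ` par i"
  then have "\<forall>i. \<exists>a. f i = V a" by blast
  then obtain a where "\<And>i. f i = V (a i)" by metis
  then show "(\<Sum>i | f i \<noteq> 0. f i) \<in> range V" by (simp flip: V_sum)
next
  fix i x y assume "x \<in> V ` par i" "y \<in> V ` par i"
  then obtain a b where ab: "a \<in> par i" "b \<in> par i" "x = V a" "y = V b" by blast
  have "x = V (a - b) + y" using V_add[of "a - b" b] ab by simp
  then have "x - y = V (a - b)" by simp
  then show "x - y \<in> V ` par i" using subspace_diff[OF subspace_par ab(1,2)] by blast
next
  fix f :: "bit \<Rightarrow> 'h field" and A
  assume A: "finite A" "\<forall>i\<in>A. f i \<in> V ` par i" "(\<Sum>i\<in>A. f i) = 0"
  then have "\<forall>i\<in>A. \<exists>a. a \<in> par i \<and> f i = V a" by blast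
  then obtain a where a: "\<And>i. i \<in> A \<Longrightarrow> a i \<in> par i" "\<And>i. i \<in> A \<Longrightarrow> f i = V (a i)" by metis
  have "V (\<Sum>i\<in>A. a i) = 0" using A(3) a(2) by (simp add: V_sum)
  then have "(\<Sum>i\<in>A. a i) = 0" by (rule V_eq_0)
  then have "a j = 0" if "j \<in> A" for j
    by (rule orthogonal_sum_zero[OF A(1) _ _ that]) (use a(1) par_orthogonal in blast)
  then show "\<forall>i\<in>A. f i = 0" using a(2) V_zero by simp
qed

text \<open>A general vector has mixed parity, so its field need not be good for any parity;
  properties linear in the field are checked on the two components.\<close>

lemma V_cases: obtains A0 A1 where "A0 \<in> good 0" "A1 \<in> good 1" "V a = A0 + A1"
  using field_space_decomposition[OF V_field_space[of a]] by blast

lemma V_is_field: "is_field smul (V a)"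
proof -
  obtain A B where A: "A \<in> good 0" and B: "B \<in> good 1" and V: "V a = A + B" by (rule V_cases)
  show ?thesis
    unfolding V
    by (rule is_fieldI)
       (simp_all add: is_field_add[OF goodD(1)[OF A]] is_field_add[OF goodD(1)[OF B]] is_field_scale[OF goodD(1)[OF A]]
         is_field_scale[OF goodD(1)[OF B]] scale_right_distrib)
qed

lemma V_annihilates: "n \<ge> 0 \<Longrightarrow> V a n \<Omega> = 0"
proof -
  obtain A B where A: "A \<in> good 0" and B: "B \<in> good 1" and V: "V a = A + B" by (rule V_cases)
  show "n \<ge> 0 \<Longrightarrow> V a n \<Omega> = 0"
    unfolding V by (simp add: goodD(3)[OF A] goodD(3)[OF B])
qed

lemma V_translation: "vir (-1) (V a n v) - V a n (vir (-1) v) = field_deriv smul (V a) n v"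
proof -
  obtain A B where A: "A \<in> good 0" and B: "B \<in> good 1" and V: "V a = A + B" by (rule V_cases)
  show ?thesis
    unfolding V by (simp add: goodD(4)[OF A] goodD(4)[OF B] vir_add field_deriv_def scale_right_distrib scale_right_diff_distrib)
qed

lemma V_deriv: "field_deriv smul (V a) = V (vir (-1) a)"
proof (rule sym, rule V_eqI)
  obtain A B where A: "A \<in> good 0" and B: "B \<in> good 1" and V: "V a = A + B" by (rule V_cases)
  have "field_deriv smul (V a) = field_deriv smul A + field_deriv smul B"
    by (simp add: V field_deriv_def fun_eq_iff scale_right_distrib)
  moreover have "field_deriv smul A + field_deriv smul B \<in> field_space smul ip psi"
    using good_properties(3)[OF good_deriv[OF A]] good_properties(3)[OF good_deriv[OF B]]
      module.span_add[OF vector_space_fields[unfolded module_iff_vector_space[symmetric]]]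
    unfolding field_space_def by blast
  ultimately show "field_deriv smul (V a) \<in> field_space smul ip psi" by simp
  show "field_deriv smul (V a) (- 1) \<Omega> = vir (- 1) a"
    using V_translation[of a "-1" \<Omega>] by (simp add: V_state vir_vacuum is_field_zero[OF V_is_field])
qed

text \<open>The claim is linear in a, so words suffice. The factor j/2 - 1 - m splits into the
  weight j/2 and -(m + 1), the coefficient coming from z V'.\<close>

lemma V_weight:
  assumes "a \<in> level j"
  shows "vir 0 (V a m v) - V a m (vir 0 v) = field_deriv smul (V a) (m + 1) v + smul (of_int j / 2) (V a m v)"
proof -
  have "vir 0 (V a m v) = V a m (vir 0 v) + smul (of_int j / 2 - 1 - of_int m) (V a m v)"
    using assms unfolding level_def
  proof (induction rule: span_induct_alt)
    case base
    then show ?case by (simp add: V_zero vir_zero)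
  next
    case (step c x y)
    then obtain ws where ws: "x = word ws" "creation ws" "energy ws = j" by blast
    have "vir 0 (V x m v) = V x m (vir 0 v) + smul (of_int j / 2 - 1 - of_int m) (V x m v)"
      using word_field_weight[of ws m v] by (simp only: ws V_word)
    then show ?case
      using step.IH unfolding V_add V_scale
      by (simp add: field_scale_def vir_add vir_scale scale_right_distrib mult.commute)
  qed
  moreover have "field_deriv smul (V a) (m + 1) v = smul (- 1 - of_int m) (V a m v)"
    by (simp add: field_deriv_def algebra_simps flip: scale_minus_left)
  ultimately show ?thesis
    by (simp flip: scale_left_distrib)
qed

lemma V_locality: "A \<in> V ` par p \<Longrightarrow> B \<in> V ` par q \<Longrightarrow> local_fields ip (p * q) A B"
  unfolding V_par using good_local_iff good_properties(1) by blast

lemma V_products: "A \<in> V ` par p \<Longrightarrow> B \<in> V ` par q \<Longrightarrow> field_prod smul (p * q) n A B \<in> V ` par (p + q)"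
  unfolding V_par by (rule good_prod) (assumption | rule good_properties(1))+

lemma is_vertex_operator_superalgebra:
  "vertex_operator_superalgebra smul ip par V \<Omega> (smul (1 / 2) (psi (-2) (psi (-1) \<Omega>)))"
proof -
  define \<omega> where "\<omega> = smul (1 / 2) (psi (-2) (psi (-1) \<Omega>))"
  have L: "V \<omega> n = vir (n - 1)" for n
    unfolding \<omega>_def by (rule V_conformal)
  have L': "V \<omega> 1 = vir 0" "V \<omega> (n + 1) = vir n" for n
    by (simp_all add: L)
  have \<omega>: "\<omega> = vir (-2) \<Omega>" by (simp add: \<omega>_def vir_vacuum_conformal)
  have level: "eigenspace (real k / 2) = level (int k)" for k
    using eigenspace_eq_level[of "int k"] by simp
  have "vertex_operator_superalgebra smul ip par V \<Omega> \<omega>"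
  proof (rule vertex_operator_superalgebra.intro)
    show "prehilbert smul ip" ..
    show "vertex_operator_superalgebra_axioms smul ip par V \<Omega> \<omega>"
    proof (rule vertex_operator_superalgebra_axioms.intro, unfold L')
      show "\<forall>\<epsilon>. subspace (par \<epsilon>)" by (simp add: subspace_par)
      show "direct_sum_on UNIV par UNIV" by (rule direct_sum_par)
      show "\<forall>a. is_field smul (V a)" by (simp add: V_is_field)
      show "Vector_Spaces.linear smul (field_scale smul) V" by (rule V_linear)
      show "direct_sum_on UNIV (\<lambda>\<epsilon>. V ` par \<epsilon>) (range V)" by (rule direct_sum_fields)
      show "\<forall>A\<in>range V. \<forall>n\<ge>0. A n \<Omega> = 0" by (auto simp: V_annihilates)
      show "\<forall>a. V a (- 1) \<Omega> = a" by (simp add: V_state)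
      show "V \<Omega> = field_id" by (rule V_vacuum)
      show "\<exists>v::'h. v \<noteq> 0" using vacuum_nonzero by blast
      \<comment> \<open>\<open>psi\<close> is itself one of the vertex operators, so stability under
        all of them includes stability under its modes.\<close>
      show "\<forall>W. subspace W \<and> (\<forall>A\<in>range V. \<forall>n. A n ` W \<subseteq> W) \<longrightarrow> W = {0} \<or> W = UNIV"
        using irreducible V_psi by (metis rangeI)
      show "\<forall>\<epsilon>\<^sub>1 \<epsilon>\<^sub>2. \<forall>A\<in>V ` par \<epsilon>\<^sub>1. \<forall>B\<in>V ` par \<epsilon>\<^sub>2. local_fields ip (\<epsilon>\<^sub>1 * \<epsilon>\<^sub>2) A B"
        using V_locality by blast
      show "\<forall>\<epsilon>\<^sub>1 \<epsilon>\<^sub>2. \<forall>A\<in>V ` par \<epsilon>\<^sub>1. \<forall>B\<in>V ` par \<epsilon>\<^sub>2. \<forall>n.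
          field_prod smul (\<epsilon>\<^sub>1 * \<epsilon>\<^sub>2) n A B \<in> V ` par (\<epsilon>\<^sub>1 + \<epsilon>\<^sub>2)"
        using V_products by blast
      show "vir 0 \<Omega> = 0" "vir (- 1) \<Omega> = 0" by (simp_all add: vir_vacuum)
      show "\<omega> = vir (- 2) \<Omega>" by (rule \<omega>)
      \<comment> \<open>With squared norm 1/4 the required constant 2 * (1/4) / 12 is 1/24.\<close>
      show "\<forall>m n v. vir m (vir n v) - vir n (vir m v) = smul (of_int (m - n)) (vir (m + n) v) +
          smul (if m + n = 0 then 2 * ip \<omega> \<omega> / 12 * of_int (m * (m\<^sup>2 - 1)) else 0) v"
        by (simp add: virasoro_relation \<omega> conformal_norm)
      show "direct_sum_on {real k / 2 | k. True} eigenspace UNIV" by (rule grading)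
      show "\<forall>n\<in>{real k / 2 | k. True}. \<exists>B. finite B \<and> span B = eigenspace n"
      proof
        fix n assume "n \<in> {real k / 2 | k. True}"
        then obtain k where "n = real k / 2" by blast
        then show "\<exists>B. finite B \<and> span B = eigenspace n"
          using level_finite_dim[of "int k"] level[of k] by (simp only:)
      qed
      show "\<forall>n\<in>{real k / 2 | k. True}. \<forall>m\<in>{real k / 2 | k. True}. n \<noteq> m \<longrightarrow>
          (\<forall>u\<in>eigenspace n. \<forall>v\<in>eigenspace m. ip u v = 0)"
        using vir0_orthogonal by blast
      show "direct_sum_on {real k | k. True} eigenspace (par 0)"
        "direct_sum_on {real k + 1 / 2 | k. True} eigenspace (par 1)" by (rule parity_grading)+
      show "\<Omega> \<in> eigenspace 0" by (simp add: vir_vacuum)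
      \<comment> \<open>The letters -2 and -1 have doubled energies 3 and 1, so the weight is
        2.\<close>
      have "\<omega> \<in> level 4"
        unfolding \<omega>_def using word_level[of "[-2, -1]"] by (auto intro!: subspace_scale subspace_level)
      then show "\<omega> \<in> eigenspace 2" by (simp add: vir0_level)
      show "\<forall>\<alpha>\<in>{real k / 2 | k. True}. \<forall>a\<in>eigenspace \<alpha>. \<forall>m v.
          vir 0 (V a m v) - V a m (vir 0 v) = field_deriv smul (V a) (m + 1) v + smul (of_real \<alpha>) (V a m v)"
      proof (intro ballI allI)
        fix \<alpha> a m v assume "\<alpha> \<in> {real k / 2 | k. True}" "a \<in> eigenspace \<alpha>"
        then obtain k where k: "\<alpha> = real k / 2" "a \<in> level (int k)" using level by blast
        show "vir 0 (V a m v) - V a m (vir 0 v) = field_deriv smul (V a) (m + 1) v + smul (of_real \<alpha>) (V a m v)"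
          using V_weight[OF k(2)] by (simp add: k(1))
      qed
      show "\<forall>a m v. vir (- 1) (V a m v) - V a m (vir (- 1) v) = field_deriv smul (V a) m v"
        by (simp add: V_translation)
      show "\<forall>a. field_deriv smul (V a) = V (vir (- 1) a)" by (simp add: V_deriv)
      show "\<forall>a. field_deriv smul (V a) \<in> range V" by (simp add: V_deriv)
    qed
  qed
  then show ?thesis unfolding \<omega>_def .
qed

end

theorem corollary3p84:
  fixes smul :: "complex \<Rightarrow> 'h::ab_group_add \<Rightarrow> 'h"
    and ip :: "'h \<Rightarrow> 'h \<Rightarrow> complex"
    and psi :: "int \<Rightarrow> 'h \<Rightarrow> 'h"
    and I :: "'h \<Rightarrow> 'h"
    and \<Omega> :: 'h
  assumes "NS_module smul ip psi I \<Omega>"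
  shows "bij_betw (state \<Omega>) (field_space smul ip psi) UNIV \<and>
    (\<exists>par. vertex_operator_superalgebra smul ip par (vertex_map smul ip psi \<Omega>) \<Omega>
       (smul (1 / 2) (psi (-2) (psi (-1) \<Omega>))))"
proof -
  interpret NS_module smul ip psi I \<Omega> by (rule assms)
  show ?thesis
    using state_bij is_vertex_operator_superalgebra unfolding V_def by blast
qed

end
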